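(* Let $\boldsymbol{X}=\{X_n\}_{n\ge 1}$ be a sequence of real random variables satisfying condition C2 (stated in the context) with a continuous distribution function $F$, a positive sequence $\boldsymbol{\alpha}=\{\alpha_n\}_{n\ge1}$ and a non-decreasing real sequence $\{\ell_n\}_{n\ge 1}$. Let $N_n:=\sum_{k=1}^n I_k$ be the number of records in $\boldsymbol{X}$ up to time $n$, and put $s_n:=\sum_{k=1}^n\alpha_k$, $p_n:=\alpha_n/s_n$, $E_n:=\sum_{k=1}^n p_k$, $V_n:=\sum_{k=1}^n p_k(1-p_k)$. Then: (A1) $N_n\to\infty$ a.s. as $n\to\infty$. (A2) $\lim_{n\to\infty}N_n/E_n=1$ a.s. (A3) $\lim_{n\to\infty}(N_n-E_n)/\ln s_n=0$ a.s. If $p_n\to0$ then $\lim_{n\to\infty}N_n/\ln s_n=1$ a.s., while if $p_n\to1$ then $\lim_{n\to\infty}N_n/\ln s_n=0$ a.s. (A4) If $\lim_{n\to\infty}V_n<\infty$ then $N_n-E_n$ converges a.s. to a proper (a.s. finite) random variable as $n\to\infty$, while if $\lim_{n\to\infty}V_n=\infty$ then $V_n^{-1/2}(N_n-E_n)$ converges in distribution to a standard normal random variable.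
   Context: For a sequence $\boldsymbol{X}=\{X_n\}_{n\ge 1}$ of random variables on a common probability space, $M_n:=\max_{1\le k\le n}X_k$ ($n\ge1$) are the partial maxima, and $I_1:=1$, $I_n:=\mathbf{1}(X_n>M_{n-1})$ ($n\ge 2$) are the record indicators. The $F^\alpha$-scheme specified by a continuous distribution function (d.f.) $F$ and a positive sequence $\boldsymbol{\alpha}=\{\alpha_n\}_{n\ge 1}$ is a sequence $\boldsymbol{\mathcal{X}}=\{\mathcal{X}_n\}_{n\ge1}$ of independent random variables such that $\mathcal{X}_n$ has d.f. $F^{\alpha_n}$, $n\ge1$. Its partial maxima are $\mathcal{M}_n:=\max_{1\le k\le n}\mathcal{X}_k$. "ev." (eventually) means "for all sufficiently large $n$". For a d.f. $G$, $G^{\leftarrow}(u):=\inf\{x\in\mathbb{R}: G(x)\ge u\}$, $u\in(0,1)$, and $G^{\leftarrow}(1-)$ is its left limit at $1$. $F_n$ denotes the d.f. of $X_n$, and $F_{n|x_1,\ldots,x_{n-1}}(x_n):=\mathbf{P}(X_n\le x_n\mid X_1=x_1,\ldots,X_{n-1}=x_{n-1})$ is the conditional d.f. of $X_n$ given the preceding observations. Condition C2: there exist a continuous d.f. $F$, a positive sequence $\boldsymbol{\alpha}$ with $\lim_{n\to\infty}s_n=\infty$, and a non-decreasing real sequence $\{\ell_n\}_{n\ge1}$ such that: (i) $F_n^{\leftarrow}(1-)\le F^{\leftarrow}(1-)$ for $n\ge1$; (ii) $F_{n|x_1,\ldots,x_{n-1}}(x_n)=F_n(x_n)$ for $x_n\ge\ell_n$,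 $x_j\in\mathbb{R}$, $1\le j<n$, $n\ge2$; (iii) $\sum_{n\ge1}\delta_n<\infty$, where $\delta_n:=\int_{(\ell_n,\infty)}|d(F_n-F^{\alpha_n})|$ is the total variation distance between the restrictions of the distributions $F_n$ and $F^{\alpha_n}$ to the half-line $(\ell_n,\infty)$; (iv) $\mathbf{P}(\mathcal{M}_n>\ell_n\ \text{ev.})=1$ for the partial maxima $\{\mathcal{M}_n\}$ of the $F^\alpha$-scheme specified by $F$ and $\boldsymbol{\alpha}$.
   Formalization: The formal statement also assumes P(X_n = F^←(1−)) = 0 for all n≥1: C2(i) allows an atom of X_n at a finite right endpoint of F, after which no records occur and (A1) fails (e.g. F uniform on [0,1], P(X_1=1)=1/2). *)

theory Defs
  imports "HOL-Probability.Probability"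
begin

section \<open>Records\<close>

text \<open>Sequences are indexed by \<open>n \<ge> 1\<close>; the entry at index \<open>0\<close> is never used.\<close>

definition partial_max :: "(nat \<Rightarrow> 'a \<Rightarrow> real) \<Rightarrow> nat \<Rightarrow> 'a \<Rightarrow> real" where
  "partial_max X n \<omega> = Max ((\<lambda>k. X k \<omega>) ` {1..n})"

definition record_indicator :: "(nat \<Rightarrow> 'a \<Rightarrow> real) \<Rightarrow> nat \<Rightarrow> 'a \<Rightarrow> real" where
  "record_indicator X n \<omega> =
     (if n = 1 then 1 else of_bool (n \<ge> 2 \<and> X n \<omega> > partial_max X (n - 1) \<omega>))"

definition num_records :: "(nat \<Rightarrow> 'a \<Rightarrow> real) \<Rightarrow> nat \<Rightarrow> 'a \<Rightarrow> real" where
  "num_records X n \<omega> = (\<Sum>k=1..n. record_indicator X k \<omega>)"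

definition s_seq :: "(nat \<Rightarrow> real) \<Rightarrow> nat \<Rightarrow> real" where
  "s_seq \<alpha> n = (\<Sum>k=1..n. \<alpha> k)"

definition p_seq :: "(nat \<Rightarrow> real) \<Rightarrow> nat \<Rightarrow> real" where
  "p_seq \<alpha> n = \<alpha> n / s_seq \<alpha> n"

definition E_seq :: "(nat \<Rightarrow> real) \<Rightarrow> nat \<Rightarrow> real" where
  "E_seq \<alpha> n = (\<Sum>k=1..n. p_seq \<alpha> k)"

definition V_seq :: "(nat \<Rightarrow> real) \<Rightarrow> nat \<Rightarrow> real" where
  "V_seq \<alpha> n = (\<Sum>k=1..n. p_seq \<alpha> k * (1 - p_seq \<alpha> k))"

section \<open>Distribution functions\<close>

definition is_df :: "(real \<Rightarrow> real) \<Rightarrow> bool" where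
  "is_df G \<longleftrightarrow> mono G \<and> (\<forall>x. continuous (at_right x) G) \<and>
     (G \<longlongrightarrow> 0) at_bot \<and> (G \<longlongrightarrow> 1) at_top"

definition quantile :: "(real \<Rightarrow> real) \<Rightarrow> real \<Rightarrow> real" where
  "quantile G u = Inf {x. G x \<ge> u}"

text \<open>The left limit of the quantile function at \<open>1\<close>; it may be \<open>\<infinity>\<close>, hence the
  extended reals (for a distribution function the limit exists by monotonicity).\<close>

definition quantile_left_lim_1 :: "(real \<Rightarrow> real) \<Rightarrow> ereal" where
  "quantile_left_lim_1 G = Lim (at_left 1) (\<lambda>u. ereal (quantile G u))"

text \<open>The total mass on \<open>S\<close> of the total variation measure of the signed measure
  \<open>\<mu> - \<nu>\<close> (so without a factor \<open>1/2\<close>), as the supremum over finite families of disjoint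
  Borel subsets of \<open>S\<close>. For probability measures the sums are bounded by \<open>2\<close>, so the real
  supremum is meaningful.\<close>

definition total_variation_on :: "real measure \<Rightarrow> real measure \<Rightarrow> real set \<Rightarrow> real" where
  "total_variation_on \<mu> \<nu> S =
     (SUP \<A> \<in> {\<A>. finite \<A> \<and> disjoint \<A> \<and> (\<forall>A\<in>\<A>. A \<in> sets borel \<and> A \<subseteq> S)}.
        \<Sum>A\<in>\<A>. \<bar>measure \<mu> A - measure \<nu> A\<bar>)"

section \<open>Conditional distribution functions\<close>

definition past :: "(nat \<Rightarrow> 'a \<Rightarrow> real) \<Rightarrow> nat \<Rightarrow> 'a \<Rightarrow> nat \<Rightarrow> real" where
  "past X n \<omega> = (\<lambda>k\<in>{1..<n}. X k \<omega>)"

definition past_algebra :: "'a measure \<Rightarrow> (nat \<Rightarrow> 'a \<Rightarrow> real) \<Rightarrow> nat \<Rightarrow> 'a measure" where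
  "past_algebra M X n =
     vimage_algebra (space M) (past X n) (\<Pi>\<^sub>M k\<in>{1..<n}. (borel :: real measure))"

text \<open>\<open>G xs x\<close> is a version of the regular conditional distribution function
  \<open>P(X\<^sub>n \<le> x | X\<^sub>1 = xs 1, \<dots>, X\<^bsub>n-1\<^esub> = xs (n-1))\<close>. Versions differ only on null sets of \<open>xs\<close>.\<close>

definition is_cond_df ::
    "'a measure \<Rightarrow> (nat \<Rightarrow> 'a \<Rightarrow> real) \<Rightarrow> nat \<Rightarrow> ((nat \<Rightarrow> real) \<Rightarrow> real \<Rightarrow> real) \<Rightarrow> bool" where
  "is_cond_df M X n G \<longleftrightarrow>
     (\<forall>xs \<in> {1..<n} \<rightarrow>\<^sub>E UNIV. is_df (G xs)) \<and>
     (\<forall>x. (\<lambda>xs. G xs x) \<in> borel_measurable (\<Pi>\<^sub>M k\<in>{1..<n}. (borel :: real measure))) \<and>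
     (\<forall>x. AE \<omega> in M. G (past X n \<omega>) x =
        real_cond_exp M (past_algebra M X n) (indicator {\<omega>' \<in> space M. X n \<omega>' \<le> x}) \<omega>)"

section \<open>The F-alpha scheme and condition C2\<close>

definition Falpha_scheme ::
    "'b measure \<Rightarrow> (nat \<Rightarrow> 'b \<Rightarrow> real) \<Rightarrow> (real \<Rightarrow> real) \<Rightarrow> (nat \<Rightarrow> real) \<Rightarrow> bool" where
  "Falpha_scheme N Y F \<alpha> \<longleftrightarrow>
     prob_space N \<and> prob_space.indep_vars N (\<lambda>_. borel) Y {1..} \<and>
     (\<forall>n\<ge>1. \<forall>x. cdf (distr N borel (Y n)) x = F x powr \<alpha> n)"

definition delta_seq ::
    "'a measure \<Rightarrow> (nat \<Rightarrow> 'a \<Rightarrow> real) \<Rightarrow> (real \<Rightarrow> real) \<Rightarrow> (nat \<Rightarrow> real) \<Rightarrow> (nat \<Rightarrow> real) \<Rightarrow> nat \<Rightarrow> real"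
  where
  "delta_seq M X F \<alpha> l n =
     total_variation_on (distr M borel (X n)) (interval_measure (\<lambda>x. F x powr \<alpha> n)) {l n<..}"

text \<open>\<open>(N, Y)\<close> is the F-alpha scheme in whose terms the last clause is phrased; it may live on
  a different probability space than \<open>X\<close>, and only its law, determined by \<open>F\<close> and \<open>\<alpha>\<close>, matters.\<close>

definition condition_C2 ::
    "'a measure \<Rightarrow> (nat \<Rightarrow> 'a \<Rightarrow> real) \<Rightarrow> (real \<Rightarrow> real) \<Rightarrow> (nat \<Rightarrow> real) \<Rightarrow> (nat \<Rightarrow> real) \<Rightarrow>
     'b measure \<Rightarrow> (nat \<Rightarrow> 'b \<Rightarrow> real) \<Rightarrow> bool" where
  "condition_C2 M X F \<alpha> l N Y \<longleftrightarrow>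
     is_df F \<and> continuous_on UNIV F \<and>
     (\<forall>n\<ge>1. 0 < \<alpha> n) \<and> filterlim (s_seq \<alpha>) at_top sequentially \<and>
     mono_on {1..} l \<and>
     (\<forall>n\<ge>1. quantile_left_lim_1 (cdf (distr M borel (X n))) \<le> quantile_left_lim_1 F) \<and>
     (\<forall>n\<ge>2. \<exists>G. is_cond_df M X n G \<and>
        (\<forall>xs \<in> {1..<n} \<rightarrow>\<^sub>E UNIV. \<forall>x\<ge>l n. G xs x = cdf (distr M borel (X n)) x)) \<and>
     summable (\<lambda>n. delta_seq M X F \<alpha> l (Suc n)) \<and>
     Falpha_scheme N Y F \<alpha> \<and>
     (AE \<omega> in N. eventually (\<lambda>n. partial_max Y n \<omega> > l n) sequentially)"

text \<open>The quantile inequality in \<open>condition_C2\<close> still allows some \<open>X n\<close> to have an atom exactly at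
  a finite upper endpoint \<open>e\<close> of the law \<open>F\<close>. On the event \<open>X n = e\<close> there are almost surely no
  records after time \<open>n\<close>, so that the number of records stays bounded. Example: \<open>F\<close> uniform on
  \<open>[0,1]\<close>, \<open>\<alpha> = 1\<close>, \<open>l = 0\<close>, the \<open>X n\<close> independent, uniform for \<open>n \<ge> 2\<close>, and \<open>P(X 1 = 1) = 1/2\<close>
  (otherwise uniform). The following condition excludes such atoms; it holds
  automatically when that endpoint is infinite or the distribution functions of the \<open>X n\<close> are
  continuous.\<close>

definition no_endpoint_atom ::
    "'a measure \<Rightarrow> (nat \<Rightarrow> 'a \<Rightarrow> real) \<Rightarrow> (real \<Rightarrow> real) \<Rightarrow> bool" where
  "no_endpoint_atom M X F \<longleftrightarrow>
     (\<forall>n\<ge>1. AE \<omega> in M. ereal (X n \<omega>) \<noteq> quantile_left_lim_1 F)"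

end

theory Submission
  imports Defs "HOL-Real_Asymp.Real_Asymp"
begin

text \<open>
Why the record counts behave like sums of independent indicators.

The case to which everything is reduced is the \<open>F\<^sup>\<alpha>\<close>-scheme itself. There the records form
independent events, and the event of a record at time \<open>n\<close> has probability \<open>p\<^sub>n = \<alpha>\<^sub>n / s\<^sub>n\<close>: if the
maximum of the first \<open>n\<close> observations has distribution function \<open>F\<^sup>s\<close> with \<open>s = s\<^sub>n\<close>, the next observation, with exponent
\<open>\<alpha> = \<alpha>\<^bsub>n+1\<^esub>\<close>, is a record below \<open>x\<close> with probability \<open>\<integral> F\<^sup>s d(F\<^sup>\<alpha>)\<close> over the values up to \<open>x\<close>, which is
\<open>\<alpha> / (s + \<alpha>)\<close> times \<open>F\<^bsup>s+\<alpha>\<^esup>(x)\<close>; the factorisation is the independence of the new record from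
the new maximum (\<open>prob_records_below\<close>, \<open>record_indicators_independent_trials\<close>). For independent
indicators with mean \<open>E\<^sub>n\<close> and variance \<open>V\<^sub>n\<close> of their sums, Chebyshev along the first times at which
\<open>E\<close> reaches \<open>k\<^sup>2\<close> gives \<open>N\<^sub>n / E\<^sub>n \<rightarrow> 1\<close>, Borel--Cantelli gives the convergence of \<open>N\<^sub>n - E\<^sub>n\<close> when
\<open>V\<close> is bounded, and characteristic functions give the central limit theorem when it is not.

For a sequence \<open>X\<close> under condition C2, only the values above the thresholds \<open>l\<^sub>n\<close> matter. The
truncations \<open>max X\<^sub>n l\<^sub>n\<close> are independent, because above \<open>l\<^sub>n\<close> the conditional distribution function does
not depend on the past (\<open>truncations_indep\<close>), and the law of \<open>max X\<^sub>n l\<^sub>n\<close> is within \<open>2\<delta>\<^sub>n\<close> of the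
law of \<open>max Y\<^sub>n l\<^sub>n\<close>, where \<open>Y\<close> is the scheme. Coupling the two truncated sequences coordinate by
coordinate, one obtains copies which agree from some random time on (\<open>independent_coupling\<close>).
All values lie strictly below the right endpoint of \<open>F\<close>, and the maxima of the scheme climb to that
endpoint; hence whatever happened before the coupling time is eventually overtaken, and the
two sequences of record indicators agree from some time on (\<open>partial_max_eventually_eq\<close>).
Truncation too changes only finitely many record indicators once the maxima have passed the
thresholds for good (\<open>truncation_keeps_records\<close>).

So the record counts of \<open>Y\<close>, of its truncation, of the two coupled copies, of the truncation of
\<open>X\<close> and of \<open>X\<close> are linked by steps which either preserve the law of the sequence or change the count by
an eventually constant amount. The limit statements collected in \<open>record_limits\<close> survive both kinds of
steps. What remains of the claim follows from \<open>N\<^sub>n / E\<^sub>n \<rightarrow> 1\<close> by comparing \<open>E\<^sub>n\<close> with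
\<open>ln s\<^sub>n\<close>, whose increments are \<open>- ln (1 - p\<^sub>n)\<close>.
\<close>

section \<open>The norming sequences\<close>

text \<open>The Stolz--Cesaro rule: once every increment of \<open>A\<close> is within a factor \<open>L \<plusminus> r/2\<close> of the increment
of \<open>B\<close>, so are the accumulated increments, and the finitely many earlier ones are negligible
against \<open>B\<close>.\<close>
lemma stolz_cesaro:
  fixes A B :: "nat \<Rightarrow> real"
  assumes mono: "\<And>n. n \<ge> m \<Longrightarrow> B n < B (Suc n)" and lim: "filterlim B at_top sequentially"
    and ratio: "(\<lambda>n. (A (Suc n) - A n) / (B (Suc n) - B n)) \<longlonglongrightarrow> L"
  shows "(\<lambda>n. A n / B n) \<longlonglongrightarrow> L"
proof (rule LIMSEQ_I)
  fix r :: real assume r: "r > 0"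
  obtain k0 where k0: "\<And>n. n \<ge> k0 \<Longrightarrow> \<bar>(A (Suc n) - A n) / (B (Suc n) - B n) - L\<bar> < r/2"
    using LIMSEQ_D[OF ratio, of "r/2"] r by auto
  define k where "k = max k0 m"
  have incr: "\<bar>(A (Suc n) - A n) - L * (B (Suc n) - B n)\<bar> \<le> r/2 * (B (Suc n) - B n)" if "n \<ge> k" for n
  proof -
    have d: "B (Suc n) - B n > 0" using mono[of n] that by (simp add: k_def)
    have "(A (Suc n) - A n) - L * (B (Suc n) - B n) =
        ((A (Suc n) - A n) / (B (Suc n) - B n) - L) * (B (Suc n) - B n)"
      using d by (simp add: field_simps)
    then show ?thesis
      using k0[of n] that d by (simp add: abs_mult k_def mult_right_mono less_imp_le)
  qed
  have acc: "\<bar>(A n - A k) - L * (B n - B k)\<bar> \<le> r/2 * (B n - B k)" if "n \<ge> k" for n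
    using that
  proof (induction n rule: dec_induct)
    case base then show ?case by simp
  next
    case (step n)
    have e: "(A (Suc n) - A k) - L * (B (Suc n) - B k) =
       ((A n - A k) - L * (B n - B k)) + ((A (Suc n) - A n) - L * (B (Suc n) - B n))"
      by (simp add: algebra_simps)
    have "r/2 * (B (Suc n) - B k) = r/2 * (B n - B k) + r/2 * (B (Suc n) - B n)"
      by (simp add: field_simps)
    then show ?case unfolding e using step.IH incr[of n] step.hyps by linarith
  qed
  \<comment> \<open>\<open>C\<close> collects what the first \<open>k\<close> terms contribute, so that \<open>r / 2\<close> of the room is left for them.\<close>
  define C where "C = \<bar>A k - L * B k\<bar> + r/2 * \<bar>B k\<bar>"
  have "\<forall>\<^sub>F n in sequentially. B n > max 1 (2 * C / r + 1)"
    using lim filterlim_at_top_dense by blast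
  moreover have "\<forall>\<^sub>F n in sequentially. n \<ge> k" by (rule eventually_ge_at_top)
  ultimately have "\<forall>\<^sub>F n in sequentially. norm (A n / B n - L) < r"
  proof eventually_elim
    case (elim n)
    have B: "B n > 0" and BC: "2 * C / r < B n" using elim by auto
    have "\<bar>A n - L * B n\<bar> \<le> \<bar>A k - L * B k\<bar> + r/2 * (B n - B k)"
      using acc[OF elim(2)] by (simp add: right_diff_distrib)
    also have "\<dots> \<le> C + r/2 * B n"
    proof -
      have "- (r/2 * B k) \<le> r/2 * \<bar>B k\<bar>" using r mult_left_mono[of "- B k" "\<bar>B k\<bar>" "r/2"] by simp
      then show ?thesis by (simp add: C_def algebra_simps)
    qed
    also have "\<dots> < r * B n" using BC r by (simp add: field_simps)
    finally have "\<bar>A n - L * B n\<bar> < r * B n" .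
    moreover have "A n / B n - L = (A n - L * B n) / B n" using B by (simp add: field_simps)
    ultimately show ?case using B by (simp add: abs_divide divide_less_eq)
  qed
  then show "\<exists>no. \<forall>n\<ge>no. norm (A n / B n - L) < r" by (simp add: eventually_sequentially)
qed

locale growing_weights =
  fixes \<alpha> :: "nat \<Rightarrow> real"
  assumes weight_pos: "\<And>n. n \<ge> 1 \<Longrightarrow> 0 < \<alpha> n"
    and s_at_top: "filterlim (s_seq \<alpha>) at_top sequentially"
begin

lemma s_0 [simp]: "s_seq \<alpha> 0 = 0" by (simp add: s_seq_def)

lemma s_Suc: "s_seq \<alpha> (Suc n) = s_seq \<alpha> n + \<alpha> (Suc n)" by (simp add: s_seq_def)

lemma s_nonneg: "0 \<le> s_seq \<alpha> n"
  unfolding s_seq_def by (intro sum_nonneg) (use weight_pos in \<open>auto intro: less_imp_le\<close>)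

lemma s_pos: "n \<ge> 1 \<Longrightarrow> 0 < s_seq \<alpha> n"
  by (cases n) (auto simp: s_Suc intro!: add_nonneg_pos s_nonneg weight_pos)

lemma p_pos: "n \<ge> 1 \<Longrightarrow> 0 < p_seq \<alpha> n"
  by (simp add: p_seq_def weight_pos s_pos)

lemma one_minus_p: "1 - p_seq \<alpha> (Suc n) = s_seq \<alpha> n / s_seq \<alpha> (Suc n)"
  using s_pos[of "Suc n"] by (simp add: p_seq_def s_Suc field_simps)

lemma p_le_1: "p_seq \<alpha> n \<le> 1"
proof (cases n)
  case 0 then show ?thesis by (simp add: p_seq_def)
next
  case (Suc k) then show ?thesis using one_minus_p[of k] s_nonneg[of k] s_nonneg[of n]
    by (smt (verit) divide_nonneg_nonneg)
qed

lemma p_first: "p_seq \<alpha> 1 = 1"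
  using one_minus_p[of 0] by simp

lemma p_less_1: "n \<ge> 1 \<Longrightarrow> p_seq \<alpha> (Suc n) < 1"
  using one_minus_p[of n] s_pos[of n] s_pos[of "Suc n"] by (smt (verit) divide_pos_pos le_SucI)

lemma E_Suc: "E_seq \<alpha> (Suc n) = E_seq \<alpha> n + p_seq \<alpha> (Suc n)" by (simp add: E_seq_def)

lemma E_0 [simp]: "E_seq \<alpha> 0 = 0" by (simp add: E_seq_def)

lemma E_mono: "mono (E_seq \<alpha>)"
  using p_pos by (intro incseq_SucI) (simp add: E_Suc less_imp_le)

text \<open>Each \<open>p\<^sub>k\<close> with \<open>m < k \<le> n\<close> is at least \<open>\<alpha>\<^sub>k / s\<^sub>n\<close>. Consequently \<open>E\<close> grows by
at least nearly \<open>1\<close> over every stretch on which \<open>s\<close> grows by a large factor, and cannot be bounded.\<close>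
lemma E_increment_lower:
  assumes "m \<le> n" "n \<ge> 1"
  shows "1 - s_seq \<alpha> m / s_seq \<alpha> n \<le> E_seq \<alpha> n - E_seq \<alpha> m"
  using assms
proof (induction n rule: dec_induct)
  case base then show ?case by (simp add: s_pos less_imp_neq[symmetric])
next
  case (step n)
  show ?case
  proof (cases "n \<ge> 1")
    case True
    have p: "0 < s_seq \<alpha> n" "0 < s_seq \<alpha> (Suc n)" using True by (auto intro: s_pos)
    have "1 - s_seq \<alpha> m / s_seq \<alpha> (Suc n) =
       (1 - s_seq \<alpha> m / s_seq \<alpha> n) * (s_seq \<alpha> n / s_seq \<alpha> (Suc n)) + p_seq \<alpha> (Suc n)"
    proof -
      have "(1 - s_seq \<alpha> m / s_seq \<alpha> n) * (s_seq \<alpha> n / s_seq \<alpha> (Suc n)) =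
          (s_seq \<alpha> n - s_seq \<alpha> m) / s_seq \<alpha> (Suc n)"
        using p(1) by (simp add: diff_divide_distrib left_diff_distrib)
      then show ?thesis
        using p(2) by (simp add: p_seq_def s_Suc diff_divide_distrib add_divide_distrib[symmetric])
    qed
    also have "\<dots> \<le> (E_seq \<alpha> n - E_seq \<alpha> m) * (s_seq \<alpha> n / s_seq \<alpha> (Suc n)) + p_seq \<alpha> (Suc n)"
      using step.IH[OF True] p by (intro add_right_mono mult_right_mono) auto
    also have "\<dots> \<le> (E_seq \<alpha> n - E_seq \<alpha> m) * 1 + p_seq \<alpha> (Suc n)"
      using monoD[OF E_mono step.hyps(1)] p s_Suc[of n] weight_pos[of "Suc n"]
      by (intro add_right_mono mult_left_mono) auto
    finally show ?thesis by (simp add: E_Suc)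
  next
    case False
    then have "n = 0" "m = 0" using step.hyps by auto
    then show ?thesis using p_first by (simp add: E_seq_def)
  qed
qed

lemma E_at_top: "filterlim (E_seq \<alpha>) at_top sequentially"
proof (rule ccontr)
  assume "\<not> ?thesis"
  then obtain C where C: "\<And>n. E_seq \<alpha> n \<le> C"
    unfolding filterlim_at_top eventually_sequentially
    by (metis E_mono linorder_le_cases monoD order_trans)
  then obtain L where L: "E_seq \<alpha> \<longlonglongrightarrow> L" "\<And>n. E_seq \<alpha> n \<le> L"
    using incseq_convergent[OF E_mono, of C] by blast
  have "1 \<le> L - E_seq \<alpha> m" for m
  proof (rule tendsto_le)
    show "(\<lambda>n. E_seq \<alpha> n - E_seq \<alpha> m) \<longlonglongrightarrow> L - E_seq \<alpha> m"
      by (intro tendsto_intros L)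
    show "(\<lambda>n. 1 - s_seq \<alpha> m / s_seq \<alpha> n) \<longlonglongrightarrow> 1"
      using tendsto_diff[OF tendsto_const, OF tendsto_divide_0[OF tendsto_const filterlim_at_top_imp_at_infinity[OF s_at_top]]]
      by (metis diff_zero)
    show "\<forall>\<^sub>F n in sequentially. 1 - s_seq \<alpha> m / s_seq \<alpha> n \<le> E_seq \<alpha> n - E_seq \<alpha> m"
      using eventually_ge_at_top[of "max m 1"] by eventually_elim (auto intro!: E_increment_lower)
  qed simp
  moreover have "(\<lambda>m. L - E_seq \<alpha> m) \<longlonglongrightarrow> L - L" by (intro tendsto_intros L)
  ultimately have "1 \<le> L - L" by (meson LIMSEQ_le_const)
  then show False by simp
qed

lemma ln_s_at_top: "filterlim (\<lambda>n. ln (s_seq \<alpha> n)) at_top sequentially"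
  by (rule filterlim_compose[OF ln_at_top s_at_top])

lemma ln_s_increment:
  assumes "n \<ge> 1"
  shows "ln (s_seq \<alpha> (Suc n)) - ln (s_seq \<alpha> n) = - ln (1 - p_seq \<alpha> (Suc n))"
  using s_pos[OF assms] s_pos[of "Suc n"] by (simp add: one_minus_p ln_div)

text \<open>The inequality \<open>p \<le> - ln (1 - p)\<close> bounds each increment of \<open>E\<close> by that of \<open>ln s\<close>. It lets an error
of order \<open>o(E\<^sub>n)\<close> be read as one of order \<open>o(ln s\<^sub>n)\<close>.\<close>
lemma E_le_ln_s:
  assumes "n \<ge> 1"
  shows "E_seq \<alpha> n \<le> ln (s_seq \<alpha> n) + (1 - ln (\<alpha> 1))"
  using assms
proof (induction n rule: dec_induct)
  case base then show ?case using p_first by (simp add: E_seq_def s_seq_def)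
next
  case (step n)
  have "p_seq \<alpha> (Suc n) \<le> - ln (1 - p_seq \<alpha> (Suc n))"
    using ln_add_one_self_le_self2[of "- p_seq \<alpha> (Suc n)"] p_less_1[of n] step.hyps by simp
  then show ?case using step ln_s_increment[of n] by (simp add: E_Suc)
qed

text \<open>The increments of \<open>E\<close> and \<open>ln s\<close> are \<open>p\<close> and \<open>- ln (1 - p)\<close>. The limit of their quotient is taken
inside \<open>(0,1)\<close>, because \<open>p\<^sub>n\<close> lies there for \<open>n \<ge> 2\<close>; so one statement serves both endpoints.\<close>
lemma E_over_ln_s_limit:
  assumes "((\<lambda>x. x / - ln (1 - x)) \<longlongrightarrow> L) (at a within {0<..<1})" and "p_seq \<alpha> \<longlonglongrightarrow> a"
    "a \<in> {0, 1}"
  shows "(\<lambda>n. E_seq \<alpha> n / ln (s_seq \<alpha> n)) \<longlonglongrightarrow> L"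
proof (rule stolz_cesaro[where m=1])
  show "ln (s_seq \<alpha> n) < ln (s_seq \<alpha> (Suc n))" if "n \<ge> 1" for n
    using s_pos[OF that] s_pos[of "Suc n"] weight_pos[of "Suc n"] by (simp add: s_Suc)
  have p: "filterlim (\<lambda>n. p_seq \<alpha> (Suc n)) (at a within {0<..<1}) sequentially"
    unfolding filterlim_at
  proof
    show "(\<lambda>n. p_seq \<alpha> (Suc n)) \<longlonglongrightarrow> a" using assms(2) by (rule LIMSEQ_Suc)
    show "\<forall>\<^sub>F n in sequentially. p_seq \<alpha> (Suc n) \<in> {0<..<1} \<and> p_seq \<alpha> (Suc n) \<noteq> a"
      using eventually_ge_at_top[of 1]
    proof eventually_elim
      case (elim n)
      then show ?case using p_pos[of "Suc n"] p_less_1[of n] assms(3) by auto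
    qed
  qed
  show "(\<lambda>n. (E_seq \<alpha> (Suc n) - E_seq \<alpha> n) / (ln (s_seq \<alpha> (Suc n)) - ln (s_seq \<alpha> n))) \<longlonglongrightarrow> L"
  proof (rule Lim_transform_eventually[OF filterlim_compose[OF assms(1) p]])
    show "\<forall>\<^sub>F n in sequentially. p_seq \<alpha> (Suc n) / - ln (1 - p_seq \<alpha> (Suc n)) =
      (E_seq \<alpha> (Suc n) - E_seq \<alpha> n) / (ln (s_seq \<alpha> (Suc n)) - ln (s_seq \<alpha> n))"
      using eventually_ge_at_top[of 1] by eventually_elim (simp add: E_Suc ln_s_increment)
  qed
qed (rule ln_s_at_top)

lemma E_over_ln_s_if_p_vanishes:
  assumes "p_seq \<alpha> \<longlonglongrightarrow> 0" shows "(\<lambda>n. E_seq \<alpha> n / ln (s_seq \<alpha> n)) \<longlonglongrightarrow> 1"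
proof (rule E_over_ln_s_limit[OF _ assms])
  have "((\<lambda>x::real. x / - ln (1 - x)) \<longlongrightarrow> 1) (at_right 0)" by real_asymp
  then show "((\<lambda>x::real. x / - ln (1 - x)) \<longlongrightarrow> 1) (at 0 within {0<..<1})"
    by (rule tendsto_within_subset) auto
qed simp

lemma E_over_ln_s_if_p_to_1:
  assumes "p_seq \<alpha> \<longlonglongrightarrow> 1" shows "(\<lambda>n. E_seq \<alpha> n / ln (s_seq \<alpha> n)) \<longlonglongrightarrow> 0"
proof (rule E_over_ln_s_limit[OF _ assms])
  have "((\<lambda>x::real. x / - ln (1 - x)) \<longlongrightarrow> 0) (at_left 1)" by real_asymp
  then show "((\<lambda>x::real. x / - ln (1 - x)) \<longlongrightarrow> 0) (at 1 within {0<..<1})"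
    by (rule tendsto_within_subset) auto
qed simp

end

section \<open>Auxiliary estimates and limit theorems\<close>

lemma exp_minus_bounds:
  fixes u :: real assumes "u \<ge> 0"
  shows "\<bar>exp (- u) - (1 - u)\<bar> \<le> u\<^sup>2 / 2"
proof -
  define f where "f u = 1 - u + u\<^sup>2 / 2 - exp (- u)" for u :: real
  have "f 0 \<le> f u"
  proof (rule DERIV_nonneg_imp_nondecreasing[OF assms])
    fix x :: real
    have "(f has_real_derivative (- 1 + x + exp (- x))) (at x)"
      unfolding f_def by (auto intro!: derivative_eq_intros)
    moreover have "0 \<le> - 1 + x + exp (- x)" using exp_ge_add_one_self[of "- x"] by simp
    ultimately show "\<exists>y. (f has_real_derivative y) (at x) \<and> 0 \<le> y" by blast
  qed
  then show ?thesis using exp_ge_add_one_self[of "- u"] by (simp add: f_def)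
qed

text \<open>By monotone convergence the sum of all the \<open>f\<^sub>n\<close> has a finite integral, hence is finite almost
everywhere.\<close>
lemma AE_tendsto_0_if_summable_integral:
  fixes f :: "nat \<Rightarrow> 'a \<Rightarrow> real"
  assumes f: "\<And>n. integrable M (f n)" and nonneg: "\<And>n x. 0 \<le> f n x"
    and summ: "summable (\<lambda>n. integral\<^sup>L M (f n))"
  shows "AE x in M. (\<lambda>n. f n x) \<longlonglongrightarrow> 0"
proof -
  have [measurable]: "f n \<in> borel_measurable M" for n using f by auto
  have "(\<integral>\<^sup>+x. (\<Sum>n. ennreal (f n x)) \<partial>M) = (\<Sum>n. (\<integral>\<^sup>+x. ennreal (f n x) \<partial>M))"
    by (intro nn_integral_suminf) auto
  also have "\<dots> = (\<Sum>n. ennreal (integral\<^sup>L M (f n)))"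
    using f nonneg by (intro suminf_cong nn_integral_eq_integral) auto
  also have "\<dots> = ennreal (\<Sum>n. integral\<^sup>L M (f n))"
    using nonneg by (intro suminf_ennreal2 summ integral_nonneg) auto
  also have "\<dots> < \<top>" by (rule ennreal_less_top)
  finally have "(\<integral>\<^sup>+x. (\<Sum>n. ennreal (f n x)) \<partial>M) \<noteq> \<infinity>"
    unfolding infinity_ennreal_def by (rule less_imp_neq)
  then have "AE x in M. (\<Sum>n. ennreal (f n x)) \<noteq> \<infinity>"
    by (rule nn_integral_PInf_AE[rotated]) measurable
  then show ?thesis
  proof eventually_elim
    case (elim x)
    then have "summable (\<lambda>n. f n x)" using nonneg by (intro summable_suminf_not_top) auto
    then show ?case by (rule summable_LIMSEQ_zero)
  qed
qed

text \<open>A strong law for a monotone count can be checked along a sparse set of times. At the first time when \<open>E\<close>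
reaches \<open>k\<^sup>2\<close> its value is at most \<open>k\<^sup>2 + 1\<close>, and the values at two successive such times have a ratio
tending to \<open>1\<close>; between them monotonicity of \<open>c\<close> and of \<open>E\<close> squeezes \<open>c / E\<close>.\<close>
lemma ratio_tendsto_1_from_squares:
  fixes c E :: "nat \<Rightarrow> real"
  assumes c: "mono c" and E: "mono E" "E 0 \<le> 0" and inc: "\<And>n. E (Suc n) \<le> E n + 1"
    and top: "filterlim E at_top sequentially"
    and lim: "(\<lambda>k. c (LEAST n. (real k)\<^sup>2 \<le> E n) / E (LEAST n. (real k)\<^sup>2 \<le> E n)) \<longlonglongrightarrow> 1"
  shows "(\<lambda>n. c n / E n) \<longlonglongrightarrow> 1"
proof -
  define m where "m k = (LEAST n. (real k)\<^sup>2 \<le> E n)" for k :: nat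
  define r where "r k = c (m k) / E (m k)" for k
  have r: "r \<longlonglongrightarrow> 1" using lim by (simp add: r_def[abs_def] m_def[abs_def])
  have ex: "\<exists>n. x \<le> E n" for x
    using top by (metis eventually_sequentially filterlim_at_top order_refl)
  have m_le: "(real k)\<^sup>2 \<le> E (m k)" for k unfolding m_def by (rule LeastI_ex[OF ex])
  have m_up: "E (m k) \<le> (real k)\<^sup>2 + 1" for k
  proof (cases "m k")
    case 0 then show ?thesis using E(2) zero_le_power2[of "real k"] by (metis add_increasing2 order_trans zero_le_one)
  next
    case (Suc j)
    have "j < (LEAST n. (real k)\<^sup>2 \<le> E n)" using Suc unfolding m_def by simp
    from not_less_Least[OF this] have "E j < (real k)\<^sup>2" by simp
    then show ?thesis using inc[of j] unfolding Suc by linarith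
  qed
  \<comment> \<open>\<open>n\<close> lies between the times at which \<open>E\<close> reaches \<open>k\<^sup>2\<close> and \<open>(k + 1)\<^sup>2\<close>.\<close>
  define k where "k n = nat \<lfloor>sqrt (E n)\<rfloor>" for n
  have k_top: "filterlim k at_top sequentially"
    unfolding k_def[abs_def]
    by (rule filterlim_compose[OF filterlim_nat_sequentially filterlim_compose[OF filterlim_floor_sequentially
          filterlim_compose[OF sqrt_at_top top]]])
  have kpos: "\<forall>\<^sub>F n in sequentially. k n > 0"
    using k_top eventually_gt_at_top[of 0] by (rule eventually_compose_filterlim[rotated])
  let ?a = "\<lambda>n. (real (k n))\<^sup>2" and ?b = "\<lambda>n. (real (Suc (k n)))\<^sup>2"
  have bounds: "\<forall>\<^sub>F n in sequentially. 0 < k n \<and> 0 \<le> r (k n) \<and> 0 \<le> r (Suc (k n)) \<and> ?a n \<le> E n \<and> E n < ?b n"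
  proof -
    have "\<forall>\<^sub>F j in sequentially. r j > 0" using order_tendstoD(1)[OF r, of 0] by simp
    then have "\<forall>\<^sub>F j in sequentially. r j > 0 \<and> r (Suc j) > 0"
      using eventually_sequentially_Suc[of "\<lambda>j. r j > 0"] eventually_conj by blast
    then have "\<forall>\<^sub>F n in sequentially. r (k n) > 0 \<and> r (Suc (k n)) > 0"
      by (rule eventually_compose_filterlim[OF _ k_top])
    with kpos show ?thesis
    proof eventually_elim
      case (elim n)
      have s: "0 \<le> sqrt (E n)" "real (k n) \<le> sqrt (E n)" "sqrt (E n) < real (Suc (k n))"
        using elim(1) by (auto simp: k_def) linarith+
      have e: "E n \<ge> 0" using s(1) by simp
      have "?a n \<le> (sqrt (E n))\<^sup>2" using s by (intro power_mono) auto
      moreover have "(sqrt (E n))\<^sup>2 < ?b n" using s by (intro power_strict_mono) auto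
      ultimately show ?case using elim e by simp
    qed
  qed
  have lim_shift: "(\<lambda>j. r (Suc j)) \<longlonglongrightarrow> 1" using r by (rule LIMSEQ_Suc)
  have upper: "(\<lambda>n. r (Suc (k n)) * ((?b n + 1) / ?a n)) \<longlonglongrightarrow> 1 * 1"
  proof (intro tendsto_mult)
    show "(\<lambda>n. r (Suc (k n))) \<longlonglongrightarrow> 1" by (rule filterlim_compose[OF lim_shift k_top])
    have "(\<lambda>j::nat. ((real (Suc j))\<^sup>2 + 1) / (real j)\<^sup>2) \<longlonglongrightarrow> 1" by real_asymp
    then show "(\<lambda>n. (?b n + 1) / ?a n) \<longlonglongrightarrow> 1" by (rule filterlim_compose[OF _ k_top])
  qed
  have lower: "(\<lambda>n. r (k n) * (?a n / ?b n)) \<longlonglongrightarrow> 1 * 1"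
  proof (intro tendsto_mult)
    show "(\<lambda>n. r (k n)) \<longlonglongrightarrow> 1" by (rule filterlim_compose[OF r k_top])
    have "(\<lambda>j::nat. (real j)\<^sup>2 / (real (Suc j))\<^sup>2) \<longlonglongrightarrow> 1" by real_asymp
    then show "(\<lambda>n. ?a n / ?b n) \<longlonglongrightarrow> 1" by (rule filterlim_compose[OF _ k_top])
  qed
  have sandwich: "\<forall>\<^sub>F n in sequentially. r (k n) * (?a n / ?b n) \<le> c n / E n \<and>
      c n / E n \<le> r (Suc (k n)) * ((?b n + 1) / ?a n)"
    using bounds
  proof eventually_elim
    case (elim n)
    have kp: "0 < ?a n" using elim by simp
    then have Ep: "0 < E n" using elim by linarith
    have mle: "m (k n) \<le> n" unfolding m_def using elim by (intro Least_le) auto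
    have mge: "n \<le> m (Suc (k n))"
    proof (rule ccontr)
      assume "\<not> ?thesis"
      then have "E (m (Suc (k n))) \<le> E n" by (intro monoD[OF E(1)]) auto
      then show False using m_le[of "Suc (k n)"] elim by linarith
    qed
    have c1: "r (k n) * ?a n \<le> c n"
    proof -
      have "r (k n) * ?a n \<le> r (k n) * E (m (k n))"
        using elim m_le by (intro mult_left_mono) auto
      also have "\<dots> = c (m (k n))"
      proof -
        have "E (m (k n)) \<noteq> 0" using m_le[of "k n"] kp by linarith
        then show ?thesis by (simp add: r_def)
      qed
      also have "\<dots> \<le> c n" by (rule monoD[OF c mle])
      finally show ?thesis .
    qed
    have c2: "c n \<le> r (Suc (k n)) * (?b n + 1)"
    proof -
      have "c n \<le> c (m (Suc (k n)))" by (rule monoD[OF c mge])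
      also have "\<dots> = r (Suc (k n)) * E (m (Suc (k n)))"
      proof -
        have "0 < ?b n" by (intro zero_less_power) simp
        then have "E (m (Suc (k n))) \<noteq> 0" using m_le[of "Suc (k n)"] by linarith
        then show ?thesis by (simp add: r_def)
      qed
      also have "\<dots> \<le> r (Suc (k n)) * (?b n + 1)"
        using elim by (intro mult_left_mono m_up) auto
      finally show ?thesis .
    qed
    have cn: "0 \<le> c n" using elim by (intro order_trans[OF _ c1] mult_nonneg_nonneg) auto
    have "r (k n) * (?a n / ?b n) \<le> c n / ?b n"
      using divide_right_mono[OF c1, of "?b n"] by simp
    also have "\<dots> \<le> c n / E n" using cn Ep elim by (intro divide_left_mono) auto
    finally have 1: "r (k n) * (?a n / ?b n) \<le> c n / E n" .
    have "c n / E n \<le> c n / ?a n"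
      using elim by (intro divide_left_mono cn mult_pos_pos Ep kp) auto
    also have "\<dots> \<le> r (Suc (k n)) * ((?b n + 1) / ?a n)"
      using divide_right_mono[OF c2, of "?a n"] by simp
    finally show ?case using 1 by blast
  qed
  show ?thesis
    by (rule tendsto_sandwich[OF _ _ lower[simplified] upper[simplified]])
      (use sandwich in \<open>auto elim: eventually_mono\<close>)
qed

section \<open>Sums of independent indicators\<close>

locale independent_trials = prob_space M + growing_weights \<alpha>
  for M :: "'a measure" and \<alpha> :: "nat \<Rightarrow> real" +
  fixes I :: "nat \<Rightarrow> 'a \<Rightarrow> real"
  assumes indep: "indep_vars (\<lambda>_. borel) I {1..}"
    and zero_one: "\<And>n \<omega>. I n \<omega> \<in> {0, 1}"
    and mean: "\<And>n. n \<ge> 1 \<Longrightarrow> expectation (I n) = p_seq \<alpha> n"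
begin

definition successes :: "nat \<Rightarrow> 'a \<Rightarrow> real" where
  "successes n \<omega> = (\<Sum>k=1..n. I k \<omega>)"

lemma rv: "n \<ge> 1 \<Longrightarrow> I n \<in> borel_measurable M"
  using indep by (auto simp: indep_vars_def)

lemma successes_rv [measurable]: "successes n \<in> borel_measurable M"
  unfolding successes_def[abs_def] by (intro borel_measurable_sum rv) auto

lemma I_bounds: "0 \<le> I n \<omega>" "I n \<omega> \<le> 1"
  using zero_one[of n \<omega>] by auto

lemma integrable_I: "n \<ge> 1 \<Longrightarrow> integrable M (I n)"
  by (rule integrable_const_bound[where B=1]) (use I_bounds rv in auto)

lemma centred_moments:
  assumes "n \<ge> 1"
  shows "expectation (\<lambda>\<omega>. I n \<omega> - p_seq \<alpha> n) = 0"
    and "expectation (\<lambda>\<omega>. (I n \<omega> - p_seq \<alpha> n)\<^sup>2) = p_seq \<alpha> n * (1 - p_seq \<alpha> n)"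
proof -
  let ?p = "p_seq \<alpha> n"
  show "expectation (\<lambda>\<omega>. I n \<omega> - ?p) = 0"
    using assms by (simp add: integrable_I mean prob_space)
  have "(I n \<omega> - ?p)\<^sup>2 = (1 - 2 * ?p) * I n \<omega> + ?p\<^sup>2" for \<omega>
    using zero_one[of n \<omega>] by (auto simp: power2_eq_square algebra_simps)
  then have "expectation (\<lambda>\<omega>. (I n \<omega> - ?p)\<^sup>2) = expectation (\<lambda>\<omega>. (1 - 2 * ?p) * I n \<omega> + ?p\<^sup>2)"
    by simp
  also have "\<dots> = (1 - 2 * ?p) * ?p + ?p\<^sup>2" using assms by (simp add: integrable_I mean prob_space)
  finally show "expectation (\<lambda>\<omega>. (I n \<omega> - ?p)\<^sup>2) = ?p * (1 - ?p)"
    by (simp add: power2_eq_square algebra_simps)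
qed

lemma centred_bound: "\<bar>I n \<omega> - p_seq \<alpha> n\<bar> \<le> 1"
proof -
  have "0 \<le> p_seq \<alpha> n"
    using p_pos[of n] by (cases "n = 0") (auto simp: p_seq_def intro: less_imp_le)
  then show ?thesis using I_bounds[of n \<omega>] p_le_1[of n] by auto
qed

lemma successes_centred: "successes n \<omega> - E_seq \<alpha> n = (\<Sum>k=1..n. I k \<omega> - p_seq \<alpha> k)"
  by (simp add: successes_def E_seq_def sum_subtractf)

lemma integrable_centred_square: "integrable M (\<lambda>\<omega>. (successes n \<omega> - E_seq \<alpha> n)\<^sup>2)"
proof (rule integrable_const_bound[where B="(real n)\<^sup>2"])
  have "\<bar>successes n \<omega> - E_seq \<alpha> n\<bar> \<le> real n" for \<omega>
    unfolding successes_centred using sum_norm_bound[of "{1..n}" "\<lambda>k. I k \<omega> - p_seq \<alpha> k" 1] centred_bound by simp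
  then show "AE \<omega> in M. norm ((successes n \<omega> - E_seq \<alpha> n)\<^sup>2) \<le> (real n)\<^sup>2"
    by (simp add: abs_le_square_iff[symmetric])
qed measurable

lemma V_Suc: "V_seq \<alpha> (Suc n) = V_seq \<alpha> n + p_seq \<alpha> (Suc n) * (1 - p_seq \<alpha> (Suc n))"
  by (simp add: V_seq_def)

lemma variance_term_nonneg: "0 \<le> p_seq \<alpha> n * (1 - p_seq \<alpha> n)"
proof (cases "n = 0")
  case False
  then show ?thesis using p_pos[of n] p_le_1[of n] by (intro mult_nonneg_nonneg) auto
qed (simp add: p_seq_def)

lemma V_le_E: "V_seq \<alpha> n \<le> E_seq \<alpha> n"
  unfolding V_seq_def E_seq_def
proof (rule sum_mono)
  fix k assume "k \<in> {1..n}"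
  then show "p_seq \<alpha> k * (1 - p_seq \<alpha> k) \<le> p_seq \<alpha> k"
    using p_pos[of k] by (simp add: mult_left_le)
qed

text \<open>Induction on \<open>n\<close>: the cross term vanishes because the new centred indicator is independent of the
previous sum.\<close>
lemma variance_successes: "expectation (\<lambda>\<omega>. (successes n \<omega> - E_seq \<alpha> n)\<^sup>2) = V_seq \<alpha> n"
proof (induction n)
  case 0 then show ?case by (simp add: successes_def V_seq_def)
next
  case (Suc n)
  let ?C = "\<lambda>\<omega>. successes n \<omega> - E_seq \<alpha> n" and ?D = "\<lambda>\<omega>. I (Suc n) \<omega> - p_seq \<alpha> (Suc n)"
  have ind: "indep_var borel (I (Suc n)) borel (\<lambda>\<omega>. \<Sum>k\<in>{1..n}. I k \<omega>)"
    by (rule indep_vars_sum) (auto intro!: indep_vars_subset[OF indep])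
  have "indep_var borel ((\<lambda>x. x - p_seq \<alpha> (Suc n)) \<circ> I (Suc n)) borel ((\<lambda>x. x - E_seq \<alpha> n) \<circ> (\<lambda>\<omega>. \<Sum>k\<in>{1..n}. I k \<omega>))"
    by (rule indep_var_compose[OF ind]) auto
  then have ind: "indep_var borel ?D borel ?C"
    by (simp add: successes_def o_def)
  have iD: "integrable M ?D" by (simp add: integrable_I)
  have iC: "integrable M ?C"
    by (rule square_integrable_imp_integrable[OF _ integrable_centred_square]) measurable
  have iDC: "integrable M (\<lambda>\<omega>. ?D \<omega> * ?C \<omega>)" by (rule indep_var_integrable[OF ind iD iC])
  have DC: "expectation (\<lambda>\<omega>. ?D \<omega> * ?C \<omega>) = 0"
    using indep_var_lebesgue_integral[OF ind iD iC] centred_moments(1)[of "Suc n"] by simp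
  have iD2: "integrable M (\<lambda>\<omega>. (?D \<omega>)\<^sup>2)"
    by (rule integrable_const_bound[where B=1])
      (use centred_bound rv[of "Suc n"] in \<open>auto simp: power_le_one abs_square_le_1\<close>)
  have "(successes (Suc n) \<omega> - E_seq \<alpha> (Suc n))\<^sup>2 = (?C \<omega>)\<^sup>2 + 2 * (?D \<omega> * ?C \<omega>) + (?D \<omega>)\<^sup>2" for \<omega>
    by (simp add: successes_def E_Suc power2_eq_square algebra_simps)
  then have "expectation (\<lambda>\<omega>. (successes (Suc n) \<omega> - E_seq \<alpha> (Suc n))\<^sup>2) =
      expectation (\<lambda>\<omega>. (?C \<omega>)\<^sup>2 + 2 * (?D \<omega> * ?C \<omega>) + (?D \<omega>)\<^sup>2)" by simp
  also have "\<dots> = expectation (\<lambda>\<omega>. (?C \<omega>)\<^sup>2) + 2 * expectation (\<lambda>\<omega>. ?D \<omega> * ?C \<omega>) + expectation (\<lambda>\<omega>. (?D \<omega>)\<^sup>2)"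
    using iDC iD2 integrable_centred_square[of n] by simp
  also have "\<dots> = V_seq \<alpha> (Suc n)"
    using DC Suc.IH centred_moments(2)[of "Suc n"] by (simp add: V_Suc)
  finally show ?case .
qed

lemma successes_mono: "mono (\<lambda>n. successes n \<omega>)"
  using I_bounds by (intro incseq_SucI) (simp add: successes_def)

text \<open>The variance is at most the mean, so at the first time when \<open>E\<close> reaches \<open>k\<^sup>2\<close> the squared relative
error has expectation at most \<open>1 / k\<^sup>2\<close>, which is summable.\<close>
theorem law_of_large_numbers: "AE \<omega> in M. (\<lambda>n. successes n \<omega> / E_seq \<alpha> n) \<longlonglongrightarrow> 1"
proof -
  define m where "m k = (LEAST n. (real k)\<^sup>2 \<le> E_seq \<alpha> n)" for k :: nat
  have "\<exists>n. x \<le> E_seq \<alpha> n" for x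
    using E_at_top by (metis eventually_sequentially filterlim_at_top order_refl)
  then have m: "(real k)\<^sup>2 \<le> E_seq \<alpha> (m k)" for k unfolding m_def by (rule LeastI_ex)
  let ?e = "\<lambda>k. E_seq \<alpha> (m k)"
  let ?f = "\<lambda>k \<omega>. ((successes (m k) \<omega> - ?e k) / ?e k)\<^sup>2"
  have mean_f: "expectation (?f k) = V_seq \<alpha> (m k) / (?e k)\<^sup>2" for k
    by (simp add: power_divide variance_successes)
  have V0: "0 \<le> V_seq \<alpha> n" for n unfolding V_seq_def by (intro sum_nonneg variance_term_nonneg)
  have "AE \<omega> in M. (\<lambda>k. ?f k \<omega>) \<longlonglongrightarrow> 0"
  proof (rule AE_tendsto_0_if_summable_integral)
    show "integrable M (?f k)" for k
      using integrable_centred_square[of "m k"] by (simp add: power_divide)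
    have "summable (\<lambda>k. 1 / (real k)\<^sup>2)"
      using inverse_power_summable[of 2, where 'a=real] by (simp add: field_simps)
    then show "summable (\<lambda>k. expectation (?f k))"
    proof (rule summable_comparison_test'[where N=1])
      fix k :: nat assume k: "k \<ge> 1"
      have kp: "0 < (real k)\<^sup>2" using k by simp
      then have Ep: "0 < ?e k" using m[of k] by linarith
      have "V_seq \<alpha> (m k) / (?e k)\<^sup>2 \<le> ?e k / (?e k)\<^sup>2"
        by (intro divide_right_mono V_le_E) simp
      also have "\<dots> = 1 / ?e k" using Ep by (simp add: power2_eq_square)
      also have "\<dots> \<le> 1 / (real k)\<^sup>2" using m[of k] kp Ep by (intro divide_left_mono mult_pos_pos) auto
      finally show "norm (expectation (?f k)) \<le> 1 / (real k)\<^sup>2" unfolding mean_f using V0 by simp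
    qed
  qed simp
  then show ?thesis
  proof eventually_elim
    case (elim \<omega>)
    have "(\<lambda>k. sqrt (?f k \<omega>)) \<longlonglongrightarrow> sqrt 0" by (intro tendsto_real_sqrt elim)
    then have "(\<lambda>k. (successes (m k) \<omega> - ?e k) / ?e k) \<longlonglongrightarrow> 0"
      unfolding real_sqrt_abs real_sqrt_zero by (rule tendsto_rabs_zero_cancel)
    then have "(\<lambda>k. (successes (m k) \<omega> - ?e k) / ?e k + 1) \<longlonglongrightarrow> 1"
      using tendsto_add[OF _ tendsto_const[of 1]] by force
    moreover have "\<forall>\<^sub>F k in sequentially. (successes (m k) \<omega> - ?e k) / ?e k + 1
        = successes (m k) \<omega> / ?e k"
      using eventually_ge_at_top[of 1]
    proof eventually_elim
      case (elim k)
      then have "0 < (real k)\<^sup>2" by simp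
      then have "0 < ?e k" using m[of k] by linarith
      then show ?case by (simp add: field_simps)
    qed
    ultimately have sub: "(\<lambda>k. successes (m k) \<omega> / ?e k) \<longlonglongrightarrow> 1"
      by (rule Lim_transform_eventually)
    show ?case
    proof (rule ratio_tendsto_1_from_squares[OF successes_mono E_mono])
      show "E_seq \<alpha> (Suc n) \<le> E_seq \<alpha> n + 1" for n using p_le_1[of "Suc n"] by (simp add: E_Suc)
    qed (use sub E_at_top in \<open>simp_all add: m_def\<close>)
  qed
qed

text \<open>Let \<open>q\<^sub>n \<in> {0,1}\<close> be the value nearest to \<open>p\<^sub>n\<close>. Then \<open>\<bar>q\<^sub>n - p\<^sub>n\<bar>\<close>, which is also the probability that
\<open>I\<^sub>n\<close> differs from \<open>q\<^sub>n\<close>, is at most twice the variance of \<open>I\<^sub>n\<close> and so summable. By Borel--Cantelli the terms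
\<open>I\<^sub>n - p\<^sub>n\<close> are eventually \<open>q\<^sub>n - p\<^sub>n\<close>, the terms of an absolutely convergent series.\<close>
theorem centred_successes_converge:
  assumes "convergent (V_seq \<alpha>)"
  shows "AE \<omega> in M. convergent (\<lambda>n. successes n \<omega> - E_seq \<alpha> n)"
proof -
  define q :: "nat \<Rightarrow> real" where "q n = (if p_seq \<alpha> n \<le> 1/2 then 0 else 1)" for n
  let ?p = "\<lambda>n. p_seq \<alpha> (Suc n)"
  let ?v = "\<lambda>n. ?p n * (1 - ?p n)"
  have V: "V_seq \<alpha> = (\<lambda>n. \<Sum>k<n. ?v k)"
    by (rule ext) (simp add: V_seq_def sum.atLeast1_atMost_eq)
  have summ: "summable ?v" using assms unfolding V summable_iff_convergent .
  have close: "\<bar>q (Suc n) - ?p n\<bar> \<le> 2 * ?v n" for n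
  proof -
    have p: "0 \<le> ?p n" "?p n \<le> 1"
      using p_pos[of "Suc n"] p_le_1[of "Suc n"] by auto
    show ?thesis
    proof (cases "?p n \<le> 1/2")
      case True
      then have "?p n * 1 \<le> ?p n * (2 * (1 - ?p n))"
        using p by (intro mult_left_mono) auto
      then show ?thesis using True p by (simp add: q_def algebra_simps)
    next
      case False
      then have "1 * (1 - ?p n) \<le> (2 * ?p n) * (1 - ?p n)"
        using p by (intro mult_right_mono) auto
      then show ?thesis using False p by (simp add: q_def algebra_simps)
    qed
  qed
  let ?A = "\<lambda>n. {\<omega> \<in> space M. I (Suc n) \<omega> \<noteq> q (Suc n)}"
  have A: "?A n \<in> events" for n using rv[of "Suc n"] by measurable
  have prob_A: "prob (?A n) = \<bar>q (Suc n) - ?p n\<bar>" for n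
  proof -
    have "prob (?A n) = expectation (indicator (?A n))" using A[of n] by simp
    also have "\<dots> = expectation (\<lambda>\<omega>. q (Suc n) + (1 - 2 * q (Suc n)) * I (Suc n) \<omega>)"
    proof (rule Bochner_Integration.integral_cong)
      fix \<omega> assume "\<omega> \<in> space M"
      then show "indicator (?A n) \<omega> = q (Suc n) + (1 - 2 * q (Suc n)) * I (Suc n) \<omega>"
        using zero_one[of "Suc n" \<omega>] by (auto simp: q_def)
    qed simp
    also have "\<dots> = q (Suc n) + (1 - 2 * q (Suc n)) * ?p n"
      by (simp add: integrable_I mean prob_space)
    also have "\<dots> = \<bar>q (Suc n) - ?p n\<bar>"
      using p_pos[of "Suc n"] p_le_1[of "Suc n"] by (auto simp: q_def)
    finally show ?thesis .
  qed
  have "AE \<omega> in M. \<forall>\<^sub>F n in sequentially. \<omega> \<in> space M - ?A n"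
  proof (rule borel_cantelli_AE1[OF A])
    show "summable (\<lambda>n. prob (?A n))"
      by (rule summable_comparison_test'[OF summable_mult[OF summ, of 2], where N=0])
        (use close in \<open>simp add: prob_A\<close>)
  qed (simp add: less_top[symmetric])
  then show ?thesis
  proof eventually_elim
    case (elim \<omega>)
    have "summable (\<lambda>n. q (Suc n) - ?p n)"
      by (rule summable_comparison_test'[OF summable_mult[OF summ, of 2], where N=0])
        (use close in simp)
    moreover have "\<forall>\<^sub>F n in sequentially. q (Suc n) - ?p n = I (Suc n) \<omega> - ?p n"
      using elim by eventually_elim auto
    note summable_cong[OF this]
    ultimately have "summable (\<lambda>n. I (Suc n) \<omega> - ?p n)" by simp
    then show ?case
      unfolding summable_iff_convergent successes_centred by (simp add: sum.atLeast1_atMost_eq)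
  qed
qed

text \<open>Both the characteristic function and the Gaussian factor are compared with \<open>1 - t\<^sup>2 c\<^sup>2 v / 2\<close>. The errors are
proportional to the variance \<open>v\<close> since \<open>\<bar>I\<^sub>n - p\<^sub>n\<bar> \<le> 1\<close> and \<open>v \<le> 1\<close>, so that they can be summed over
\<open>n\<close>.\<close>
lemma char_centred_trial:
  assumes n: "n \<ge> 1" and c: "c \<ge> 0"
  defines "v \<equiv> p_seq \<alpha> n * (1 - p_seq \<alpha> n)"
  shows "cmod (char (distr M borel (\<lambda>\<omega>. c * (I n \<omega> - p_seq \<alpha> n))) t - exp (- (t\<^sup>2 * c\<^sup>2 * v / 2)))
    \<le> (\<bar>t\<bar>^3 * c^3 / 6 + t^4 * c^4 / 8) * v"
proof -
  let ?X = "\<lambda>\<omega>. c * (I n \<omega> - p_seq \<alpha> n)"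
  have [measurable]: "I n \<in> borel_measurable M" by (rule rv[OF n])
  have X_bound: "\<bar>?X \<omega>\<bar> \<le> c" for \<omega> using centred_bound[of n \<omega>] c by (simp add: abs_mult mult_left_le)
  have intX: "integrable M ?X" by (rule integrable_const_bound[where B=c]) (use X_bound in auto)
  have intX2: "integrable M (\<lambda>\<omega>. (?X \<omega>)\<^sup>2)"
    by (rule integrable_const_bound[where B="c\<^sup>2"]) (use X_bound c in \<open>auto simp: abs_le_square_iff[symmetric]\<close>)
  have EX: "expectation ?X = 0" using centred_moments(1)[OF n] by simp
  have EX2: "expectation (\<lambda>\<omega>. (?X \<omega>)\<^sup>2) = c\<^sup>2 * v"
    using centred_moments(2)[OF n] by (simp add: power_mult_distrib v_def)
  have v: "0 \<le> v" "v \<le> 1"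
    using variance_term_nonneg[of n] p_pos[OF n] p_le_1[of n] unfolding v_def by (auto intro: mult_le_one)
  have "cmod (char (distr M borel ?X) t - (1 - t^2 * (c\<^sup>2 * v) / 2))
     \<le> (t^2 / 6) * expectation (\<lambda>\<omega>. min (6 * (?X \<omega>)^2) (\<bar>t\<bar> * \<bar>?X \<omega>\<bar>^3))"
    by (rule char_approx3') (use intX intX2 EX EX2 in auto)
  also have "\<dots> \<le> (t^2 / 6) * expectation (\<lambda>\<omega>. \<bar>t\<bar> * c * (?X \<omega>)\<^sup>2)"
  proof (intro mult_left_mono integral_mono)
    show "integrable M (\<lambda>\<omega>. min (6 * (?X \<omega>)^2) (\<bar>t\<bar> * \<bar>?X \<omega>\<bar>^3))"
      by (rule Bochner_Integration.integrable_bound[OF integrable_mult_right[OF intX2, of 6]]) auto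
    show "integrable M (\<lambda>\<omega>. \<bar>t\<bar> * c * (?X \<omega>)\<^sup>2)" by (intro integrable_mult_right intX2)
    fix \<omega>
    have "\<bar>?X \<omega>\<bar>^3 \<le> c * (?X \<omega>)\<^sup>2"
    proof -
      have "\<bar>x\<bar>^3 = \<bar>x\<bar> * x\<^sup>2" for x :: real by (cases "x \<ge> 0") (auto simp: power3_eq_cube power2_eq_square)
      then have "\<bar>?X \<omega>\<bar>^3 = \<bar>?X \<omega>\<bar> * (?X \<omega>)\<^sup>2" .
      then show ?thesis using mult_right_mono[OF X_bound[of \<omega>], of "(?X \<omega>)\<^sup>2"] by simp
    qed
    then have "\<bar>t\<bar> * \<bar>?X \<omega>\<bar>^3 \<le> \<bar>t\<bar> * (c * (?X \<omega>)\<^sup>2)" by (intro mult_left_mono) auto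
    then show "min (6 * (?X \<omega>)^2) (\<bar>t\<bar> * \<bar>?X \<omega>\<bar>^3) \<le> \<bar>t\<bar> * c * (?X \<omega>)\<^sup>2" by (simp add: mult.assoc)
  qed auto
  also have "\<dots> = \<bar>t\<bar>^3 * c^3 / 6 * v"
    using EX2 by (simp add: power2_eq_square power3_eq_cube)
  finally have 1: "cmod (char (distr M borel ?X) t - (1 - t\<^sup>2 * c\<^sup>2 * v / 2)) \<le> \<bar>t\<bar>^3 * c^3 / 6 * v"
    by (simp add: mult.assoc)
  let ?u = "t\<^sup>2 * c\<^sup>2 * v / 2"
  have "cmod (complex_of_real (exp (- ?u)) - complex_of_real (1 - ?u)) = \<bar>exp (- ?u) - (1 - ?u)\<bar>"
    unfolding of_real_diff[symmetric] norm_of_real ..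
  also have "\<dots> \<le> ?u\<^sup>2 / 2" using v by (intro exp_minus_bounds) auto
  also have "\<dots> = t^4 * c^4 / 8 * (v * v)" by (simp add: power2_eq_square power4_eq_xxxx)
  also have "\<dots> \<le> t^4 * c^4 / 8 * v" using v by (intro mult_left_mono) (auto simp: mult_left_le)
  finally have 2: "cmod (complex_of_real (exp (- ?u)) - (1 - ?u)) \<le> t^4 * c^4 / 8 * v" by simp
  have "cmod (char (distr M borel ?X) t - exp (- ?u)) \<le>
     cmod (char (distr M borel ?X) t - (1 - ?u)) + cmod (complex_of_real (exp (- ?u)) - (1 - ?u))"
    using dist_triangle2[of "char (distr M borel ?X) t" "complex_of_real (exp (- ?u))" "complex_of_real (1 - ?u)"]
    by (simp add: dist_norm)
  also have "\<dots> \<le> \<bar>t\<bar>^3 * c^3 / 6 * v + t^4 * c^4 / 8 * v" using 1 2 by (intro add_mono) auto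
  finally show ?thesis by (simp add: algebra_simps)
qed

text \<open>With the scaling \<open>c\<^sub>n = V\<^sub>n\<^bsup>-1/2\<^esup>\<close> the Gaussian factors multiply to \<open>exp (- t\<^sup>2 / 2)\<close>, and the errors of
\<open>char_centred_trial\<close> add up to \<open>O(c\<^sub>n)\<close>.\<close>
theorem central_limit:
  assumes V: "filterlim (V_seq \<alpha>) at_top sequentially"
  shows "weak_conv_m (\<lambda>n. distr M borel (\<lambda>\<omega>. V_seq \<alpha> n powr (- 1 / 2) * (successes n \<omega> - E_seq \<alpha> n)))
    std_normal_distribution"
proof (rule levy_continuity)
  show "real_distribution (distr M borel (\<lambda>\<omega>. V_seq \<alpha> n powr (- 1 / 2) * (successes n \<omega> - E_seq \<alpha> n)))" for n
    by (intro real_distribution_distr) measurable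
  show "real_distribution std_normal_distribution" by (rule real_dist_normal_dist)
  fix t :: real
  define c where "c n = V_seq \<alpha> n powr (- 1 / 2)" for n
  let ?v = "\<lambda>k. p_seq \<alpha> k * (1 - p_seq \<alpha> k)"
  let ?\<phi> = "\<lambda>n. char (distr M borel (\<lambda>\<omega>. c n * (successes n \<omega> - E_seq \<alpha> n))) t"
  have c0: "c n \<ge> 0" for n by (simp add: c_def)
  have c: "c \<longlonglongrightarrow> 0"
    unfolding c_def[abs_def] by (rule tendsto_neg_powr[OF _ V]) simp
  have "\<forall>\<^sub>F n in sequentially. cmod (?\<phi> n - exp (- (t\<^sup>2 / 2))) \<le> \<bar>t\<bar>^3 * c n / 6 + t^4 * (c n)\<^sup>2 / 8"
    using filterlim_at_top_dense[THEN iffD1, OF V, rule_format, of 0]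
  proof eventually_elim
    case (elim n)
    have cV: "(c n)\<^sup>2 * V_seq \<alpha> n = 1"
    proof -
      have "(c n)\<^sup>2 = V_seq \<alpha> n powr (- 1)"
        by (simp add: c_def power2_eq_square powr_add[symmetric] del: powr_minus)
      then show ?thesis using elim by (simp add: powr_minus)
    qed
    let ?a = "\<lambda>k. char (distr M borel (\<lambda>\<omega>. c n * (I k \<omega> - p_seq \<alpha> k))) t"
    let ?b = "\<lambda>k. complex_of_real (exp (- (t\<^sup>2 * (c n)\<^sup>2 * ?v k / 2)))"
    have "indep_vars (\<lambda>_. borel) (\<lambda>k \<omega>. c n * (I k \<omega> - p_seq \<alpha> k)) {1..n}"
      by (rule indep_vars_compose2[OF indep_vars_subset[OF indep]]) auto
    then have "?\<phi> n = (\<Prod>k=1..n. ?a k)"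
      by (simp add: successes_centred sum_distrib_left char_distr_sum)
    moreover have "complex_of_real (exp (- (t\<^sup>2 / 2))) = (\<Prod>k=1..n. ?b k)"
    proof -
      have "(\<Sum>k=1..n. - (t\<^sup>2 * (c n)\<^sup>2 * ?v k / 2)) = - (t\<^sup>2 / 2) * ((c n)\<^sup>2 * V_seq \<alpha> n)"
        by (simp add: V_seq_def sum_distrib_left sum_negf mult.assoc sum_divide_distrib)
      then have "(\<Sum>k=1..n. - (t\<^sup>2 * (c n)\<^sup>2 * ?v k / 2)) = - (t\<^sup>2 / 2)" using cV by simp
      then show ?thesis by (simp add: exp_sum[symmetric] of_real_prod[symmetric] del: of_real_prod)
    qed
    ultimately have "cmod (?\<phi> n - exp (- (t\<^sup>2 / 2))) = cmod ((\<Prod>k=1..n. ?a k) - (\<Prod>k=1..n. ?b k))" by simp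
    also have "\<dots> \<le> (\<Sum>k=1..n. cmod (?a k - ?b k))"
    proof (rule norm_prod_diff)
      fix k assume k: "k \<in> {1..n}"
      then have [measurable]: "I k \<in> borel_measurable M" by (intro rv) auto
      interpret X: real_distribution "distr M borel (\<lambda>\<omega>. c n * (I k \<omega> - p_seq \<alpha> k))"
        by (rule real_distribution_distr) measurable
      show "cmod (?a k) \<le> 1" by (rule X.cmod_char_le_1)
      show "cmod (?b k) \<le> 1" using variance_term_nonneg[of k] by (simp add: mult.assoc)
    qed
    also have "\<dots> \<le> (\<Sum>k=1..n. (\<bar>t\<bar>^3 * (c n)^3 / 6 + t^4 * (c n)^4 / 8) * ?v k)"
      by (intro sum_mono char_centred_trial c0) auto
    also have "\<dots> = (\<bar>t\<bar>^3 * (c n)^3 / 6 + t^4 * (c n)^4 / 8) * V_seq \<alpha> n"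
      by (simp add: V_seq_def sum_distrib_left)
    also have "\<dots> = (\<bar>t\<bar>^3 * c n / 6 + t^4 * (c n)\<^sup>2 / 8) * ((c n)\<^sup>2 * V_seq \<alpha> n)"
      by (simp add: power2_eq_square power3_eq_cube power4_eq_xxxx algebra_simps)
    finally show ?case using cV by simp
  qed
  moreover have "(\<lambda>n. \<bar>t\<bar>^3 * c n / 6 + t^4 * (c n)\<^sup>2 / 8) \<longlonglongrightarrow> \<bar>t\<bar>^3 * 0 / 6 + t^4 * 0\<^sup>2 / 8"
    by (intro tendsto_intros c) auto
  then have "(\<lambda>n. \<bar>t\<bar>^3 * c n / 6 + t^4 * (c n)\<^sup>2 / 8) \<longlonglongrightarrow> 0" by simp
  ultimately have "(\<lambda>n. ?\<phi> n - exp (- (t\<^sup>2 / 2))) \<longlonglongrightarrow> 0"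
    by (rule Lim_null_comparison)
  then have "?\<phi> \<longlonglongrightarrow> exp (- (t\<^sup>2 / 2))" by (simp add: LIM_zero_iff)
  then show "(\<lambda>n. char (distr M borel (\<lambda>\<omega>. V_seq \<alpha> n powr (- 1 / 2) * (successes n \<omega> - E_seq \<alpha> n))) t)
      \<longlonglongrightarrow> char std_normal_distribution t"
    by (simp add: c_def char_std_normal_distribution)
qed

end

section \<open>Records in an F-alpha scheme\<close>

lemma record_indicator_iff:
  assumes "n \<ge> 1"
  shows "record_indicator X n \<omega> = of_bool (\<forall>j\<in>{1..<n}. X j \<omega> < X n \<omega>)"
proof (cases "n = 1")
  case False
  then have "{1..n - 1} = {1..<n}" "{1..<n} \<noteq> {}" using assms by auto
  then show ?thesis using assms False by (simp add: record_indicator_def partial_max_def)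
qed (simp add: record_indicator_def)

lemma is_df_nonneg: "is_df G \<Longrightarrow> 0 \<le> G x"
proof -
  assume G: "is_df G"
  have "\<forall>\<^sub>F y in at_bot. G y \<le> G x"
    using eventually_le_at_bot[of x] by eventually_elim (use G in \<open>auto simp: is_df_def intro: monoD\<close>)
  then show "0 \<le> G x"
    using G by (intro tendsto_upperbound[of G 0 at_bot "G x"]) (auto simp: is_df_def)
qed

lemma is_df_le_1: "is_df G \<Longrightarrow> G x \<le> 1"
proof -
  assume G: "is_df G"
  have "\<forall>\<^sub>F y in at_top. G x \<le> G y"
    using eventually_ge_at_top[of x] by eventually_elim (use G in \<open>auto simp: is_df_def intro: monoD\<close>)
  then show "G x \<le> 1"
    using G by (intro tendsto_lowerbound[of G 1 at_top "G x"]) (auto simp: is_df_def)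
qed

text \<open>A continuous distribution function attains every value in \<open>(0,1)\<close>. Hence the event that its value is at
most \<open>u\<close> contains a half-line of probability \<open>u\<close> and is contained in half-lines of probability
arbitrarily close to \<open>u\<close>.\<close>
theorem (in real_distribution) probability_integral_transform:
  assumes cont: "continuous_on UNIV (cdf M)"
  shows "distr M borel (cdf M) = uniform_measure lborel {0..1}"
    and "0 \<le> u \<Longrightarrow> u \<le> 1 \<Longrightarrow> prob {x. cdf M x \<le> u} = u"
proof -
  let ?T = "cdf M"
  have Tb [measurable]: "?T \<in> borel_measurable borel" by (rule borel_measurable_continuous_onI[OF cont])
  then have TM [simp]: "?T \<in> borel_measurable M" by (rule measurable_finite_borel)
  have attained: "\<exists>w. ?T w = u" if u01: "0 < u" "u < 1" for u
  proof -
    obtain a where a: "?T a < u"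
      using order_tendstoD(2)[OF cdf_lim_at_bot u01(1)] by (auto simp: eventually_at_bot_linorder)
    obtain b where b: "u < ?T b"
      using order_tendstoD(1)[OF cdf_lim_at_top_prob u01(2)] by (auto simp: eventually_at_top_linorder)
    have "a \<le> b" using a b cdf_nondecreasing[of b a] by linarith
    then show ?thesis
      using IVT'[of ?T a u b, OF _ _ _ continuous_on_subset[OF cont]] a b by auto
  qed
  have mid: "prob {x. ?T x \<le> u} = u" if u: "0 \<le> u" "u < 1" for u
  proof (rule antisym)
    show "prob {x. ?T x \<le> u} \<le> u"
    proof (rule field_le_epsilon)
      fix e :: real assume e: "e > 0"
      \<comment> \<open>A value slightly above \<open>u\<close> that is still below \<open>1\<close>, hence attained.\<close>
      define u' where "u' = min (u + e) ((u + 1) / 2)"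
      have u': "u < u'" "u' < 1" "u' \<le> u + e" using e u by (auto simp: u'_def min_def field_simps)
      obtain w where w: "?T w = u'" using attained[of u'] u u' by auto
      have "prob {x. ?T x \<le> u} \<le> prob {..w}"
      proof (rule finite_measure_mono)
        show "{x. ?T x \<le> u} \<subseteq> {..w}"
        proof
          fix x assume "x \<in> {x. ?T x \<le> u}"
          then have "?T x < ?T w" using w u' by simp
          then show "x \<in> {..w}" using cdf_nondecreasing[of w x] by (cases "w \<le> x") auto
        qed
      qed simp
      also have "\<dots> = u'" using w by (simp add: cdf_def2)
      finally show "prob {x. ?T x \<le> u} \<le> u + e" using u' by simp
    qed
    show "u \<le> prob {x. ?T x \<le> u}"
    proof (cases "u = 0")
      case False
      then obtain w where w: "?T w = u" using attained[of u] u by auto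
      have "prob {..w} \<le> prob {x. ?T x \<le> u}"
        by (rule finite_measure_mono) (use w cdf_nondecreasing[of _ w] in auto)
      then show ?thesis using w by (simp add: cdf_def2)
    qed simp
  qed
  have all: "prob {x. ?T x \<le> u} = 1" if "1 \<le> u" for u
  proof -
    have "{x. ?T x \<le> u} = UNIV" using order_trans[OF cdf_bounded_prob that] by auto
    then show ?thesis using prob_space by simp
  qed
  show "prob {x. ?T x \<le> u} = u" if "0 \<le> u" "u \<le> 1"
    using mid[of u] all[of u] that by (cases "u = 1") auto
  interpret D: real_distribution "distr M borel ?T" by (rule real_distribution_distr[OF TM])
  interpret U: prob_space "uniform_measure lborel {0..1::real}"
    by (rule prob_space_uniform_measure) auto
  show "distr M borel ?T = uniform_measure lborel {0..1}"
  proof (rule cdf_unique)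
    show "real_distribution (distr M borel ?T)" by (rule real_distribution_distr[OF TM])
    show "real_distribution (uniform_measure lborel {0..1::real})"
      by unfold_locales auto
    show "cdf (distr M borel ?T) = cdf (uniform_measure lborel {0..1})"
    proof
      fix u :: real
      have "cdf (distr M borel ?T) u = prob {x. ?T x \<le> u}"
        by (subst cdf_def2) (simp add: measure_distr[OF TM] vimage_def)
      also have "\<dots> = (if u < 0 then 0 else if u < 1 then u else 1)"
      proof (cases "u < 0")
        case True
        then have "{x. ?T x \<le> u} = {}" using cdf_nonneg by (auto simp: not_le intro: less_le_trans)
        then show ?thesis using True by simp
      qed (use mid all in auto)
      also have "\<dots> = measure lborel ({0..1} \<inter> {..u})"
      proof -
        consider "u < 0" | "0 \<le> u" "u < 1" | "1 \<le> u" by linarith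
        then show ?thesis
        proof cases
          case 1 then have "{0..1} \<inter> {..u} = {}" by auto
          then show ?thesis using 1 by simp
        next
          case 2 then have "{0..1} \<inter> {..u} = {0..u}" by auto
          then show ?thesis using 2 by simp
        next
          case 3 then have "{0..1} \<inter> {..u} = {0..1}" by auto
          then show ?thesis using 3 by simp
        qed
      qed
      also have "\<dots> = cdf (uniform_measure lborel {0..1}) u"
        unfolding cdf_def2 by (simp add: measure_def emeasure_uniform_measure divide_ennreal_def)
      finally show "cdf (distr M borel ?T) u = cdf (uniform_measure lborel {0..1}) u" .
    qed
  qed
qed

text \<open>Substituting the uniformly distributed value of the distribution function turns the left-hand side
into \<open>\<integral> u\<^sup>r du\<close>. The events \<open>w \<le> x\<close> and \<open>cdf M w \<le> cdf M x\<close> differ only on a stretch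
where the distribution function is constant, which has probability \<open>0\<close>.\<close>
lemma (in real_distribution) integral_cdf_power:
  assumes cont: "continuous_on UNIV (cdf M)" and r: "0 \<le> r"
  shows "(\<integral>\<^sup>+w. ennreal (cdf M w powr r) * indicator {..x} w \<partial>M) = ennreal (cdf M x powr (r + 1) / (r + 1))"
proof -
  let ?T = "cdf M"
  have Tb [measurable]: "?T \<in> borel_measurable borel" by (rule borel_measurable_continuous_onI[OF cont])
  then have TM [simp]: "?T \<in> borel_measurable M" by (rule measurable_finite_borel)
  have T01: "0 \<le> ?T x" "?T x \<le> 1" by (auto simp: cdf_nonneg cdf_bounded_prob)
  have "AE w in M. (indicator {..x} w :: ennreal) = indicator {..?T x} (?T w)"
  proof (rule AE_I)
    show "{w \<in> space M. (indicator {..x} w :: ennreal) \<noteq> indicator {..?T x} (?T w)} \<subseteq> {w. ?T w \<le> ?T x} - {..x}"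
      using cdf_nondecreasing[of _ x] by (auto split: split_indicator)
    have "prob ({w. ?T w \<le> ?T x} - {..x}) = prob {w. ?T w \<le> ?T x} - prob {..x}"
      by (rule finite_measure_Diff) (auto intro: cdf_nondecreasing)
    also have "\<dots> = 0" using probability_integral_transform(2)[OF cont T01] by (simp add: cdf_def2)
    finally show "emeasure M ({w. ?T w \<le> ?T x} - {..x}) = 0" by (simp add: emeasure_eq_measure)
    show "{w. ?T w \<le> ?T x} - {..x} \<in> events" by measurable
  qed
  then have "(\<integral>\<^sup>+w. ennreal (?T w powr r) * indicator {..x} w \<partial>M) =
      (\<integral>\<^sup>+w. ennreal (?T w powr r) * indicator {..?T x} (?T w) \<partial>M)"
    by (intro nn_integral_cong_AE) auto
  also have "\<dots> = (\<integral>\<^sup>+u. ennreal (u powr r) * indicator {..?T x} u \<partial>distr M borel ?T)"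
    by (subst nn_integral_distr) auto
  also have "\<dots> = (\<integral>\<^sup>+u. ennreal (u powr r) * indicator {..?T x} u * indicator {0..1} u \<partial>lborel)"
    unfolding probability_integral_transform(1)[OF cont]
    by (subst nn_integral_uniform_measure) (auto simp: divide_ennreal_def)
  also have "\<dots> = (\<integral>\<^sup>+u. ennreal (u powr r) * indicator {0..?T x} u \<partial>lborel)"
    using T01 by (intro nn_integral_cong) (auto split: split_indicator)
  also have "\<dots> = ennreal (?T x powr (r + 1) / (r + 1))"
    using T01 r by (intro nn_integral_has_integral_lebesgue' has_integral_powr_from_0) auto
  finally show ?thesis .
qed

text \<open>Fubini for independent variables. The integral is over \<open>M\<close> itself instead of the law of \<open>W\<close>, so
no measurability of the inner probability as a function of the value of \<open>W\<close> has to be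
supplied when the lemma is applied.\<close>
lemma (in prob_space) emeasure_indep_pair:
  assumes ind: "indep_var S Z T W" and B: "B \<in> sets (S \<Otimes>\<^sub>M T)"
  shows "emeasure M {\<omega> \<in> space M. (Z \<omega>, W \<omega>) \<in> B} =
    (\<integral>\<^sup>+\<omega>'. emeasure M {\<omega> \<in> space M. (Z \<omega>, W \<omega>') \<in> B} \<partial>M)"
proof -
  have [measurable]: "Z \<in> measurable M S" "W \<in> measurable M T"
    using ind indep_var_rv1 indep_var_rv2 by blast+
  have joint: "distr M S Z \<Otimes>\<^sub>M distr M T W = distr M (S \<Otimes>\<^sub>M T) (\<lambda>\<omega>. (Z \<omega>, W \<omega>))"
    using ind by (simp add: indep_var_distribution_eq)
  interpret Z: prob_space "distr M S Z" by (rule prob_space_distr) simp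
  interpret W: prob_space "distr M T W" by (rule prob_space_distr) simp
  interpret ZW: pair_prob_space "distr M S Z" "distr M T W" ..
  have "emeasure M {\<omega> \<in> space M. (Z \<omega>, W \<omega>) \<in> B} = emeasure (distr M S Z \<Otimes>\<^sub>M distr M T W) B"
    unfolding joint using B by (subst emeasure_distr) (auto intro!: arg_cong[where f="emeasure M"])
  also have "\<dots> = (\<integral>\<^sup>+w. emeasure (distr M S Z) ((\<lambda>z. (z, w)) -` B) \<partial>distr M T W)"
    using B by (intro ZW.emeasure_pair_measure_alt2) (simp cong: sets_pair_measure_cong)
  also have "\<dots> = (\<integral>\<^sup>+\<omega>'. emeasure (distr M S Z) ((\<lambda>z. (z, W \<omega>')) -` B) \<partial>M)"
  proof -
    have "B \<in> sets (distr M S Z \<Otimes>\<^sub>M distr M T W)" using B by (simp cong: sets_pair_measure_cong)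
    then show ?thesis using ZW.measurable_emeasure_Pair2 by (intro nn_integral_distr) simp_all
  qed
  also have "\<dots> = (\<integral>\<^sup>+\<omega>'. emeasure M {\<omega> \<in> space M. (Z \<omega>, W \<omega>') \<in> B} \<partial>M)"
    using sets_Pair2[OF B] by (intro nn_integral_cong) (auto simp: emeasure_distr intro!: arg_cong[where f="emeasure M"])
  finally show ?thesis .
qed

locale falpha_scheme = prob_space M + growing_weights \<alpha>
  for M :: "'a measure" and \<alpha> :: "nat \<Rightarrow> real" +
  fixes Y :: "nat \<Rightarrow> 'a \<Rightarrow> real" and F :: "real \<Rightarrow> real"
  assumes indep_Y: "indep_vars (\<lambda>_. borel) Y {1..}"
    and law: "\<And>n x. n \<ge> 1 \<Longrightarrow> cdf (distr M borel (Y n)) x = F x powr \<alpha> n"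
    and F_df: "is_df F" and F_cont: "continuous_on UNIV F"
begin

lemma rv_Y: "n \<ge> 1 \<Longrightarrow> Y n \<in> borel_measurable M"
  using indep_Y by (auto simp: indep_vars_def)

lemma F_nonneg: "0 \<le> F x" using is_df_nonneg[OF F_df] .

lemma cdf_Y_cont: "n \<ge> 1 \<Longrightarrow> continuous_on UNIV (cdf (distr M borel (Y n)))"
proof -
  assume n: "n \<ge> 1"
  have "continuous_on UNIV (\<lambda>x. F x powr \<alpha> n)"
    using weight_pos[OF n] F_nonneg F_cont by (auto intro!: continuous_on_powr')
  then show ?thesis using law[OF n] by presburger
qed

lemma prob_Y_le: "n \<ge> 1 \<Longrightarrow> prob {\<omega> \<in> space M. Y n \<omega> \<le> x} = F x powr \<alpha> n"
proof -
  assume n: "n \<ge> 1"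
  have "Y n -` {..x} \<inter> space M = {\<omega> \<in> space M. Y n \<omega> \<le> x}" by auto
  then show ?thesis using law[OF n, of x] rv_Y[OF n] by (simp add: cdf_def measure_distr)
qed

lemma AE_Y_neq: "n \<ge> 1 \<Longrightarrow> AE \<omega> in M. Y n \<omega> \<noteq> x"
proof -
  assume n: "n \<ge> 1"
  have [measurable]: "Y n \<in> borel_measurable M" by (rule rv_Y[OF n])
  interpret D: real_distribution "distr M borel (Y n)" by (rule real_distribution_distr) simp
  have "measure (distr M borel (Y n)) {x} = 0"
    using cdf_Y_cont[OF n] by (simp add: D.isCont_cdf[symmetric] continuous_on_eq_continuous_at)
  then have "emeasure (distr M borel (Y n)) {x} = 0" by (simp add: D.emeasure_eq_measure)
  then have "emeasure M (Y n -` {x} \<inter> space M) = 0" by (simp add: emeasure_distr)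
  then show ?thesis by (intro AE_I[where N="Y n -` {x} \<inter> space M"]) auto
qed

text \<open>The level \<open>x\<close> is what makes an induction on \<open>n\<close> possible: whether time \<open>n + 1\<close> is a record depends on the past
through the maximum alone.\<close>
definition records_below :: "nat set \<Rightarrow> nat \<Rightarrow> real \<Rightarrow> 'a set" where
  "records_below J n x =
    {\<omega> \<in> space M. (\<forall>k\<in>J. \<forall>j\<in>{1..<k}. Y j \<omega> < Y k \<omega>) \<and> (\<forall>k\<in>{1..n}. Y k \<omega> \<le> x)}"

definition record_at_all :: "nat set \<Rightarrow> 'a set" where
  "record_at_all J = {\<omega> \<in> space M. \<forall>k\<in>J. \<forall>j\<in>{1..<k}. Y j \<omega> < Y k \<omega>}"

lemma record_at_all_events:
  assumes "J \<subseteq> {1..n}" shows "record_at_all J \<in> events"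
proof -
  have "finite J" using assms finite_subset by blast
  moreover have "{\<omega> \<in> space M. Y j \<omega> < Y k \<omega>} \<in> events" if "k \<in> J" "j \<in> {1..<k}" for k j
    using that assms by (intro borel_measurable_less rv_Y) auto
  ultimately show ?thesis
    unfolding record_at_all_def by (intro sets.sets_Collect_finite_All) auto
qed

lemma records_below_events:
  assumes "J \<subseteq> {1..n}" shows "records_below J n x \<in> events"
proof -
  have "{\<omega> \<in> space M. Y k \<omega> \<le> x} \<in> events" if "k \<in> {1..n}" for k
    using that by (intro borel_measurable_le rv_Y) auto
  then have "{\<omega> \<in> space M. \<forall>k\<in>{1..n}. Y k \<omega> \<le> x} \<in> events"
    by (intro sets.sets_Collect_finite_All) auto
  then have "record_at_all J \<inter> {\<omega> \<in> space M. \<forall>k\<in>{1..n}. Y k \<omega> \<le> x} \<in> events"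
    using record_at_all_events[OF assms] by (rule sets.Int[rotated])
  also have "record_at_all J \<inter> {\<omega> \<in> space M. \<forall>k\<in>{1..n}. Y k \<omega> \<le> x} = records_below J n x"
    unfolding records_below_def record_at_all_def by blast
  finally show ?thesis .
qed

lemma records_strictly_below_events:
  assumes "J \<subseteq> {1..n}"
  shows "{\<omega> \<in> space M. (\<forall>k\<in>J. \<forall>j\<in>{1..<k}. Y j \<omega> < Y k \<omega>) \<and> (\<forall>k\<in>{1..n}. Y k \<omega> < x)} \<in> events"
proof -
  have "{\<omega> \<in> space M. Y k \<omega> < x} \<in> events" if "k \<in> {1..n}" for k
    using that by (intro borel_measurable_less rv_Y) auto
  then have "{\<omega> \<in> space M. \<forall>k\<in>{1..n}. Y k \<omega> < x} \<in> events"
    by (intro sets.sets_Collect_finite_All) auto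
  then have "record_at_all J \<inter> {\<omega> \<in> space M. \<forall>k\<in>{1..n}. Y k \<omega> < x} \<in> events"
    using record_at_all_events[OF assms] by (rule sets.Int[rotated])
  also have "record_at_all J \<inter> {\<omega> \<in> space M. \<forall>k\<in>{1..n}. Y k \<omega> < x} =
    {\<omega> \<in> space M. (\<forall>k\<in>J. \<forall>j\<in>{1..<k}. Y j \<omega> < Y k \<omega>) \<and> (\<forall>k\<in>{1..n}. Y k \<omega> < x)}"
    unfolding record_at_all_def by blast
  finally show ?thesis .
qed

text \<open>Fixing the newest observation at \<open>w\<close>, it is a record exactly when the earlier observations lie below
\<open>w\<close>. Since their laws have no atoms, strict and weak inequality may be exchanged.\<close>
lemma records_below_step:
  assumes J: "J \<subseteq> {1..n}" and n: "n \<ge> 1"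
  shows "emeasure M (records_below (insert (Suc n) J) (Suc n) x) =
    (\<integral>\<^sup>+\<omega>'. emeasure M (records_below J n (Y (Suc n) \<omega>')) * indicator {..x} (Y (Suc n) \<omega>') \<partial>M)"
    and "emeasure M (records_below J (Suc n) x) =
    (\<integral>\<^sup>+\<omega>'. emeasure M (records_below J n x) * indicator {..x} (Y (Suc n) \<omega>') \<partial>M)"
proof -
  let ?P = "PiM {1..n} (\<lambda>_. borel :: real measure)"
  let ?Z = "\<lambda>\<omega>. \<lambda>k\<in>{1..n}. Y k \<omega>" 
  let ?R = "PiM {Suc n} (\<lambda>_. borel :: real measure)" and ?W = "\<lambda>\<omega>. \<lambda>k\<in>{Suc n}. Y k \<omega>"
  have fJ: "finite J" using J finite_subset by blast
  have [measurable]: "Y (Suc n) \<in> borel_measurable M" by (rule rv_Y) simp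
  have Zm [measurable]: "?Z \<in> measurable M ?P" by (intro measurable_restrict rv_Y) auto
  have comp [measurable]: "(\<lambda>z. z k) \<in> borel_measurable ?P" if "k \<in> {1..n}" for k
    using that by (rule measurable_component_singleton)
  have ind: "indep_var ?P ?Z ?R ?W"
    by (rule indep_var_restrict[OF indep_Y]) auto
  have [measurable]: "(\<lambda>z. z (Suc n)) \<in> borel_measurable ?R" by (rule measurable_component_singleton) simp
  have Wm: "?W \<in> measurable M ?R" by (intro measurable_restrict rv_Y) auto
  have records_pred [measurable]: "Measurable.pred (?P \<Otimes>\<^sub>M ?R) (\<lambda>p. \<forall>k\<in>J. \<forall>j\<in>{1..<k}. fst p j < fst p k)"
  proof (intro pred_intros_finite fJ finite_atLeastLessThan)
    fix k j assume "k \<in> J" "j \<in> {1..<k}"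
    then have [measurable]: "(\<lambda>z. z k) \<in> borel_measurable ?P" "(\<lambda>z. z j) \<in> borel_measurable ?P"
      using J by (auto intro!: comp)
    show "Measurable.pred (?P \<Otimes>\<^sub>M ?R) (\<lambda>p. fst p j < fst p k)" by measurable
  qed
  let ?r = "\<lambda>\<omega>. \<forall>k\<in>J. \<forall>j\<in>{1..<k}. Y j \<omega> < Y k \<omega>"
  have records_Z: "(\<forall>k\<in>J. \<forall>j\<in>{1..<k}. ?Z \<omega> j < ?Z \<omega> k) \<longleftrightarrow> ?r \<omega>" for \<omega>
    using J by (intro ball_cong refl) (auto simp: subset_iff)
  have disintegrate: "emeasure M {\<omega> \<in> space M. ?r \<omega> \<and> Q (?Z \<omega>) (Y (Suc n) \<omega>)} =
      (\<integral>\<^sup>+\<omega>'. emeasure M {\<omega> \<in> space M. ?r \<omega> \<and> Q (?Z \<omega>) (Y (Suc n) \<omega>')} \<partial>M)"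
    if [measurable]: "Measurable.pred (?P \<Otimes>\<^sub>M ?R) (\<lambda>p. Q (fst p) (snd p (Suc n)))" for Q :: "(nat \<Rightarrow> real) \<Rightarrow> real \<Rightarrow> bool"
  proof -
    let ?B = "{p \<in> space (?P \<Otimes>\<^sub>M ?R). (\<forall>k\<in>J. \<forall>j\<in>{1..<k}. fst p j < fst p k) \<and> Q (fst p) (snd p (Suc n))}"
    have "?B \<in> sets (?P \<Otimes>\<^sub>M ?R)" by measurable
    from emeasure_indep_pair[OF ind this]
    have dis: "emeasure M {\<omega> \<in> space M. (?Z \<omega>, ?W \<omega>) \<in> ?B} =
      (\<integral>\<^sup>+\<omega>'. emeasure M {\<omega> \<in> space M. (?Z \<omega>, ?W \<omega>') \<in> ?B} \<partial>M)" .
    have mem: "(?Z \<omega>, ?W \<omega>') \<in> ?B \<longleftrightarrow>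
        ?r \<omega> \<and> Q (?Z \<omega>) (Y (Suc n) \<omega>')"
      if "\<omega> \<in> space M" "\<omega>' \<in> space M" for \<omega> \<omega>'
      using measurable_space[OF Zm that(1)] measurable_space[OF Wm that(2)]
      unfolding mem_Collect_eq space_pair_measure fst_conv snd_conv records_Z by simp
    have L: "{\<omega> \<in> space M. (?Z \<omega>, ?W \<omega>) \<in> ?B} =
        {\<omega> \<in> space M. ?r \<omega> \<and> Q (?Z \<omega>) (Y (Suc n) \<omega>)}"
      using mem by blast
    have R: "(\<integral>\<^sup>+\<omega>'. emeasure M {\<omega> \<in> space M. (?Z \<omega>, ?W \<omega>') \<in> ?B} \<partial>M) =
      (\<integral>\<^sup>+\<omega>'. emeasure M {\<omega> \<in> space M. ?r \<omega> \<and> Q (?Z \<omega>) (Y (Suc n) \<omega>')} \<partial>M)"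
      using mem by (intro nn_integral_cong arg_cong[where f="emeasure M"]) blast
    show ?thesis using dis unfolding L R .
  qed
  have "emeasure M (records_below (insert (Suc n) J) (Suc n) x) =
    emeasure M {\<omega> \<in> space M. ?r \<omega> \<and> (\<forall>k\<in>{1..n}. ?Z \<omega> k < Y (Suc n) \<omega>) \<and> Y (Suc n) \<omega> \<le> x}"
  proof -
    have "(\<forall>k\<in>{1..n}. ?Z \<omega> k < Y (Suc n) \<omega>) \<and> Y (Suc n) \<omega> \<le> x \<longleftrightarrow>
       (\<forall>j\<in>{1..<Suc n}. Y j \<omega> < Y (Suc n) \<omega>) \<and> (\<forall>k\<in>{1..Suc n}. Y k \<omega> \<le> x)" for \<omega>
      by (force simp: atLeastAtMostSuc_conv atLeastLessThanSuc_atLeastAtMost)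
    then have "records_below (insert (Suc n) J) (Suc n) x =
      {\<omega> \<in> space M. ?r \<omega> \<and> (\<forall>k\<in>{1..n}. ?Z \<omega> k < Y (Suc n) \<omega>) \<and> Y (Suc n) \<omega> \<le> x}"
      unfolding records_below_def by blast
    then show ?thesis by simp
  qed
  also have "\<dots> = (\<integral>\<^sup>+\<omega>'. emeasure M {\<omega> \<in> space M. ?r \<omega> \<and> (\<forall>k\<in>{1..n}. ?Z \<omega> k < Y (Suc n) \<omega>') \<and> Y (Suc n) \<omega>' \<le> x} \<partial>M)"
  proof (rule disintegrate)
    have "Measurable.pred (?P \<Otimes>\<^sub>M ?R) (\<lambda>p. \<forall>k\<in>{1..n}. fst p k < snd p (Suc n))"
    proof (intro pred_intros_finite finite_atLeastAtMost)
      fix k assume "k \<in> {1..n}"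
      then have [measurable]: "(\<lambda>z. z k) \<in> borel_measurable ?P" by (rule comp)
      show "Measurable.pred (?P \<Otimes>\<^sub>M ?R) (\<lambda>p. fst p k < snd p (Suc n))" by measurable
    qed
    then show "Measurable.pred (?P \<Otimes>\<^sub>M ?R) (\<lambda>p. (\<forall>k\<in>{1..n}. fst p k < snd p (Suc n)) \<and> snd p (Suc n) \<le> x)" by measurable
  qed
  also have "\<dots> = (\<integral>\<^sup>+\<omega>'. emeasure M (records_below J n (Y (Suc n) \<omega>')) * indicator {..x} (Y (Suc n) \<omega>') \<partial>M)"
  proof (rule nn_integral_cong)
    fix \<omega>'
    define w where "w = Y (Suc n) \<omega>'"
    have "emeasure M {\<omega> \<in> space M. ?r \<omega> \<and> (\<forall>k\<in>{1..n}. ?Z \<omega> k < w) \<and> w \<le> x} =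
      emeasure M (records_below J n w) * indicator {..x} w"
    proof (cases "w \<le> x")
      case True
      have "emeasure M {\<omega> \<in> space M. ?r \<omega> \<and> (\<forall>k\<in>{1..n}. Y k \<omega> < w)} =
        emeasure M (records_below J n w)"
      proof (rule emeasure_eq_AE)
        have "AE \<omega> in M. \<forall>k\<in>{1..n}. Y k \<omega> \<noteq> w" by (intro AE_finite_allI AE_Y_neq) auto
        then show "AE \<omega> in M. \<omega> \<in> {\<omega> \<in> space M. ?r \<omega> \<and> (\<forall>k\<in>{1..n}. Y k \<omega> < w)}
            \<longleftrightarrow> \<omega> \<in> records_below J n w"
          by eventually_elim (auto simp: records_below_def order_less_le)
      qed (rule records_strictly_below_events[OF J], rule records_below_events[OF J])
      then show ?thesis using True by simp
    qed simp
    then show "emeasure M {\<omega> \<in> space M. ?r \<omega> \<and> (\<forall>k\<in>{1..n}. ?Z \<omega> k < Y (Suc n) \<omega>') \<and> Y (Suc n) \<omega>' \<le> x} =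
      emeasure M (records_below J n (Y (Suc n) \<omega>')) * indicator {..x} (Y (Suc n) \<omega>')"
      unfolding w_def .
  qed
  finally show "emeasure M (records_below (insert (Suc n) J) (Suc n) x) =
    (\<integral>\<^sup>+\<omega>'. emeasure M (records_below J n (Y (Suc n) \<omega>')) * indicator {..x} (Y (Suc n) \<omega>') \<partial>M)" .
  have "emeasure M (records_below J (Suc n) x) =
    emeasure M {\<omega> \<in> space M. ?r \<omega> \<and> (\<forall>k\<in>{1..n}. ?Z \<omega> k \<le> x) \<and> Y (Suc n) \<omega> \<le> x}"
    by (intro arg_cong[where f="emeasure M"]) (auto simp: records_below_def atLeastAtMostSuc_conv)
  also have "\<dots> = (\<integral>\<^sup>+\<omega>'. emeasure M {\<omega> \<in> space M. ?r \<omega> \<and> (\<forall>k\<in>{1..n}. ?Z \<omega> k \<le> x) \<and> Y (Suc n) \<omega>' \<le> x} \<partial>M)"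
  proof (rule disintegrate)
    have "Measurable.pred (?P \<Otimes>\<^sub>M ?R) (\<lambda>p. \<forall>k\<in>{1..n}. fst p k \<le> x)"
    proof (intro pred_intros_finite finite_atLeastAtMost)
      fix k assume "k \<in> {1..n}"
      then have [measurable]: "(\<lambda>z. z k) \<in> borel_measurable ?P" by (rule comp)
      show "Measurable.pred (?P \<Otimes>\<^sub>M ?R) (\<lambda>p. fst p k \<le> x)" by measurable
    qed
    then show "Measurable.pred (?P \<Otimes>\<^sub>M ?R) (\<lambda>p. (\<forall>k\<in>{1..n}. fst p k \<le> x) \<and> snd p (Suc n) \<le> x)" by measurable
  qed
  also have "\<dots> = (\<integral>\<^sup>+\<omega>'. emeasure M (records_below J n x) * indicator {..x} (Y (Suc n) \<omega>') \<partial>M)"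
    by (intro nn_integral_cong) (auto simp: records_below_def split: split_indicator)
  finally show "emeasure M (records_below J (Suc n) x) =
    (\<integral>\<^sup>+\<omega>'. emeasure M (records_below J n x) * indicator {..x} (Y (Suc n) \<omega>') \<partial>M)" .
qed

text \<open>Record events at different times are independent of each other and of the current maximum. If time
\<open>n + 1\<close> is in \<open>J\<close>, the integral of \<open>F\<^sup>s d(F\<^sup>\<alpha>)\<close> with \<open>s = s\<^sub>n\<close> and \<open>\<alpha> = \<alpha>\<^bsub>n+1\<^esub>\<close>
contributes the factor \<open>\<alpha> / (s + \<alpha>) = p\<^bsub>n+1\<^esub>\<close>; otherwise the new observation
only contributes \<open>F\<^sup>\<alpha>(x)\<close>.\<close>
lemma prob_records_below:
  assumes "n \<ge> 1" "J \<subseteq> {1..n}"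
  shows "prob (records_below J n x) = (\<Prod>k\<in>J. p_seq \<alpha> k) * F x powr s_seq \<alpha> n"
  using assms
proof (induction n arbitrary: J x rule: dec_induct)
  case base
  then have "J = {} \<or> J = {1}" by auto
  then show ?case
    using prob_Y_le[of 1 x] p_first by (auto simp: records_below_def s_seq_def)
next
  case (step n)
  let ?Q = "distr M borel (Y (Suc n))"
  have [measurable]: "Y (Suc n) \<in> borel_measurable M" by (rule rv_Y) simp
  interpret Q: real_distribution ?Q by (rule real_distribution_distr) simp
  have pos: "0 < s_seq \<alpha> n" "0 < \<alpha> (Suc n)" using step.hyps s_pos weight_pos by auto
  define J' where "J' = J - {Suc n}"
  have J': "J' \<subseteq> {1..n}" using step.prems by (auto simp: J'_def atLeastAtMostSuc_conv)
  have fJ': "finite J'" using J' finite_subset by blast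
  have p0: "0 \<le> (\<Prod>k\<in>J'. p_seq \<alpha> k)"
    using J' p_pos by (intro prod_nonneg) (auto simp: subset_iff intro: less_imp_le)
  have IH: "emeasure M (records_below J' n w) = ennreal (\<Prod>k\<in>J'. p_seq \<alpha> k) * ennreal (F w powr s_seq \<alpha> n)" for w
    using step.IH[OF J'] p0 by (simp add: emeasure_eq_measure ennreal_mult)
  have meas [measurable]: "(\<lambda>w. F w powr s_seq \<alpha> n) \<in> borel_measurable borel"
    using borel_measurable_continuous_onI[OF F_cont] by measurable
  show ?case
  proof (cases "Suc n \<in> J")
    case True
    then have J: "J = insert (Suc n) J'" "Suc n \<notin> J'" by (auto simp: J'_def)
    \<comment> \<open>\<open>F\<^sup>s\<close> as a power of the distribution function \<open>F\<^sup>\<alpha>\<close> of the new observation.\<close>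
    have power: "F w powr s_seq \<alpha> n = cdf ?Q w powr (s_seq \<alpha> n / \<alpha> (Suc n))" for w
      using pos by (simp add: law powr_powr)
    have "emeasure M (records_below J (Suc n) x) =
      (\<integral>\<^sup>+\<omega>. ennreal (\<Prod>k\<in>J'. p_seq \<alpha> k) * (ennreal (F (Y (Suc n) \<omega>) powr s_seq \<alpha> n) * indicator {..x} (Y (Suc n) \<omega>)) \<partial>M)"
      unfolding J(1) records_below_step(1)[OF J' step.hyps(1)] IH by (simp add: mult.assoc)
    also have "\<dots> = (\<integral>\<^sup>+w. ennreal (\<Prod>k\<in>J'. p_seq \<alpha> k) * (ennreal (F w powr s_seq \<alpha> n) * indicator {..x} w) \<partial>?Q)"
      by (subst nn_integral_distr) auto
    also have "\<dots> = ennreal (\<Prod>k\<in>J'. p_seq \<alpha> k) * (\<integral>\<^sup>+w. ennreal (F w powr s_seq \<alpha> n) * indicator {..x} w \<partial>?Q)"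
      by (rule nn_integral_cmult) measurable
    also have "(\<integral>\<^sup>+w. ennreal (F w powr s_seq \<alpha> n) * indicator {..x} w \<partial>?Q) =
       ennreal (cdf ?Q x powr (s_seq \<alpha> n / \<alpha> (Suc n) + 1) / (s_seq \<alpha> n / \<alpha> (Suc n) + 1))"
      unfolding power by (rule Q.integral_cdf_power[OF cdf_Y_cont]) (use pos in auto)
    also have "cdf ?Q x powr (s_seq \<alpha> n / \<alpha> (Suc n) + 1) / (s_seq \<alpha> n / \<alpha> (Suc n) + 1) =
        p_seq \<alpha> (Suc n) * F x powr s_seq \<alpha> (Suc n)"
    proof -
      have "\<alpha> (Suc n) * (s_seq \<alpha> n / \<alpha> (Suc n) + 1) = s_seq \<alpha> (Suc n)"
        using pos by (simp add: s_Suc field_simps)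
      moreover have "s_seq \<alpha> n / \<alpha> (Suc n) + 1 = inverse (p_seq \<alpha> (Suc n))"
        using pos by (simp add: p_seq_def s_Suc field_simps)
      ultimately show ?thesis by (simp add: law powr_powr divide_inverse mult.commute)
    qed
    finally have "emeasure M (records_below J (Suc n) x) =
        ennreal ((\<Prod>k\<in>J'. p_seq \<alpha> k) * (p_seq \<alpha> (Suc n) * F x powr s_seq \<alpha> (Suc n)))"
      using p0 by (simp add: ennreal_mult')
    then show ?thesis
      using J fJ' p0 p_pos[of "Suc n"] by (subst measure_eq_emeasure_eq_ennreal) (auto simp: mult_ac)
  next
    case False
    then have J: "J = J'" by (auto simp: J'_def)
    have "emeasure M (records_below J (Suc n) x) = emeasure M (records_below J' n x) * emeasure ?Q {..x}"
    proof -
      have "(\<integral>\<^sup>+\<omega>. emeasure M (records_below J' n x) * indicator {..x} (Y (Suc n) \<omega>) \<partial>M) =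
          (\<integral>\<^sup>+w. emeasure M (records_below J' n x) * indicator {..x} w \<partial>?Q)"
        by (subst nn_integral_distr) auto
      then show ?thesis unfolding J records_below_step(2)[OF J' step.hyps(1)]
        by (simp add: nn_integral_cmult_indicator)
    qed
    also have "emeasure ?Q {..x} = ennreal (F x powr \<alpha> (Suc n))"
      using law[of "Suc n" x] by (simp add: Q.emeasure_eq_measure cdf_def2)
    finally have "emeasure M (records_below J (Suc n) x) =
        ennreal ((\<Prod>k\<in>J'. p_seq \<alpha> k) * F x powr s_seq \<alpha> (Suc n))"
      using p0 by (simp add: IH s_Suc powr_add ennreal_mult' mult.assoc)
    then show ?thesis
      unfolding J using p0 by (subst measure_eq_emeasure_eq_ennreal) auto
  qed
qed

definition record_at :: "nat \<Rightarrow> 'a set" where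
  "record_at k = {\<omega> \<in> space M. \<forall>j\<in>{1..<k}. Y j \<omega> < Y k \<omega>}"

lemma record_at_events: "k \<ge> 1 \<Longrightarrow> record_at k \<in> events"
proof -
  assume k: "k \<ge> 1"
  have "record_at k = record_at_all {k}"
    by (simp add: record_at_def record_at_all_def)
  then show ?thesis using record_at_all_events[of "{k}" k] k by simp
qed

lemma prob_records:
  assumes J: "finite J" "J \<subseteq> {1..}"
  shows "prob (record_at_all J) = (\<Prod>k\<in>J. p_seq \<alpha> k)"
proof -
  define n where "n = Max (insert 1 J)"
  have n: "n \<ge> 1" "J \<subseteq> {1..n}" using J by (auto simp: n_def)
  have "(\<lambda>i. prob (records_below J n (real i))) \<longlonglongrightarrow> prob (\<Union>i. records_below J n (real i))"
  proof (rule finite_Lim_measure_incseq)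
    show "range (\<lambda>i. records_below J n (real i)) \<subseteq> events"
      using records_below_events[OF n(2)] by auto
    show "incseq (\<lambda>i. records_below J n (real i))"
      by (intro incseq_SucI) (force simp: records_below_def)
  qed
  also have "(\<Union>i. records_below J n (real i)) = record_at_all J"
  proof -
    have "\<exists>i. \<forall>k\<in>{1..n}. Y k \<omega> \<le> real i" for \<omega>
    proof -
      obtain i where "Max ((\<lambda>k. Y k \<omega>) ` {1..n}) \<le> real i" using real_arch_simple by blast
      then have "\<forall>k\<in>{1..n}. Y k \<omega> \<le> real i" using n by (subst (asm) Max_le_iff) auto
      then show ?thesis by blast
    qed
    then show ?thesis by (auto simp: records_below_def record_at_all_def)
  qed
  finally have 1: "(\<lambda>i. (\<Prod>k\<in>J. p_seq \<alpha> k) * F (real i) powr s_seq \<alpha> n) \<longlonglongrightarrow> prob (record_at_all J)"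
    by (simp add: prob_records_below[OF n])
  have "(\<lambda>i. F (real i)) \<longlonglongrightarrow> 1"
    using F_df by (auto simp: is_df_def intro: filterlim_compose[OF _ filterlim_real_sequentially])
  then have "(\<lambda>i. (\<Prod>k\<in>J. p_seq \<alpha> k) * F (real i) powr s_seq \<alpha> n) \<longlonglongrightarrow> (\<Prod>k\<in>J. p_seq \<alpha> k) * 1 powr s_seq \<alpha> n"
    by (intro tendsto_intros) auto
  then show ?thesis using LIMSEQ_unique[OF 1] by simp
qed

lemma indep_record_at: "indep_events record_at {1..}"
proof (rule indep_eventsI)
  fix J :: "nat set" assume J: "J \<subseteq> {1..}" "finite J" "J \<noteq> {}"
  have "prob (\<Inter>k\<in>J. record_at k) = (\<Prod>k\<in>J. p_seq \<alpha> k)"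
    proof -
      have "(\<Inter>k\<in>J. record_at k) = record_at_all J"
        using J(3) by (auto simp: record_at_def record_at_all_def)
      then show ?thesis using prob_records[OF J(2,1)] by simp
    qed
  also have "\<dots> = (\<Prod>k\<in>J. prob (record_at k))"
  proof (rule prod.cong)
    fix k assume "k \<in> J"
    then show "p_seq \<alpha> k = prob (record_at k)"
      using prob_records[of "{k}"] J(1) by (auto simp: record_at_def record_at_all_def)
  qed simp
  finally show "prob (\<Inter> (record_at ` J)) = (\<Prod>k\<in>J. prob (record_at k))" .
qed (auto intro: record_at_events)

theorem record_indicators_independent_trials: "independent_trials M \<alpha> (record_indicator Y)"
proof unfold_locales
  have ind: "indep_sets (\<lambda>k. sigma_sets (space M) {record_at k}) {1..}"
    using indep_record_at unfolding indep_events_def_alt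
    by (rule indep_sets_sigma) (simp add: Int_stable_def)
  have preimage: "record_indicator Y k -` A \<inter> space M =
      (if 1 \<in> A then record_at k else {}) \<union> (if 0 \<in> A then space M - record_at k else {})"
    if "k \<ge> 1" for k A
  proof -
    have "record_indicator Y k \<omega> = of_bool (\<omega> \<in> record_at k)" if "\<omega> \<in> space M" for \<omega>
      using \<open>k \<ge> 1\<close> that by (simp add: record_indicator_iff record_at_def)
    then show ?thesis using sets.sets_into_space[OF record_at_events[OF that]] by (auto simp: of_bool_def split: if_splits)
  qed
  have sub: "{record_indicator Y k -` A \<inter> space M |A. A \<in> sets borel} \<subseteq> sigma_sets (space M) {record_at k}"
    if "k \<ge> 1" for k
  proof clarify
    fix A :: "real set"
    interpret S: sigma_algebra "space M" "sigma_sets (space M) {record_at k}"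
      by (rule sigma_algebra_sigma_sets) (auto simp: record_at_def)
    have "record_at k \<in> sigma_sets (space M) {record_at k}" by auto
    then show "record_indicator Y k -` A \<inter> space M \<in> sigma_sets (space M) {record_at k}"
      unfolding preimage[OF that] by auto
  qed
  show "indep_vars (\<lambda>_. borel) (record_indicator Y) {1..}"
    unfolding indep_vars_def2
  proof (intro conjI ballI)
    fix k :: nat assume k: "k \<in> {1..}"
    show "record_indicator Y k \<in> borel_measurable M"
    proof (rule measurableI)
      fix A :: "real set" assume "A \<in> sets borel"
      then show "record_indicator Y k -` A \<inter> space M \<in> events"
        using k record_at_events[of k] by (subst preimage) auto
    qed simp
  next
    show "indep_sets (\<lambda>i. {record_indicator Y i -` A \<inter> space M |A. A \<in> sets borel}) {1..}"
      by (rule indep_sets_mono_sets[OF ind sub]) simp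
  qed
  show "record_indicator Y n \<omega> \<in> {0, 1}" for n \<omega> by (simp add: record_indicator_def)
  show "expectation (record_indicator Y n) = p_seq \<alpha> n" if n: "n \<ge> 1" for n
  proof -
    have "expectation (record_indicator Y n) = expectation (indicator (record_at n))"
      using n by (intro Bochner_Integration.integral_cong) (auto simp: record_indicator_iff record_at_def split: split_indicator)
    also have "\<dots> = prob (record_at n)" using record_at_events[OF n] by simp
    also have "\<dots> = p_seq \<alpha> n"
      using prob_records[of "{n}"] n by (simp add: record_at_def record_at_all_def)
    finally show ?thesis .
  qed
qed

end

section \<open>Couplings of two laws on the line\<close>

text \<open>On the set where \<open>h > 1\<close> the excess \<open>h - 1\<close> has integral at most \<open>0\<close>; finiteness of \<open>P\<close> makes the
subtraction legitimate.\<close>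
lemma AE_density_le_1:
  assumes fin: "finite_measure P" and h [measurable]: "h \<in> borel_measurable P"
    and le: "\<And>A. A \<in> sets P \<Longrightarrow> emeasure (density P h) A \<le> emeasure P A"
  shows "AE x in P. h x \<le> 1"
proof -
  interpret finite_measure P by fact
  let ?B = "{x \<in> space P. 1 < h x}"
  have "(\<integral>\<^sup>+x. (h x - 1) * indicator ?B x \<partial>P) + emeasure P ?B = (\<integral>\<^sup>+x. (h x - 1) * indicator ?B x + indicator ?B x \<partial>P)"
    by (subst nn_integral_add) auto
  also have "\<dots> = (\<integral>\<^sup>+x. h x * indicator ?B x \<partial>P)"
    by (intro nn_integral_cong) (auto split: split_indicator intro!: diff_add_cancel_ennreal)
  also have "\<dots> = emeasure (density P h) ?B" by (rule emeasure_density[symmetric]) auto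
  also have "\<dots> \<le> emeasure P ?B" by (rule le) auto
  finally have "emeasure P ?B + (\<integral>\<^sup>+x. (h x - 1) * indicator ?B x \<partial>P) \<le> emeasure P ?B + 0"
    by (simp add: add.commute)
  then have "(\<integral>\<^sup>+x. (h x - 1) * indicator ?B x \<partial>P) \<le> 0"
    using emeasure_finite[of ?B] unfolding ennreal_add_left_cancel_le by simp
  then have "AE x in P. (h x - 1) * indicator ?B x = 0"
    by (subst nn_integral_0_iff_AE[symmetric]) auto
  then show ?thesis
    by (rule AE_mp) (auto intro!: AE_I2 simp: not_less[symmetric] diff_eq_0_iff_ennreal split: split_indicator_asm)
qed

text \<open>Let \<open>H\<close> be a Hahn set on which \<open>P\<close> dominates \<open>Q\<close>. The common part of the two laws has density \<open>\<phi>\<close> with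
respect to \<open>P\<close>, where \<open>\<phi>\<close> is the density of \<open>Q\<close> on \<open>H\<close> and \<open>1\<close> outside. A point drawn from \<open>P\<close> is
kept with probability \<open>\<phi>\<close> and otherwise replaced by an independent point drawn from the normalised rest of
\<open>Q\<close>. The second coordinate then has law \<open>Q\<close>, and the probability of a replacement is
\<open>P(H) - Q(H)\<close>.\<close>
lemma maximal_coupling:
  fixes P Q :: "real measure"
  assumes P: "real_distribution P" and Q: "real_distribution Q"
    and d: "\<And>A. A \<in> sets borel \<Longrightarrow> \<bar>measure P A - measure Q A\<bar> \<le> d"
  shows "\<exists>K. prob_space K \<and> sets K = sets (borel \<Otimes>\<^sub>M borel) \<and>
    distr K borel fst = P \<and> distr K borel snd = Q \<and> measure K {p \<in> space K. fst p \<noteq> snd p} \<le> d"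
proof -
  interpret P: real_distribution P by (rule P)
  interpret Q: real_distribution Q by (rule Q)
  have sP [measurable_cong]: "sets P = sets borel" and sQ [measurable_cong]: "sets Q = sets borel" by simp_all
  obtain H where H [measurable]: "H \<in> sets borel"
    and QP: "\<And>A. A \<in> sets borel \<Longrightarrow> A \<subseteq> H \<Longrightarrow> emeasure Q A \<le> emeasure P A"
    and PQ: "\<And>A. A \<in> sets borel \<Longrightarrow> A \<inter> H = {} \<Longrightarrow> emeasure P A \<le> emeasure Q A"
    using finite_unsigned_Hahn_decomposition[of P Q] P.finite_measure_axioms Q.finite_measure_axioms by auto
  let ?QH = "density Q (indicator H)"
  have QH: "emeasure ?QH A = emeasure Q (A \<inter> H)" if "A \<in> sets borel" for A
    using that by (subst emeasure_density) (auto simp: indicator_inter_arith[symmetric] mult.commute Int_commute)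
  have QH_le: "emeasure ?QH A \<le> emeasure P A" if A: "A \<in> sets borel" for A
    unfolding QH[OF A] using A QP[of "A \<inter> H"] emeasure_mono[of "A \<inter> H" A P] by (auto intro: order_trans)
  have "absolutely_continuous P ?QH"
    unfolding absolutely_continuous_def
  proof
    fix A assume "A \<in> null_sets P"
    then show "A \<in> null_sets ?QH" using QH_le[of A] by (auto simp: null_sets_def)
  qed
  moreover have "finite_measure ?QH"
    using QH_le[of UNIV] by (intro finite_measureI) (auto simp: top_unique)
  ultimately obtain h where h [measurable]: "h \<in> borel_measurable P" and hQH: "density P h = ?QH"
    using P.Radon_Nikodym_finite_measure[of ?QH] by auto
  have h1: "AE x in P. h x \<le> 1"
    by (rule AE_density_le_1) (use P.finite_measure_axioms QH_le hQH in auto)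
  define \<phi> where "\<phi> x = (if x \<in> H then min 1 (h x) else 1)" for x
  have \<phi> [measurable]: "\<phi> \<in> borel_measurable borel" unfolding \<phi>_def[abs_def] by measurable
  have \<phi>1: "\<phi> x \<le> 1" for x by (simp add: \<phi>_def)
  let ?C = "\<lambda>A. \<integral>\<^sup>+x. \<phi> x * indicator A x \<partial>P"
  have common: "?C A = emeasure Q (A \<inter> H) + emeasure P (A - H)" if A [measurable]: "A \<in> sets borel" for A
  proof -
    have "?C A = (\<integral>\<^sup>+x. h x * indicator (A \<inter> H) x + indicator (A - H) x \<partial>P)"
      by (rule nn_integral_cong_AE) (use h1 in eventually_elim, auto simp: \<phi>_def min_def split: split_indicator)
    also have "\<dots> = (\<integral>\<^sup>+x. h x * indicator (A \<inter> H) x \<partial>P) + emeasure P (A - H)"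
      by (subst nn_integral_add) auto
    also have "(\<integral>\<^sup>+x. h x * indicator (A \<inter> H) x \<partial>P) = emeasure ?QH (A \<inter> H)"
      unfolding hQH[symmetric] by (rule emeasure_density[symmetric]) auto
    finally show ?thesis by (simp add: QH Int_assoc)
  qed
  have common_le: "?C A \<le> emeasure Q A" if A [measurable]: "A \<in> sets borel" for A
  proof -
    have "?C A \<le> emeasure Q (A \<inter> H) + emeasure Q (A - H)"
      unfolding common[OF A] by (intro add_left_mono PQ) auto
    also have "\<dots> = emeasure Q A" by (subst plus_emeasure) (auto intro!: arg_cong[where f="emeasure Q"])
    finally show ?thesis .
  qed
  \<comment> \<open>The probability of a replacement.\<close>
  define loss where "loss = (\<integral>\<^sup>+x. 1 - \<phi> x \<partial>P)"
  have loss_le: "loss \<le> 1"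
  proof -
    have "loss \<le> (\<integral>\<^sup>+x. 1 \<partial>P)" unfolding loss_def by (intro nn_integral_mono) simp
    then show ?thesis using P.emeasure_space_1 by simp
  qed
  then have loss_fin: "loss \<noteq> \<top>" by (metis ennreal_one_neq_top top.extremum_unique)
  have total: "(\<integral>\<^sup>+x. \<phi> x \<partial>P) + loss = 1"
  proof -
    have "(\<integral>\<^sup>+x. \<phi> x \<partial>P) + loss = (\<integral>\<^sup>+x. \<phi> x + (1 - \<phi> x) \<partial>P)"
      unfolding loss_def by (subst nn_integral_add) auto
    also have "\<dots> = (\<integral>\<^sup>+x. 1 \<partial>P)"
      by (intro nn_integral_cong) (simp add: add_diff_inverse_ennreal \<phi>1)
    finally show ?thesis using P.emeasure_space_1 by simp
  qed
  have loss_d: "loss \<le> ennreal d"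
  proof -
    have "measure Q H + measure P (- H) + enn2real loss = 1"
    proof -
      have "ennreal (measure Q H + measure P (- H)) + loss = 1"
        using total common[of UNIV] by (simp add: Q.emeasure_eq_measure P.emeasure_eq_measure Compl_eq_Diff_UNIV)
      then have "ennreal (measure Q H + measure P (- H) + enn2real loss) = ennreal 1"
        using loss_le by (subst ennreal_plus) (auto simp: ennreal_enn2real_if top_unique)
      then show ?thesis by (subst (asm) ennreal_inj) auto
    qed
    moreover have "measure P (- H) = 1 - measure P H"
      using P.prob_compl[of H] by (simp add: Compl_eq_Diff_UNIV)
    ultimately have "enn2real loss \<le> d" using d[OF H] by linarith
    then have "ennreal (enn2real loss) \<le> ennreal d" by (rule ennreal_leI)
    then show ?thesis using loss_le by (simp add: ennreal_enn2real_if top_unique split: if_splits)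
  qed
  obtain W where W: "real_distribution W"
    and residual: "\<And>A. A \<in> sets borel \<Longrightarrow> ?C A + loss * emeasure W A = emeasure Q A"
  proof (cases "loss = 0")
    case True
    have "?C A = emeasure Q A" if A [measurable]: "A \<in> sets borel" for A
    proof (rule antisym[OF common_le[OF A]])
      have "(\<integral>\<^sup>+x. \<phi> x \<partial>P) = (\<integral>\<^sup>+x. \<phi> x * indicator A x + \<phi> x * indicator (- A) x \<partial>P)"
        by (intro nn_integral_cong) (auto split: split_indicator)
      also have "\<dots> = ?C A + (\<integral>\<^sup>+x. \<phi> x * indicator (- A) x \<partial>P)"
        by (subst nn_integral_add) auto
      also have "\<dots> \<le> ?C A + emeasure Q (- A)"
        by (intro add_left_mono common_le) auto
      finally have "emeasure Q A + emeasure Q (- A) \<le> ?C A + emeasure Q (- A)"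
        using total True Q.emeasure_space_1 plus_emeasure[of A Q "- A"] by simp
      then show "emeasure Q A \<le> ?C A"
        using Q.emeasure_finite[of "- A"]
        by (simp add: add.commute[of _ "emeasure Q (- A)"] ennreal_add_left_cancel_le)
    qed
    then show ?thesis using that[of Q] Q True by simp
  next
    case False
    let ?D = "density P \<phi>"
    let ?R = "diff_measure Q ?D"
    have D: "emeasure ?D A = ?C A" if "A \<in> sets borel" for A
      using that by (simp add: emeasure_density)
    have "finite_measure ?D" using common_le[of UNIV] D[of UNIV] by (intro finite_measureI) (auto simp: top_unique)
    then have R: "emeasure ?R A = emeasure Q A - emeasure ?D A" if "A \<in> sets borel" for A
      using that Q.finite_measure_axioms common_le by (intro emeasure_diff_measure) (auto simp: D)
    have R_UNIV: "emeasure ?R UNIV = loss"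
    proof -
      have "emeasure ?R UNIV = 1 - (\<integral>\<^sup>+x. \<phi> x \<partial>P)"
        using Q.emeasure_space_1 by (simp add: R D)
      also have "\<dots> = ((\<integral>\<^sup>+x. \<phi> x \<partial>P) + loss) - (\<integral>\<^sup>+x. \<phi> x \<partial>P)" by (simp only: total)
      also have "\<dots> = loss"
        using common_le[of UNIV] by (intro ennreal_add_diff_cancel_left) (auto simp: top_unique)
      finally show ?thesis .
    qed
    let ?W = "uniform_measure ?R UNIV"
    interpret W: prob_space ?W
      using False loss_le by (intro prob_space_uniform_measure) (auto simp: R_UNIV top_unique)
    have "real_distribution ?W" by unfold_locales auto
    moreover have "?C A + loss * emeasure ?W A = emeasure Q A" if A: "A \<in> sets borel" for A
    proof -
      have "loss * emeasure ?W A = loss * (emeasure ?R A / loss)"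
        using A by (subst emeasure_uniform_measure) (auto simp: R_UNIV)
      also have "\<dots> = emeasure ?R A"
        using False loss_fin by (simp add: ennreal_times_divide mult.commute[of loss] ennreal_mult_divide_eq)
      finally show ?thesis
        using common_le[OF A] by (simp add: R[OF A] D[OF A] add_diff_inverse_ennreal)
    qed
    ultimately show ?thesis using that by blast
  qed
  interpret W: real_distribution W by (rule W)
  \<comment> \<open>The uniform variable decides whether the point is kept.\<close>
  define U where "U = uniform_measure lborel {0..1::real}"
  interpret U: prob_space U unfolding U_def by (rule prob_space_uniform_measure) auto
  have sU [measurable_cong, simp]: "sets U = sets borel" by (simp add: U_def)
  have sW [measurable_cong]: "sets W = sets borel" by simp
  have U_le: "emeasure U {u. ennreal u \<le> c} = c" if c: "c \<le> 1" for c
  proof -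
    have "c \<noteq> \<top>" using c by (metis ennreal_one_neq_top top.extremum_unique)
    then obtain r where r: "c = ennreal r" "0 \<le> r" by (cases c) auto
    then have "r \<le> 1" using c by simp
    have "{0..1} \<inter> {u. ennreal u \<le> c} = {0..r}" using r \<open>r \<le> 1\<close> by (auto simp: ennreal_le_iff)
    then show ?thesis unfolding U_def using r by (subst emeasure_uniform_measure) (auto simp: divide_ennreal_def)
  qed
  have U_gt: "emeasure U {u. \<not> ennreal u \<le> c} = 1 - c" if "c \<le> 1" for c
  proof -
    have "emeasure U {u. \<not> ennreal u \<le> c} = emeasure U (space U - {u. ennreal u \<le> c})"
      by (intro arg_cong[where f="emeasure U"]) (auto simp: U_def)
    also have "\<dots> = 1 - c"
      using that by (subst emeasure_compl) (auto simp: U_le U.emeasure_space_1 top_unique)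
    finally show ?thesis .
  qed
  interpret UW: pair_prob_space U W ..
  interpret PUW: pair_prob_space P "U \<Otimes>\<^sub>M W" ..
  define g where "g = (\<lambda>(x, u, w). (x, if ennreal u \<le> \<phi> x then x else w))"
  have g [measurable]: "g \<in> measurable (P \<Otimes>\<^sub>M (U \<Otimes>\<^sub>M W)) (borel \<Otimes>\<^sub>M borel)"
    unfolding g_def by measurable
  let ?PUW = "P \<Otimes>\<^sub>M (U \<Otimes>\<^sub>M W)"
  let ?K = "distr ?PUW (borel \<Otimes>\<^sub>M borel) g"
  have "distr ?K borel fst = distr ?PUW P fst"
    by (subst distr_distr) (auto simp: g_def comp_def case_prod_beta intro!: distr_cong)
  also have "\<dots> = P" by (rule UW.P.distr_pair_fst)
  finally have fst_law: "distr ?K borel fst = P" .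
  have snd_law: "distr ?K borel snd = Q"
  proof (rule measure_eqI)
    fix A assume "A \<in> sets (distr ?K borel snd)"
    then have A [measurable]: "A \<in> sets borel" by simp
    let ?S = "{p \<in> space ?PUW. snd (g p) \<in> A}"
    have S: "?S \<in> sets ?PUW" by measurable
    have "emeasure (distr ?K borel snd) A = emeasure ?PUW ?S"
      by (subst distr_distr) (auto simp: emeasure_distr comp_def intro!: arg_cong[where f="emeasure ?PUW"])
    also have "\<dots> = (\<integral>\<^sup>+x. emeasure (U \<Otimes>\<^sub>M W) (Pair x -` ?S) \<partial>P)"
      by (rule UW.P.emeasure_pair_measure_alt[OF S])
    also have "\<dots> = (\<integral>\<^sup>+x. \<phi> x * indicator A x + (1 - \<phi> x) * emeasure W A \<partial>P)"
    proof (rule nn_integral_cong)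
      fix x
      have "Pair x -` ?S = {u. ennreal u \<le> \<phi> x} \<times> (if x \<in> A then UNIV else {}) \<union> {u. \<not> ennreal u \<le> \<phi> x} \<times> A"
        by (auto simp: g_def space_pair_measure U_def split: if_splits)
      also have "emeasure (U \<Otimes>\<^sub>M W) \<dots> = emeasure (U \<Otimes>\<^sub>M W) ({u. ennreal u \<le> \<phi> x} \<times> (if x \<in> A then UNIV else {}))
          + emeasure (U \<Otimes>\<^sub>M W) ({u. \<not> ennreal u \<le> \<phi> x} \<times> A)"
        by (rule plus_emeasure[symmetric]) auto
      also have "\<dots> = \<phi> x * indicator A x + (1 - \<phi> x) * emeasure W A"
        using W.emeasure_space_1 by (auto simp: W.emeasure_pair_measure_Times U_le U_gt \<phi>1)
      finally show "emeasure (U \<Otimes>\<^sub>M W) (Pair x -` ?S) = \<phi> x * indicator A x + (1 - \<phi> x) * emeasure W A" .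
    qed
    also have "\<dots> = ?C A + loss * emeasure W A"
      unfolding loss_def by (subst nn_integral_add) (auto simp: nn_integral_multc)
    finally show "emeasure (distr ?K borel snd) A = emeasure Q A" using residual[OF A] by simp
  qed simp
  have K: "prob_space ?K" by (rule PUW.P.prob_space_distr) simp
  interpret K: prob_space ?K by (rule K)
  have "emeasure ?K {p \<in> space ?K. fst p \<noteq> snd p} \<le> ennreal d"
  proof -
    let ?S = "{p \<in> space ?PUW. \<not> ennreal (fst (snd p)) \<le> \<phi> (fst p)}"
    have S: "?S \<in> sets ?PUW" by measurable
    have "emeasure ?K {p \<in> space ?K. fst p \<noteq> snd p} \<le> emeasure ?PUW ?S"
      using S by (subst emeasure_distr) (auto intro!: emeasure_mono simp: g_def split: if_splits)
    also have "\<dots> = (\<integral>\<^sup>+x. emeasure (U \<Otimes>\<^sub>M W) (Pair x -` ?S) \<partial>P)"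
      by (rule UW.P.emeasure_pair_measure_alt[OF S])
    also have "\<dots> = loss" unfolding loss_def
    proof (rule nn_integral_cong)
      fix x
      have "Pair x -` ?S = {u. \<not> ennreal u \<le> \<phi> x} \<times> UNIV"
        by (auto simp: space_pair_measure U_def)
      then show "emeasure (U \<Otimes>\<^sub>M W) (Pair x -` ?S) = 1 - \<phi> x"
        using W.emeasure_space_1 by (simp add: W.emeasure_pair_measure_Times U_gt \<phi>1)
    qed
    finally show ?thesis using loss_d by simp
  qed
  moreover have "0 \<le> d" using d[of "{}"] by simp
  ultimately have "measure ?K {p \<in> space ?K. fst p \<noteq> snd p} \<le> d"
    by (simp add: K.emeasure_eq_measure)
  then show ?thesis using K fst_law snd_law by (intro exI[of _ ?K]) simp
qed

section \<open>Records of sequences that eventually agree\<close>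

lemma partial_max_ge: "k \<in> {1..n} \<Longrightarrow> X k \<omega> \<le> partial_max X n \<omega>"
  unfolding partial_max_def by (intro Max_ge) auto

lemma partial_max_le_iff: "n \<ge> 1 \<Longrightarrow> partial_max X n \<omega> \<le> x \<longleftrightarrow> (\<forall>k\<in>{1..n}. X k \<omega> \<le> x)"
  unfolding partial_max_def by (subst Max_le_iff) auto

text \<open>Two sequences may differ before time \<open>m\<close>, but the finitely many values taken there are exceeded by common
later values, which then decide both maxima.\<close>
lemma partial_max_eventually_eq:
  fixes X :: "nat \<Rightarrow> 'a \<Rightarrow> real" and Z :: "nat \<Rightarrow> 'b \<Rightarrow> real"
  assumes eq: "\<And>n. n \<ge> m \<Longrightarrow> X n \<omega> = Z n \<omega>'"
    and X: "\<And>k. k \<ge> 1 \<Longrightarrow> \<exists>n\<ge>m. X k \<omega> < Z n \<omega>'"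
    and Z: "\<And>k. k \<ge> 1 \<Longrightarrow> \<exists>n\<ge>m. Z k \<omega>' < Z n \<omega>'"
  shows "\<forall>\<^sub>F n in sequentially. partial_max X n \<omega> = partial_max Z n \<omega>'"
proof -
  obtain f where f: "\<And>k. k \<ge> 1 \<Longrightarrow> f k \<ge> m \<and> X k \<omega> < Z (f k) \<omega>'" using X by metis
  obtain g where g: "\<And>k. k \<ge> 1 \<Longrightarrow> g k \<ge> m \<and> Z k \<omega>' < Z (g k) \<omega>'" using Z by metis
  \<comment> \<open>A time by which every early value of either sequence has been exceeded.\<close>
  define B where "B = Max (insert 1 (f ` {1..<m} \<union> g ` {1..<m}))"
  have B: "f k \<le> B" "g k \<le> B" if "k \<in> {1..<m}" for k
    unfolding B_def using that by (intro Max_ge; auto)+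
  show ?thesis
    using eventually_ge_at_top[of "max B (max m 1)"]
  proof eventually_elim
    case (elim n)
    have XZ: "X k \<omega> \<le> partial_max Z n \<omega>'" if k: "k \<in> {1..n}" for k
    proof (cases "k < m")
      case True
      then have "f k \<in> {1..n}" using f[of k] B(1)[of k] k elim by auto
      then show ?thesis using f[of k] k partial_max_ge[of "f k" n Z \<omega>'] by fastforce
    qed (use eq k partial_max_ge[of k n Z \<omega>'] in auto)
    have ZX: "Z k \<omega>' \<le> partial_max X n \<omega>" if k: "k \<in> {1..n}" for k
    proof (cases "k < m")
      case True
      then have "g k \<in> {1..n}" using g[of k] B(2)[of k] k elim by auto
      then show ?thesis using g[of k] k eq[of "g k"] partial_max_ge[of "g k" n X \<omega>] by fastforce
    qed (use eq k partial_max_ge[of k n X \<omega>] in auto)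
    show ?case using XZ ZX elim by (intro antisym) (auto simp: partial_max_le_iff)
  qed
qed

lemma record_indicator_eventually_eq:
  assumes "\<forall>\<^sub>F n in sequentially. partial_max X n \<omega> = partial_max Z n \<omega>'"
    and "\<forall>\<^sub>F n in sequentially. X n \<omega> = Z n \<omega>'"
  shows "\<forall>\<^sub>F n in sequentially. record_indicator X n \<omega> = record_indicator Z n \<omega>'"
proof -
  have "\<forall>\<^sub>F n in sequentially. partial_max X (n - 1) \<omega> = partial_max Z (n - 1) \<omega>'"
    using assms(1) filterlim_minus_const_nat_at_top by (rule eventually_compose_filterlim)
  with assms(2) show ?thesis by eventually_elim (simp add: record_indicator_def)
qed

lemma num_records_eventually_const_diff:
  assumes "\<forall>\<^sub>F n in sequentially. record_indicator X n \<omega> = record_indicator Z n \<omega>'"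
  shows "\<exists>d. \<forall>\<^sub>F n in sequentially. num_records X n \<omega> - num_records Z n \<omega>' = d"
proof -
  obtain m where m: "\<And>n. n \<ge> m \<Longrightarrow> record_indicator X n \<omega> = record_indicator Z n \<omega>'"
    using assms by (auto simp: eventually_sequentially)
  have "num_records X n \<omega> - num_records Z n \<omega>' = num_records X m \<omega> - num_records Z m \<omega>'" if "n \<ge> m" for n
    using that by (induction n rule: dec_induct) (use m in \<open>auto simp: num_records_def\<close>)
  then show ?thesis by (auto simp: eventually_sequentially)
qed

definition truncate_at :: "(nat \<Rightarrow> real) \<Rightarrow> (nat \<Rightarrow> 'a \<Rightarrow> real) \<Rightarrow> nat \<Rightarrow> 'a \<Rightarrow> real" where
  "truncate_at l X n \<omega> = max (X n \<omega>) (l n)"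

lemma partial_max_truncate_at:
  assumes "mono_on {1..} l" "n \<ge> 1"
  shows "partial_max (truncate_at l X) n \<omega> = max (partial_max X n \<omega>) (l n)"
proof (rule antisym)
  have "truncate_at l X k \<omega> \<le> max (partial_max X n \<omega>) (l n)" if "k \<in> {1..n}" for k
    using partial_max_ge[OF that, of X \<omega>] mono_onD[OF assms(1), of k n] that by (auto simp: truncate_at_def)
  then show "partial_max (truncate_at l X) n \<omega> \<le> max (partial_max X n \<omega>) (l n)"
    using assms(2) by (simp add: partial_max_le_iff)
  have "X k \<omega> \<le> partial_max (truncate_at l X) n \<omega>" if "k \<in> {1..n}" for k
    using partial_max_ge[OF that, of "truncate_at l X" \<omega>] by (simp add: truncate_at_def)
  moreover have "l n \<le> partial_max (truncate_at l X) n \<omega>"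
    using partial_max_ge[of n n "truncate_at l X" \<omega>] assms(2) by (simp add: truncate_at_def)
  ultimately show "max (partial_max X n \<omega>) (l n) \<le> partial_max (truncate_at l X) n \<omega>"
    using assms(2) by (simp add: partial_max_le_iff)
qed

text \<open>Once the maximum exceeds the threshold at all times, it is not changed by truncation. A truncated value
that exceeds the old maximum only because of the threshold would leave the new maximum at or below the
threshold.\<close>
lemma truncation_keeps_records:
  assumes l: "mono_on {1..} l" and exceed: "\<forall>\<^sub>F n in sequentially. l n < partial_max X n \<omega>"
  shows "\<forall>\<^sub>F n in sequentially. record_indicator X n \<omega> = record_indicator (truncate_at l X) n \<omega>"
proof -
  have "\<forall>\<^sub>F n in sequentially. l (n - 1) < partial_max X (n - 1) \<omega>"
    using exceed filterlim_minus_const_nat_at_top by (rule eventually_compose_filterlim)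
  with exceed eventually_ge_at_top[of 2] show ?thesis
  proof eventually_elim
    case (elim n)
    have pm: "partial_max (truncate_at l X) (n - 1) \<omega> = partial_max X (n - 1) \<omega>"
      using partial_max_truncate_at[OF l, of "n - 1" X \<omega>] elim by simp
    have "partial_max X n \<omega> \<le> max (partial_max X (n - 1) \<omega>) (X n \<omega>)"
    proof -
      have "X k \<omega> \<le> max (partial_max X (n - 1) \<omega>) (X n \<omega>)" if "k \<in> {1..n}" for k
      proof -
        have "k = n \<or> k \<in> {1..n - 1}" using that by auto
        then show ?thesis using partial_max_ge[of k "n - 1" X \<omega>] by (auto simp: le_max_iff_disj)
      qed
      then show ?thesis using elim by (simp add: partial_max_le_iff)
    qed
    then have "max (X n \<omega>) (l n) > partial_max X (n - 1) \<omega> \<longleftrightarrow> X n \<omega> > partial_max X (n - 1) \<omega>"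
      using elim by auto
    then show ?case using elim pm by (simp add: record_indicator_def truncate_at_def)
  qed
qed

text \<open>The count is a function of the sequence alone; therefore it can be transported between probability
spaces on which the sequences have the same law.\<close>
lemma num_records_coordinates:
  "num_records X n \<omega> = num_records (\<lambda>k s. s k) n (\<lambda>k\<in>{1..}. X k \<omega>)"
  unfolding num_records_def by (intro sum.cong refl) (auto simp: record_indicator_iff)

lemma partial_max_coordinates:
  "partial_max X n \<omega> = partial_max (\<lambda>k s. s k) n (\<lambda>k\<in>{1..}. X k \<omega>)"
  unfolding partial_max_def by (intro arg_cong[where f=Max] image_cong) auto

lemma partial_max_measurable:
  assumes "\<And>k. k \<ge> 1 \<Longrightarrow> X k \<in> borel_measurable M" and "n \<ge> 1"
  shows "partial_max X n \<in> borel_measurable M"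
  unfolding partial_max_def[abs_def] using assms by (intro borel_measurable_Max) auto

lemma record_indicator_measurable:
  assumes X: "\<And>k. k \<ge> 1 \<Longrightarrow> X k \<in> borel_measurable M"
  shows "record_indicator X n \<in> borel_measurable M"
proof (cases "n \<ge> 2")
  case True
  then have [measurable]: "partial_max X (n - 1) \<in> borel_measurable M" "X n \<in> borel_measurable M"
    by (auto intro!: partial_max_measurable X)
  show ?thesis unfolding record_indicator_def[abs_def] by measurable
next
  case False
  then have "record_indicator X n = (\<lambda>_. of_bool (n = 1))"
    by (intro ext) (simp add: record_indicator_def)
  then show ?thesis by simp
qed

lemma num_records_measurable:
  assumes X: "\<And>k. k \<ge> 1 \<Longrightarrow> X k \<in> borel_measurable M"
  shows "num_records X n \<in> borel_measurable M"
  unfolding num_records_def[abs_def] by (intro borel_measurable_sum record_indicator_measurable X)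

lemma AE_transfer_law:
  assumes "f \<in> measurable M L" "g \<in> measurable N L" "distr M L f = distr N L g"
    and "{x \<in> space L. P x} \<in> sets L" and "AE \<omega> in M. P (f \<omega>)"
  shows "AE \<omega> in N. P (g \<omega>)"
proof -
  have "AE x in distr M L f. P x" using assms(5) AE_distr_iff[OF assms(1,4)] by blast
  then have "AE x in distr N L g. P x" unfolding assms(3) .
  then show ?thesis using AE_distr_iff[OF assms(2,4)] by blast
qed

lemma cmod_iexp_diff_le: "cmod (iexp a - iexp b) \<le> \<bar>a - b\<bar>"
proof -
  have "iexp a - iexp b = iexp b * (iexp (a - b) - 1)"
    by (simp add: algebra_simps exp_add[symmetric])
  then have "cmod (iexp a - iexp b) = cmod (iexp (a - b) - 1)" by (simp add: norm_mult)
  also have "\<dots> \<le> \<bar>a - b\<bar>" using iexp_approx1[of "a - b" 0] by simp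
  finally show ?thesis .
qed

text \<open>A form of Slutsky's theorem: the characteristic functions differ by the expectation of a bounded
quantity that tends to \<open>0\<close>.\<close>
lemma weak_conv_m_null_shift:
  fixes Z Z' :: "nat \<Rightarrow> 'a \<Rightarrow> real"
  assumes M: "prob_space M"
    and Z [measurable]: "\<And>n. Z n \<in> borel_measurable M" and Z' [measurable]: "\<And>n. Z' n \<in> borel_measurable M"
    and null: "AE \<omega> in M. (\<lambda>n. Z n \<omega> - Z' n \<omega>) \<longlonglongrightarrow> 0"
    and \<mu>: "real_distribution \<mu>" and conv: "weak_conv_m (\<lambda>n. distr M borel (Z n)) \<mu>"
  shows "weak_conv_m (\<lambda>n. distr M borel (Z' n)) \<mu>"
proof (rule levy_continuity)
  interpret prob_space M by (rule M)
  show "real_distribution (distr M borel (Z' n))" for n by (rule real_distribution_distr) simp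
  show "real_distribution \<mu>" by (rule \<mu>)
  fix t :: real
  have "(\<lambda>n. CLINT \<omega>|M. iexp (t * Z' n \<omega>) - iexp (t * Z n \<omega>)) \<longlonglongrightarrow> (CLINT \<omega>|M. 0)"
  proof (rule integral_dominated_convergence[where w="\<lambda>_. 2"])
    show "AE \<omega> in M. (\<lambda>n. iexp (t * Z' n \<omega>) - iexp (t * Z n \<omega>)) \<longlonglongrightarrow> 0"
      using null
    proof eventually_elim
      case (elim \<omega>)
      have "(\<lambda>n. \<bar>t\<bar> * \<bar>Z n \<omega> - Z' n \<omega>\<bar>) \<longlonglongrightarrow> \<bar>t\<bar> * 0"
        by (intro tendsto_mult tendsto_const tendsto_rabs_zero elim)
      then have "(\<lambda>n. \<bar>t\<bar> * \<bar>Z n \<omega> - Z' n \<omega>\<bar>) \<longlonglongrightarrow> 0" by simp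
      then show ?case
      proof (rule Lim_null_comparison[rotated])
        show "\<forall>\<^sub>F n in sequentially. cmod (iexp (t * Z' n \<omega>) - iexp (t * Z n \<omega>)) \<le> \<bar>t\<bar> * \<bar>Z n \<omega> - Z' n \<omega>\<bar>"
        proof (rule always_eventually, rule allI)
          fix n
          show "cmod (iexp (t * Z' n \<omega>) - iexp (t * Z n \<omega>)) \<le> \<bar>t\<bar> * \<bar>Z n \<omega> - Z' n \<omega>\<bar>"
            using cmod_iexp_diff_le[of "t * Z' n \<omega>" "t * Z n \<omega>"]
            by (simp add: right_diff_distrib[symmetric] abs_mult abs_minus_commute)
        qed
      qed
    qed
    show "AE \<omega> in M. norm (iexp (t * Z' n \<omega>) - iexp (t * Z n \<omega>)) \<le> 2" for n
      using norm_triangle_ineq4[of "iexp (t * Z' n _)" "iexp (t * Z n _)"] by simp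
  qed auto
  moreover have "(CLINT \<omega>|M. iexp (t * Z' n \<omega>) - iexp (t * Z n \<omega>)) = char (distr M borel (Z' n)) t - char (distr M borel (Z n)) t" for n
  proof -
    have "integrable M (\<lambda>\<omega>. iexp (t * W \<omega>))" if [measurable]: "W \<in> borel_measurable M" for W
      by (rule integrable_const_bound[where B=1]) auto
    then show ?thesis
      by (subst Bochner_Integration.integral_diff) (auto simp: char_def integral_distr)
  qed
  ultimately have "(\<lambda>n. char (distr M borel (Z' n)) t - char (distr M borel (Z n)) t) \<longlonglongrightarrow> 0" by simp
  moreover have "(\<lambda>n. char (distr M borel (Z n)) t) \<longlonglongrightarrow> char \<mu> t"
    by (rule levy_continuity1[OF _ \<mu> conv]) (rule real_distribution_distr, simp)
  ultimately show "(\<lambda>n. char (distr M borel (Z' n)) t) \<longlonglongrightarrow> char \<mu> t"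
    by (rule Lim_transform[rotated])
qed

text \<open>The product of the maximal couplings of the single coordinates. Its pairs are independent, so each of the
two coordinate sequences is independent, and they disagree only finitely often by
Borel--Cantelli.\<close>
theorem independent_coupling:
  fixes P Q :: "nat \<Rightarrow> real measure" and d :: "nat \<Rightarrow> real"
  assumes P: "\<And>n. real_distribution (P n)" and Q: "\<And>n. real_distribution (Q n)"
    and d: "\<And>n A. A \<in> sets borel \<Longrightarrow> \<bar>measure (P n) A - measure (Q n) A\<bar> \<le> d n"
    and summ: "summable (\<lambda>n. d (Suc n))"
  obtains \<Omega> :: "(nat \<Rightarrow> real \<times> real) measure" and x y :: "nat \<Rightarrow> (nat \<Rightarrow> real \<times> real) \<Rightarrow> real"
  where "prob_space \<Omega>"
    and "prob_space.indep_vars \<Omega> (\<lambda>_. borel) x {1..}" and "prob_space.indep_vars \<Omega> (\<lambda>_. borel) y {1..}"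
    and "\<forall>n\<ge>1. distr \<Omega> borel (x n) = P n" and "\<forall>n\<ge>1. distr \<Omega> borel (y n) = Q n"
    and "AE \<omega> in \<Omega>. \<forall>\<^sub>F n in sequentially. x n \<omega> = y n \<omega>"
proof -
  have "\<forall>n. \<exists>K. prob_space K \<and> sets K = sets (borel \<Otimes>\<^sub>M borel) \<and> distr K borel fst = P n \<and>
      distr K borel snd = Q n \<and> measure K {p \<in> space K. fst p \<noteq> snd p} \<le> d n"
    using maximal_coupling[OF P Q d] by blast
  from choice[OF this] obtain K where KK: "\<forall>n. prob_space (K n) \<and> sets (K n) = sets (borel \<Otimes>\<^sub>M borel) \<and> distr (K n) borel fst = P n \<and>
      distr (K n) borel snd = Q n \<and> measure (K n) {p \<in> space (K n). fst p \<noteq> snd p} \<le> d n" ..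
  then have K: "\<And>n. prob_space (K n)" and sK [measurable_cong]: "\<And>n. sets (K n) = sets (borel \<Otimes>\<^sub>M borel)"
    and fstK: "\<And>n. distr (K n) borel fst = P n" and sndK: "\<And>n. distr (K n) borel snd = Q n"
    and offK: "\<And>n. measure (K n) {p \<in> space (K n). fst p \<noteq> snd p} \<le> d n"
    by auto
  let ?\<Omega> = "PiM {1..} K"
  interpret K: prob_space "K n" for n by (rule K)
  interpret \<Omega>: prob_space ?\<Omega> by (rule prob_space_PiM[OF K])
  have fst_m [measurable]: "fst \<in> borel_measurable (K n)" and snd_m [measurable]: "snd \<in> borel_measurable (K n)" for n
    by (auto simp: measurable_cong_sets[OF sK refl])
  have comp: "(\<lambda>\<omega>. \<omega> n) \<in> measurable ?\<Omega> (K n)" if "n \<ge> 1" for n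
    using that by (intro measurable_component_singleton) auto
  have law: "distr ?\<Omega> (K n) (\<lambda>\<omega>. \<omega> n) = K n" if "n \<ge> 1" for n
    using that by (intro distr_PiM_component K) auto
  have "\<Omega>.indep_vars K (\<lambda>n \<omega>. \<omega> n) {1..}"
  proof (subst \<Omega>.indep_vars_iff_distr_eq_PiM')
    have "distr ?\<Omega> ?\<Omega> (\<lambda>\<omega>. \<lambda>n\<in>{1..}. \<omega> n) = distr ?\<Omega> ?\<Omega> (\<lambda>\<omega>. \<omega>)"
      by (intro distr_cong refl) (auto simp: space_PiM PiE_def extensional_restrict)
    then show "distr ?\<Omega> ?\<Omega> (\<lambda>\<omega>. \<lambda>n\<in>{1..}. \<omega> n) = PiM {1..} (\<lambda>n. distr ?\<Omega> (K n) (\<lambda>\<omega>. \<omega> n))"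
      using PiM_cong[OF refl, of "{1..}" "\<lambda>n. distr ?\<Omega> (K n) (\<lambda>\<omega>. \<omega> n)" K] law
      by (simp add: distr_id[unfolded id_def])
  qed (auto intro: comp)
  note indep = \<Omega>.indep_vars_compose2[OF this]
  show ?thesis
  proof (rule that)
    show "prob_space ?\<Omega>" by (rule prob_space_PiM[OF K])
    show "\<Omega>.indep_vars (\<lambda>_. borel) (\<lambda>n \<omega>. fst (\<omega> n)) {1..}" by (rule indep) simp
    show "\<Omega>.indep_vars (\<lambda>_. borel) (\<lambda>n \<omega>. snd (\<omega> n)) {1..}" by (rule indep) simp
    show "\<forall>n\<ge>1. distr ?\<Omega> borel (\<lambda>\<omega>. fst (\<omega> n)) = P n"
    proof (intro allI impI)
      fix n :: nat assume n: "n \<ge> 1"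
      have "distr (distr ?\<Omega> (K n) (\<lambda>\<omega>. \<omega> n)) borel fst = distr ?\<Omega> borel (\<lambda>\<omega>. fst (\<omega> n))"
        by (subst distr_distr[OF fst_m comp[OF n]]) (simp add: comp_def)
      then show "distr ?\<Omega> borel (\<lambda>\<omega>. fst (\<omega> n)) = P n" unfolding law[OF n] fstK by simp
    qed
    show "\<forall>n\<ge>1. distr ?\<Omega> borel (\<lambda>\<omega>. snd (\<omega> n)) = Q n"
    proof (intro allI impI)
      fix n :: nat assume n: "n \<ge> 1"
      have "distr (distr ?\<Omega> (K n) (\<lambda>\<omega>. \<omega> n)) borel snd = distr ?\<Omega> borel (\<lambda>\<omega>. snd (\<omega> n))"
        by (subst distr_distr[OF snd_m comp[OF n]]) (simp add: comp_def)
      then show "distr ?\<Omega> borel (\<lambda>\<omega>. snd (\<omega> n)) = Q n" unfolding law[OF n] sndK by simp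
    qed
    let ?A = "\<lambda>n. {\<omega> \<in> space ?\<Omega>. fst (\<omega> (Suc n)) \<noteq> snd (\<omega> (Suc n))}"
    have offK_sets: "{p \<in> space (K n). fst p \<noteq> snd p} \<in> sets (K n)" for n
      by measurable
    have pre: "?A n = (\<lambda>\<omega>. \<omega> (Suc n)) -` {p \<in> space (K (Suc n)). fst p \<noteq> snd p} \<inter> space ?\<Omega>" for n
      using measurable_space[OF comp[of "Suc n"]] by auto
    have A: "?A n \<in> sets ?\<Omega>" for n
      unfolding pre by (rule measurable_sets[OF comp offK_sets]) simp
    have prob_A: "\<Omega>.prob (?A n) \<le> d (Suc n)" for n
    proof -
      have "\<Omega>.prob (?A n) = measure (distr ?\<Omega> (K (Suc n)) (\<lambda>\<omega>. \<omega> (Suc n))) {p \<in> space (K (Suc n)). fst p \<noteq> snd p}"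
        unfolding pre by (rule measure_distr[OF comp offK_sets, symmetric]) simp
      also have "\<dots> = measure (K (Suc n)) {p \<in> space (K (Suc n)). fst p \<noteq> snd p}"
        by (subst law) simp_all
      finally show ?thesis using offK[of "Suc n"] by simp
    qed
    have "AE \<omega> in ?\<Omega>. \<forall>\<^sub>F n in sequentially. \<omega> \<in> space ?\<Omega> - ?A n"
    proof (rule borel_cantelli_AE1[OF A])
      show "summable (\<lambda>n. \<Omega>.prob (?A n))"
        by (rule summable_comparison_test'[OF summ, where N=0]) (use prob_A in simp)
      show "emeasure ?\<Omega> (?A n) < \<infinity>" for n
        unfolding \<Omega>.emeasure_eq_measure infinity_ennreal_def by (rule ennreal_less_top)
    qed
    then show "AE \<omega> in ?\<Omega>. \<forall>\<^sub>F n in sequentially. fst (\<omega> n) = snd (\<omega> n)"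
    proof eventually_elim
      case (elim \<omega>)
      then have "\<forall>\<^sub>F n in sequentially. fst (\<omega> (Suc n)) = snd (\<omega> (Suc n))"
        by eventually_elim auto
      then show ?case by (subst eventually_sequentially_Suc[symmetric])
    qed
  qed
qed

lemma indep_sequences_same_law:
  assumes M: "prob_space M" and N: "prob_space N"
    and X: "prob_space.indep_vars M (\<lambda>_. borel) X {1..}" and Y: "prob_space.indep_vars N (\<lambda>_. borel) Y {1..}"
    and law: "\<And>n. n \<ge> (1::nat) \<Longrightarrow> distr M borel (X n) = distr N borel (Y n)"
  shows "distr M (PiM {1..} (\<lambda>_. borel)) (\<lambda>\<omega>. \<lambda>n\<in>{1..}. X n \<omega>) = distr N (PiM {1..} (\<lambda>_. borel)) (\<lambda>\<omega>. \<lambda>n\<in>{1..}. Y n \<omega>)"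
proof -
  interpret M: prob_space M by (rule M)
  interpret N: prob_space N by (rule N)
  have "X n \<in> borel_measurable M" "Y n \<in> borel_measurable N" if "n \<in> {1..}" for n
    using X Y that by (auto simp: M.indep_vars_def N.indep_vars_def)
  then show ?thesis
    using X Y PiM_cong[OF refl, of "{1..}" "\<lambda>n. distr M borel (X n)" "\<lambda>n. distr N borel (Y n)"] M.indep_vars_iff_distr_eq_PiM'[of "{1..}" X "\<lambda>_. borel"] N.indep_vars_iff_distr_eq_PiM'[of "{1..}" Y "\<lambda>_. borel"] law
    by simp
qed

section \<open>Right endpoints, truncation and total variation\<close>

lemma is_df_cdf: "real_distribution \<mu> \<Longrightarrow> is_df (cdf \<mu>)"
proof -
  assume "real_distribution \<mu>"
  then interpret real_distribution \<mu> .
  show ?thesis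
    using cdf_is_right_cont cdf_lim_at_bot cdf_lim_at_top_prob by (auto simp: is_df_def mono_def cdf_nondecreasing)
qed

text \<open>The quantile of order \<open>u\<close> is at least every \<open>x\<close> with \<open>G x < u\<close> and at most every \<open>y\<close> with \<open>G y = 1\<close>, so
that its limit is the right endpoint of \<open>G\<close>.\<close>
lemma quantile_left_lim_1_eq:
  assumes G: "is_df G"
  shows "quantile_left_lim_1 G = (SUP x\<in>{x. G x < 1}. ereal x)" (is "_ = ?S")
proof -
  have mono: "x \<le> y \<Longrightarrow> G x \<le> G y" for x y using G by (auto simp: is_df_def mono_def)
  have bot: "(G \<longlongrightarrow> 0) at_bot" and top: "(G \<longlongrightarrow> 1) at_top" using G by (auto simp: is_df_def)
  have ne: "{x. u \<le> G x} \<noteq> {}" if u: "u < 1" for u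
  proof -
    have "\<forall>\<^sub>F x in at_top. u < G x" using order_tendstoD(1)[OF top u] .
    then obtain x where "u < G x" by (auto simp: eventually_at_top_linorder)
    then show ?thesis by (auto intro: less_imp_le)
  qed
  have bdd: "bdd_below {x. u \<le> G x}" if u: "0 < u" for u
  proof -
    have "\<forall>\<^sub>F x in at_bot. G x < u" using order_tendstoD(2)[OF bot u] .
    then obtain b where "G b < u" by (auto simp: eventually_at_bot_linorder)
    then have "b \<le> x" if "u \<le> G x" for x using mono[of x b] that by (cases "b \<le> x") auto
    then show ?thesis by (intro bdd_belowI[of _ b]) auto
  qed
  have "((\<lambda>u. ereal (quantile G u)) \<longlongrightarrow> ?S) (at_left 1)"
  proof (rule order_tendstoI)
    fix a assume "a < ?S"
    then obtain x where x: "G x < 1" "a < ereal x" unfolding less_SUP_iff by blast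
    have "\<forall>\<^sub>F u in at_left 1. u \<in> {max (G x) 0<..<1}"
      by (rule eventually_at_leftI[of "max (G x) 0"]) (use x in auto)
    then show "\<forall>\<^sub>F u in at_left 1. a < ereal (quantile G u)"
    proof eventually_elim
      case (elim u)
      have "x \<le> quantile G u" unfolding quantile_def
      proof (rule cInf_greatest)
        show "{x. u \<le> G x} \<noteq> {}" using ne elim by simp
        fix y assume "y \<in> {x. u \<le> G x}"
        then show "x \<le> y" using mono[of y x] elim by (cases "x \<le> y") auto
      qed
      then show ?case using x(2) by (metis ereal_less_eq(3) less_le_trans)
    qed
  next
    fix a assume "?S < a"
    then obtain y where y: "?S < ereal y" "ereal y < a" using ereal_dense2 by blast
    have "1 \<le> G y"
    proof (rule ccontr)
      assume "\<not> 1 \<le> G y"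
      then have "ereal y \<le> ?S" by (intro SUP_upper) auto
      then show False using y(1) by simp
    qed
    have "\<forall>\<^sub>F u in at_left 1. u \<in> {0<..<1::real}"
      by (rule eventually_at_leftI[of 0]) auto
    then show "\<forall>\<^sub>F u in at_left 1. ereal (quantile G u) < a"
    proof eventually_elim
      case (elim u)
      have "quantile G u \<le> y" unfolding quantile_def
        by (rule cInf_lower) (use bdd elim \<open>1 \<le> G y\<close> in auto)
      then show ?case using y(2) by (metis ereal_less_eq(3) le_less_trans)
    qed
  qed
  then show ?thesis unfolding quantile_left_lim_1_def by (intro tendsto_Lim) auto
qed

text \<open>A point \<open>x\<close> with \<open>F x = 1\<close> is at or above the right endpoint of \<open>F\<close>. Equality is excluded by hypothesis, and
above it lies a rational at which the distribution function of \<open>\<mu>\<close> already equals \<open>1\<close>.\<close>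
lemma AE_below_right_endpoint:
  assumes \<mu>: "real_distribution \<mu>" and F: "is_df F"
    and le: "quantile_left_lim_1 (cdf \<mu>) \<le> quantile_left_lim_1 F"
    and atom: "AE x in \<mu>. ereal x \<noteq> quantile_left_lim_1 F"
  shows "AE x in \<mu>. F x < 1"
proof -
  interpret real_distribution \<mu> by (rule \<mu>)
  let ?e = "quantile_left_lim_1 (cdf \<mu>)"
  have "AE x in \<mu>. \<forall>q\<in>\<rat>. ?e < ereal q \<longrightarrow> x \<le> q"
  proof (rule AE_ball_countable'[OF _ countable_rat])
    fix q :: real
    show "AE x in \<mu>. ?e < ereal q \<longrightarrow> x \<le> q"
    proof (cases "?e < ereal q")
      case True
      have "\<not> cdf \<mu> q < 1"
      proof
        assume "cdf \<mu> q < 1"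
        then have "ereal q \<le> ?e" unfolding quantile_left_lim_1_eq[OF is_df_cdf[OF \<mu>]] by (intro SUP_upper) auto
        then show False using True by simp
      qed
      then have "prob {..q} = 1" using prob_le_1[of "{..q}"] unfolding cdf_def by linarith
      then have "AE x in \<mu>. x \<in> {..q}" by (rule AE_prob_1)
      then show ?thesis by (rule AE_mp) simp
    qed simp
  qed
  then show ?thesis using atom
  proof eventually_elim
    case (elim x)
    show ?case
    proof (rule ccontr)
      assume "\<not> F x < 1"
      then have "z \<le> x" if "F z < 1" for z
        using that F by (cases "z \<le> x") (auto simp: is_df_def mono_def, smt (verit))
      then have "quantile_left_lim_1 F \<le> ereal x"
        unfolding quantile_left_lim_1_eq[OF F] by (intro SUP_least) auto
      then have "?e < ereal x" using le elim(2) by auto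
      then obtain q :: rat where q: "?e < ereal (of_rat q)" "ereal (of_rat q) < ereal x"
        using ereal_dense3 by blast
      then show False using elim(1) by (auto dest!: bspec[of _ _ "of_rat q"])
    qed
  qed
qed

lemma total_variation_on_ge:
  assumes \<mu>: "real_distribution \<mu>" and \<nu>: "real_distribution \<nu>"
    and A: "A \<in> sets borel" "A \<subseteq> S"
  shows "\<bar>measure \<mu> A - measure \<nu> A\<bar> \<le> total_variation_on \<mu> \<nu> S"
proof -
  interpret \<mu>: real_distribution \<mu> by (rule \<mu>)
  interpret \<nu>: real_distribution \<nu> by (rule \<nu>)
  let ?T = "{\<A>. finite \<A> \<and> disjoint \<A> \<and> (\<forall>A\<in>\<A>. A \<in> sets borel \<and> A \<subseteq> S)}"
  have "(\<Sum>A\<in>\<A>. \<bar>measure \<mu> A - measure \<nu> A\<bar>) \<le> 2" if "\<A> \<in> ?T" for \<A>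
  proof -
    have fin: "finite \<A>" and dis: "disjoint_family_on (\<lambda>A. A) \<A>" and b: "\<A> \<subseteq> sets borel"
      using that by (auto simp: disjoint_def disjoint_family_on_def)
    have "(\<Sum>A\<in>\<A>. \<bar>measure \<mu> A - measure \<nu> A\<bar>) \<le> (\<Sum>A\<in>\<A>. measure \<mu> A + measure \<nu> A)"
      by (intro sum_mono) (smt (verit) measure_nonneg)
    also have "\<dots> = measure \<mu> (\<Union>A\<in>\<A>. A) + measure \<nu> (\<Union>A\<in>\<A>. A)"
      unfolding sum.distrib using \<mu>.finite_measure_finite_Union[OF fin _ dis] \<nu>.finite_measure_finite_Union[OF fin _ dis] b by simp
    also have "\<dots> \<le> 1 + 1" by (intro add_mono \<mu>.prob_le_1 \<nu>.prob_le_1)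
    finally show ?thesis by simp
  qed
  then have "bdd_above ((\<lambda>\<A>. \<Sum>A\<in>\<A>. \<bar>measure \<mu> A - measure \<nu> A\<bar>) ` ?T)" by (intro bdd_aboveI2) auto
  moreover have "{A} \<in> ?T" using A by auto
  ultimately have "(\<Sum>A\<in>{A}. \<bar>measure \<mu> A - measure \<nu> A\<bar>) \<le> total_variation_on \<mu> \<nu> S"
    unfolding total_variation_on_def by (intro cSUP_upper)
  then show ?thesis by simp
qed

text \<open>The laws of \<open>max x c\<close> can differ above \<open>c\<close> and in the atom at \<open>c\<close>. That atom carries all the mass which the
half-line above \<open>c\<close> does not, so both differences are bounded by the variation on the half-line; this
is the factor \<open>2\<close>.\<close>
lemma truncated_laws_close:
  assumes \<mu>: "real_distribution \<mu>" and \<nu>: "real_distribution \<nu>" and A [measurable]: "A \<in> sets borel"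
  shows "\<bar>measure (distr \<mu> borel (\<lambda>x. max x c)) A - measure (distr \<nu> borel (\<lambda>x. max x c)) A\<bar>
    \<le> 2 * total_variation_on \<mu> \<nu> {c<..}"
proof -
  have law: "measure (distr \<rho> borel (\<lambda>x. max x c)) A =
      measure \<rho> (A \<inter> {c<..}) + (if c \<in> A then 1 - measure \<rho> {c<..} else 0)" if "real_distribution \<rho>" for \<rho>
  proof -
    interpret real_distribution \<rho> by (rule that)
    have "measure (distr \<rho> borel (\<lambda>x. max x c)) A = prob ((A \<inter> {c<..}) \<union> (if c \<in> A then UNIV - {c<..} else {}))"
      by (subst measure_distr) (auto intro!: arg_cong[where f=prob] simp: max_def split: if_splits)
    also have "\<dots> = measure \<rho> (A \<inter> {c<..}) + (if c \<in> A then prob (UNIV - {c<..}) else 0)"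
      by (subst finite_measure_Union) auto
    also have "prob (UNIV - {c<..}) = 1 - prob {c<..}" using prob_compl[of "{c<..}"] by simp
    finally show ?thesis .
  qed
  have "\<bar>measure \<mu> (A \<inter> {c<..}) - measure \<nu> (A \<inter> {c<..})\<bar> \<le> total_variation_on \<mu> \<nu> {c<..}"
    by (rule total_variation_on_ge[OF \<mu> \<nu>]) auto
  moreover have "\<bar>measure \<mu> {c<..} - measure \<nu> {c<..}\<bar> \<le> total_variation_on \<mu> \<nu> {c<..}"
    by (rule total_variation_on_ge[OF \<mu> \<nu>]) auto
  ultimately show ?thesis unfolding law[OF \<mu>] law[OF \<nu>] by auto
qed

lemma interval_measure_cdf:
  assumes "real_distribution \<nu>" shows "interval_measure (cdf \<nu>) = \<nu>"
proof -
  interpret real_distribution \<nu> by fact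
  note facts = cdf_nondecreasing cdf_is_right_cont cdf_lim_at_bot
  show ?thesis
    by (rule cdf_unique)
      (use real_distribution_interval_measure[OF facts cdf_lim_at_top_prob] cdf_interval_measure[OF facts] assms in auto)
qed

text \<open>For \<open>x \<ge> c\<close> the conditional probability of \<open>X\<^sub>n \<le> x\<close> is the constant \<open>P(X\<^sub>n \<le> x)\<close>. For smaller \<open>x\<close>
the event that the truncated value is at most \<open>x\<close> is empty. So the law of the truncated value on \<open>A\<close> and
\<open>P(A)\<close> times its law have the same distribution function.\<close>
lemma (in prob_space) truncation_indep_of_past:
  assumes X: "\<And>k. k \<ge> 1 \<Longrightarrow> X k \<in> borel_measurable M" and n: "n \<ge> 1"
    and G: "is_cond_df M X n G"
    and tail: "\<And>xs x. xs \<in> {1..<n} \<rightarrow>\<^sub>E UNIV \<Longrightarrow> c \<le> x \<Longrightarrow> G xs x = cdf (distr M borel (X n)) x"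
    and A: "A \<in> sets (past_algebra M X n)" and B: "B \<in> sets borel"
  shows "prob (A \<inter> {\<omega> \<in> space M. max (X n \<omega>) c \<in> B}) = prob A * prob {\<omega> \<in> space M. max (X n \<omega>) c \<in> B}"
proof -
  have [measurable]: "X n \<in> borel_measurable M" by (rule X[OF n])
  let ?P = "\<Pi>\<^sub>M k\<in>{1..<n}. (borel :: real measure)"
  have past: "past X n \<in> measurable M ?P"
    unfolding past_def[abs_def] by (intro measurable_restrict X) auto
  have sub: "subalgebra M (past_algebra M X n)"
    unfolding subalgebra_def past_algebra_def using sets_image_in_sets[OF refl past] by simp
  interpret C: finite_measure_subalgebra M "past_algebra M X n" by unfold_locales (rule sub)
  have AM [measurable]: "A \<in> events" using A sub by (auto simp: subalgebra_def)
  interpret D: real_distribution "distr M borel (X n)" by (rule real_distribution_distr) simp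
  have below: "prob (A \<inter> {\<omega> \<in> space M. X n \<omega> \<le> x}) = prob A * prob {\<omega> \<in> space M. X n \<omega> \<le> x}" if x: "c \<le> x" for x
  proof -
    let ?E = "{\<omega> \<in> space M. X n \<omega> \<le> x}"
    have E [measurable]: "?E \<in> events" by measurable
    have law: "cdf (distr M borel (X n)) x = prob ?E"
      unfolding cdf_def by (subst measure_distr) (auto intro!: arg_cong[where f=prob])
    have cond: "AE \<omega> in M. real_cond_exp M (past_algebra M X n) (indicator ?E) \<omega> = prob ?E"
    proof -
      have "AE \<omega> in M. G (past X n \<omega>) x = real_cond_exp M (past_algebra M X n) (indicator ?E) \<omega>"
        using G by (simp add: is_cond_df_def)
      moreover have eq: "G (past X n \<omega>) x = prob ?E" for \<omega>
        using tail[OF _ x, of "past X n \<omega>"] law by (simp add: past_def)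
      ultimately show ?thesis by (elim eventually_mono) (simp only: eq)
    qed
    have "prob (A \<inter> ?E) = (LINT \<omega>:A|M. indicator ?E \<omega>)"
    proof -
      have "indicat_real A \<omega> *\<^sub>R indicat_real ?E \<omega> = indicator (A \<inter> ?E) \<omega>" for \<omega>
        unfolding indicator_inter_arith real_scaleR_def ..
      then have "(LINT \<omega>:A|M. indicat_real ?E \<omega>) = (LINT \<omega>|M. indicator (A \<inter> ?E) \<omega>)"
        unfolding set_lebesgue_integral_def by (rule Bochner_Integration.integral_cong[OF refl])
      also have "\<dots> = prob (A \<inter> ?E)" using AM E by (simp add: sets.Int)
      finally show ?thesis ..
    qed
    also have "\<dots> = (LINT \<omega>:A|M. real_cond_exp M (past_algebra M X n) (indicator ?E) \<omega>)"
      by (rule C.real_cond_exp_intA[OF _ A]) (auto intro!: integrable_real_indicator simp: less_top[symmetric])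
    also have "\<dots> = (LINT \<omega>:A|M. prob ?E)"
      unfolding set_lebesgue_integral_def
    proof (rule integral_cong_AE)
      show "AE \<omega> in M. indicat_real A \<omega> *\<^sub>R real_cond_exp M (past_algebra M X n) (indicator ?E) \<omega> = indicat_real A \<omega> *\<^sub>R prob ?E"
        using cond by eventually_elim simp
    qed (use borel_measurable_cond_exp2[of M "past_algebra M X n"] in measurable)
    also have "\<dots> = prob A * prob ?E"
      by (simp add: set_lebesgue_integral_def)
    finally show ?thesis .
  qed
  let ?T = "\<lambda>\<omega>. max (X n \<omega>) c"
  let ?\<mu> = "distr (density M (indicator A)) borel ?T"
  let ?\<nu> = "density (distr M borel ?T) (\<lambda>_. ennreal (prob A))"
  have \<mu>: "emeasure ?\<mu> S = ennreal (prob (A \<inter> {\<omega> \<in> space M. ?T \<omega> \<in> S}))" if [measurable]: "S \<in> sets borel" for S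
  proof -
    have "emeasure ?\<mu> S = emeasure (density M (indicator A)) {\<omega> \<in> space M. ?T \<omega> \<in> S}"
      by (subst emeasure_distr) (auto intro!: arg_cong[where f="emeasure _"])
    also have "\<dots> = (\<integral>\<^sup>+\<omega>. indicator (A \<inter> {\<omega> \<in> space M. ?T \<omega> \<in> S}) \<omega> \<partial>M)"
      unfolding indicator_inter_arith by (rule emeasure_density) measurable
    finally show ?thesis by (simp add: emeasure_eq_measure)
  qed
  have \<nu>: "emeasure ?\<nu> S = ennreal (prob A * prob {\<omega> \<in> space M. ?T \<omega> \<in> S})" if [measurable]: "S \<in> sets borel" for S
  proof -
    have "emeasure ?\<nu> S = ennreal (prob A) * emeasure (distr M borel ?T) S"
      by (subst emeasure_density) (auto simp: nn_integral_cmult)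
    also have "emeasure (distr M borel ?T) S = ennreal (prob {\<omega> \<in> space M. ?T \<omega> \<in> S})"
      by (subst emeasure_distr) (auto simp: emeasure_eq_measure intro!: arg_cong[where f=prob])
    finally show ?thesis by (simp add: ennreal_mult')
  qed
  have "?\<mu> = ?\<nu>"
  proof (rule cdf_unique')
    show "finite_borel_measure ?\<mu>"
      by (rule finite_borel_measure.intro) (auto simp: finite_borel_measure_axioms_def \<mu> intro!: finite_measureI)
    show "finite_borel_measure ?\<nu>"
      by (rule finite_borel_measure.intro) (auto simp: finite_borel_measure_axioms_def \<nu> intro!: finite_measureI)
    show "cdf ?\<mu> = cdf ?\<nu>"
    proof
      fix x
      have "prob (A \<inter> {\<omega> \<in> space M. ?T \<omega> \<in> {..x}}) = prob A * prob {\<omega> \<in> space M. ?T \<omega> \<in> {..x}}"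
        using below[of x] by (cases "c \<le> x") auto
      then have "emeasure ?\<mu> {..x} = emeasure ?\<nu> {..x}" by (simp only: \<mu> \<nu> atMost_borel)
      then show "cdf ?\<mu> x = cdf ?\<nu> x" by (simp only: cdf_def measure_def)
    qed
  qed
  then have "emeasure ?\<mu> B = emeasure ?\<nu> B" by simp
  then show ?thesis using B by (simp only: \<mu> \<nu>) (subst (asm) ennreal_inj, auto)
qed

text \<open>Induction on the largest index: an event about earlier truncated values belongs to the past of that
index.\<close>
lemma (in prob_space) truncations_indep:
  assumes X: "\<And>k. k \<ge> 1 \<Longrightarrow> X k \<in> borel_measurable M"
    and cond: "\<And>n. n \<ge> 2 \<Longrightarrow> \<exists>G. is_cond_df M X n G \<and>
        (\<forall>xs \<in> {1..<n} \<rightarrow>\<^sub>E UNIV. \<forall>x\<ge>l n. G xs x = cdf (distr M borel (X n)) x)"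
  shows "indep_vars (\<lambda>_. borel) (\<lambda>n \<omega>. max (X n \<omega>) (l n)) {1..}"
proof -
  let ?T = "\<lambda>n \<omega>. max (X n \<omega>) (l n)"
  have T: "?T n \<in> borel_measurable M" if "n \<ge> 1" for n
    using X[OF that] by measurable
  have main: "prob {\<omega> \<in> space M. \<forall>j\<in>J. ?T j \<omega> \<in> B j} = (\<Prod>j\<in>J. prob {\<omega> \<in> space M. ?T j \<omega> \<in> B j})"
    if "finite J" "J \<subseteq> {1..}" "\<And>j. j \<in> J \<Longrightarrow> B j \<in> sets borel" for J B
    using that
  proof (induction J rule: finite_linorder_max_induct)
    case empty then show ?case by (simp add: prob_space)
  next
    case (insert b J)
    show ?case
    proof (cases "J = {}")
      case False
      then obtain a where "a \<in> J" by auto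
      then have b: "b \<ge> 2" using insert.hyps(2) insert.prems(1) by force
      have J: "J \<subseteq> {1..<b}" using insert by auto
      let ?P = "\<Pi>\<^sub>M k\<in>{1..<b}. (borel :: real measure)"
      let ?A = "{\<omega> \<in> space M. \<forall>j\<in>J. ?T j \<omega> \<in> B j}"
      have "{s \<in> space ?P. \<forall>j\<in>J. max (s j) (l j) \<in> B j} \<in> sets ?P"
      proof (rule sets.sets_Collect_finite_All[OF _ insert.hyps(1)])
        fix j assume j: "j \<in> J"
        then have [measurable]: "(\<lambda>s. s j) \<in> borel_measurable ?P" "B j \<in> sets borel"
          using J insert.prems by auto
        show "{s \<in> space ?P. max (s j) (l j) \<in> B j} \<in> sets ?P" by measurable
      qed
      then have "past X b -` {s \<in> space ?P. \<forall>j\<in>J. max (s j) (l j) \<in> B j} \<inter> space M \<in> sets (past_algebra M X b)"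
        unfolding past_algebra_def by (rule in_vimage_algebra)
      also have "past X b -` {s \<in> space ?P. \<forall>j\<in>J. max (s j) (l j) \<in> B j} \<inter> space M = ?A"
        using J by (auto simp: past_def space_PiM subset_iff)
      finally have A: "?A \<in> sets (past_algebra M X b)" .
      obtain G where G: "is_cond_df M X b G"
        "\<And>xs x. xs \<in> {1..<b} \<rightarrow>\<^sub>E UNIV \<Longrightarrow> l b \<le> x \<Longrightarrow> G xs x = cdf (distr M borel (X b)) x"
        using cond[OF b] by blast
      have "{\<omega> \<in> space M. \<forall>j\<in>insert b J. ?T j \<omega> \<in> B j} = ?A \<inter> {\<omega> \<in> space M. ?T b \<omega> \<in> B b}" by auto
      also have "prob \<dots> = prob ?A * prob {\<omega> \<in> space M. ?T b \<omega> \<in> B b}"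
        by (rule truncation_indep_of_past[OF X _ G A]) (use b insert.prems in auto)
      also have "prob ?A = (\<Prod>j\<in>J. prob {\<omega> \<in> space M. ?T j \<omega> \<in> B j})"
        using insert by auto
      finally show ?thesis using insert.hyps by (subst prod.insert) (auto simp: mult.commute)
    qed simp
  qed
  show ?thesis
    unfolding indep_vars_def2
  proof (intro conjI ballI indep_setsI)
    show "?T n \<in> borel_measurable M" if "n \<in> {1..}" for n using T that by simp
    show "{?T n -` A \<inter> space M |A. A \<in> sets borel} \<subseteq> events" if "n \<in> {1..}" for n
      using T that by (auto intro!: measurable_sets)
    fix A J assume J: "J \<noteq> {}" "J \<subseteq> {1..}" "finite J" and "\<forall>j\<in>J. A j \<in> {?T j -` A \<inter> space M |A. A \<in> sets borel}"
    then have "\<forall>j\<in>J. \<exists>B. B \<in> sets borel \<and> A j = {\<omega> \<in> space M. ?T j \<omega> \<in> B}" by fastforce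
    from bchoice[OF this] obtain B where "\<forall>j\<in>J. B j \<in> sets borel \<and> A j = {\<omega> \<in> space M. ?T j \<omega> \<in> B j}" ..
    then have B: "\<And>j. j \<in> J \<Longrightarrow> B j \<in> sets borel" "\<And>j. j \<in> J \<Longrightarrow> A j = {\<omega> \<in> space M. ?T j \<omega> \<in> B j}"
      by blast+
    have "(\<Inter>j\<in>J. A j) = {\<omega> \<in> space M. \<forall>j\<in>J. ?T j \<omega> \<in> B j}" using J(1) B(2) by auto
    then show "prob (\<Inter> (A ` J)) = (\<Prod>j\<in>J. prob (A j))" using main[OF J(3,2) B(1)] B(2) by simp
  qed
qed

lemma powr_at_top_null:
  assumes "0 < (r::real)" "r < 1" shows "((\<lambda>t. r powr t) \<longlongrightarrow> 0) at_top"
proof -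
  have "filterlim (\<lambda>t. t * ln r) at_bot at_top"
    unfolding mult.commute[of _ "ln r"]
    by (rule filterlim_tendsto_neg_mult_at_bot[OF tendsto_const _ filterlim_ident]) (use assms in simp)
  then have "((\<lambda>t. exp (t * ln r)) \<longlongrightarrow> 0) at_top" by (rule filterlim_compose[OF exp_at_bot])
  then show ?thesis using assms by (simp add: powr_def)
qed

text \<open>The probability that no value after time \<open>m\<close> exceeds \<open>q\<close> is at most \<open>F(q)\<close> raised to the power
\<open>s\<^sub>n - s\<^sub>m\<close> for each \<open>n > m\<close>, which tends to \<open>0\<close> when \<open>F(q) < 1\<close>. Rational levels \<open>q\<close> suffice, because by
continuity of \<open>F\<close> a rational with \<open>F q < 1\<close> lies above each \<open>x\<close> with \<open>F x < 1\<close>.\<close>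
lemma AE_exceeds_infinitely_often:
  assumes W: "growing_weights \<alpha>" and M: "prob_space M" and F: "is_df F" and cont: "continuous_on UNIV F"
    and indep: "prob_space.indep_vars M (\<lambda>_. borel) Z {1..}"
    and Z_le: "\<And>n x. n \<ge> 1 \<Longrightarrow> measure M {\<omega> \<in> space M. Z n \<omega> \<le> x} \<le> F x powr \<alpha> n"
  shows "AE \<omega> in M. \<forall>x. F x < 1 \<longrightarrow> (\<forall>m. \<exists>n\<ge>m. x < Z n \<omega>)"
proof -
  interpret growing_weights \<alpha> by (rule W)
  interpret prob_space M by (rule M)
  have Z [measurable]: "n \<ge> 1 \<Longrightarrow> Z n \<in> borel_measurable M" for n using indep by (auto simp: indep_vars_def)
  have one: "AE \<omega> in M. \<exists>n\<ge>m. q < Z n \<omega>" if q: "F q < 1" for q m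
  proof -
    \<comment> \<open>Positive even if \<open>F q = 0\<close>, so that the powers of \<open>r\<close> are exponentials.\<close>
    define r where "r = max (F q) (1/2)"
    have r: "0 < r" "r < 1" "F q \<le> r" using q by (auto simp: r_def)
    define m' where "m' = Suc m"
    let ?E = "{\<omega> \<in> space M. \<forall>n\<ge>m'. Z n \<omega> \<le> q}"
    have E: "?E \<in> events"
    proof -
      have "{\<omega> \<in> space M. m' \<le> n \<longrightarrow> Z n \<omega> \<le> q} \<in> events" for n
        by (cases "m' \<le> n") (auto intro!: borel_measurable_le Z simp: m'_def)
      then show ?thesis by (rule sets.sets_Collect_countable_All)
    qed
    have bound: "prob ?E \<le> r powr (s_seq \<alpha> n - s_seq \<alpha> m)" if n: "n \<ge> m'" for n
    proof -
      have J: "{m'..n} \<noteq> {}" "finite {m'..n}" "{m'..n} \<subseteq> {1..}" using n by (auto simp: m'_def)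
      have "prob ?E \<le> prob (\<Inter>k\<in>{m'..n}. Z k -` {..q} \<inter> space M)"
      proof (rule finite_measure_mono)
        show "?E \<subseteq> (\<Inter>k\<in>{m'..n}. Z k -` {..q} \<inter> space M)" by auto
        show "(\<Inter>k\<in>{m'..n}. Z k -` {..q} \<inter> space M) \<in> events"
          using J by (intro sets.finite_INT measurable_sets[OF Z]) auto
      qed
      also have "\<dots> = (\<Prod>k\<in>{m'..n}. prob (Z k -` {..q} \<inter> space M))"
        by (rule indep_varsD[OF indep J]) auto
      also have "\<dots> \<le> (\<Prod>k\<in>{m'..n}. r powr \<alpha> k)"
      proof (intro prod_mono conjI measure_nonneg)
        fix k assume "k \<in> {m'..n}"
        then have k: "k \<ge> 1" by (simp add: m'_def)
        have "Z k -` {..q} \<inter> space M = {\<omega> \<in> space M. Z k \<omega> \<le> q}" by auto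
        then have "prob (Z k -` {..q} \<inter> space M) \<le> F q powr \<alpha> k" using Z_le[OF k, of q] by simp
        also have "\<dots> \<le> r powr \<alpha> k"
          using r is_df_nonneg[OF F] weight_pos[OF k] by (intro powr_mono2) auto
        finally show "prob (Z k -` {..q} \<inter> space M) \<le> r powr \<alpha> k" .
      qed
      also have "\<dots> = r powr (\<Sum>k=m'..n. \<alpha> k)" using r by (subst powr_sum) auto
      also have "(\<Sum>k=m'..n. \<alpha> k) = s_seq \<alpha> n - s_seq \<alpha> m"
      proof -
        have "{1..n} = {1..m} \<union> {m'..n}" "{1..m} \<inter> {m'..n} = {}" using n by (auto simp: m'_def)
        then show ?thesis by (simp add: s_seq_def sum.union_disjoint)
      qed
      finally show ?thesis .
    qed
    have "filterlim (\<lambda>n. s_seq \<alpha> n - s_seq \<alpha> m) at_top sequentially"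
      using filterlim_tendsto_add_at_top[OF tendsto_const s_at_top, of "- s_seq \<alpha> m"] by simp
    then have "(\<lambda>n. r powr (s_seq \<alpha> n - s_seq \<alpha> m)) \<longlonglongrightarrow> 0"
      by (rule filterlim_compose[OF powr_at_top_null[OF r(1,2)]])
    then have "prob ?E \<le> 0"
    proof (rule tendsto_lowerbound)
      show "\<forall>\<^sub>F n in sequentially. prob ?E \<le> r powr (s_seq \<alpha> n - s_seq \<alpha> m)"
        using eventually_ge_at_top[of m'] by (rule eventually_mono) (rule bound)
    qed simp
    then have "emeasure M ?E = 0" using measure_nonneg[of M ?E] by (simp add: emeasure_eq_measure)
    then have "AE \<omega> in M. \<omega> \<notin> ?E" 
      by (intro AE_not_in null_setsI E)
    then show ?thesis
    proof (rule AE_mp, intro AE_I2 impI)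
      fix \<omega> assume "\<omega> \<in> space M" "\<omega> \<notin> ?E"
      then obtain n where "n \<ge> m'" "\<not> Z n \<omega> \<le> q" by blast
      then show "\<exists>n\<ge>m. q < Z n \<omega>" by (intro exI[of _ n]) (simp add: m'_def)
    qed
  qed
  have "AE \<omega> in M. \<forall>q\<in>\<rat>. F q < 1 \<longrightarrow> (\<forall>m. \<exists>n\<ge>m. q < Z n \<omega>)"
  proof (rule AE_ball_countable'[OF _ countable_rat])
    fix q :: real
    show "AE \<omega> in M. F q < 1 \<longrightarrow> (\<forall>m. \<exists>n\<ge>m. q < Z n \<omega>)"
    proof (cases "F q < 1")
      case True
      then have "AE \<omega> in M. \<forall>m. \<exists>n\<ge>m. q < Z n \<omega>" unfolding AE_all_countable using one by blast
      then show ?thesis by (rule AE_mp) simp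
    qed simp
  qed
  then show ?thesis
  proof eventually_elim
    case (elim \<omega>)
    show ?case
    proof (intro allI impI)
      fix x m assume x: "F x < 1"
      have "(F \<longlongrightarrow> F x) (at_right x)"
        using cont by (simp add: continuous_on_eq_continuous_at isCont_def filterlim_at_split)
      then have "\<forall>\<^sub>F y in at_right x. F y < 1" using x by (rule order_tendstoD)
      then obtain b where b: "b > x" "\<And>y. x < y \<Longrightarrow> y < b \<Longrightarrow> F y < 1"
        by (auto simp: eventually_at_right_field)
      obtain q where q: "q \<in> \<rat>" "x < q" "q < b" using Rats_dense_in_real[OF b(1)] by auto
      then obtain n where "n \<ge> m" "q < Z n \<omega>" using elim b(2) by blast
      then show "\<exists>n\<ge>m. x < Z n \<omega>" using q by (intro exI[of _ n]) auto
    qed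
  qed
qed

section \<open>Transfer of the record limits\<close>

text \<open>Three statements about a counting process which depend on its law only and do not feel an eventually
constant change of the count. Convergence is stated without naming the limit variable, since that variable is not
a function of the law.\<close>
definition record_limits :: "(nat \<Rightarrow> real) \<Rightarrow> 'a measure \<Rightarrow> (nat \<Rightarrow> 'a \<Rightarrow> real) \<Rightarrow> bool" where
  "record_limits \<alpha> M c \<longleftrightarrow>
     (AE \<omega> in M. (\<lambda>n. c n \<omega> / E_seq \<alpha> n) \<longlonglongrightarrow> 1) \<and>
     (convergent (V_seq \<alpha>) \<longrightarrow> (AE \<omega> in M. convergent (\<lambda>n. c n \<omega> - E_seq \<alpha> n))) \<and>
     (filterlim (V_seq \<alpha>) at_top sequentially \<longrightarrow>
       weak_conv_m (\<lambda>n. distr M borel (\<lambda>\<omega>. V_seq \<alpha> n powr (- 1 / 2) * (c n \<omega> - E_seq \<alpha> n)))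
         std_normal_distribution)"

lemma (in falpha_scheme) record_limits: "record_limits \<alpha> M (num_records Y)"
proof -
  interpret independent_trials M \<alpha> "record_indicator Y"
    by (rule record_indicators_independent_trials)
  have "num_records Y = successes" by (intro ext) (simp add: num_records_def successes_def)
  then show ?thesis
    unfolding record_limits_def using law_of_large_numbers centred_successes_converge central_limit by simp
qed

lemma (in growing_weights) record_limits_shift:
  assumes M: "prob_space M"
    and c: "\<And>n. c n \<in> borel_measurable M" and c': "\<And>n. c' n \<in> borel_measurable M"
    and diff: "AE \<omega> in M. \<exists>d. \<forall>\<^sub>F n in sequentially. c n \<omega> - c' n \<omega> = d"
    and limits: "record_limits \<alpha> M c"
  shows "record_limits \<alpha> M c'"
  unfolding record_limits_def
proof (intro conjI impI)
  have "AE \<omega> in M. (\<lambda>n. c n \<omega> / E_seq \<alpha> n) \<longlonglongrightarrow> 1" using limits by (simp add: record_limits_def)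
  with diff show "AE \<omega> in M. (\<lambda>n. c' n \<omega> / E_seq \<alpha> n) \<longlonglongrightarrow> 1"
  proof eventually_elim
    case (elim \<omega>)
    then obtain d where d: "\<forall>\<^sub>F n in sequentially. c n \<omega> - c' n \<omega> = d" by blast
    have "(\<lambda>n. d / E_seq \<alpha> n) \<longlonglongrightarrow> 0"
      by (rule tendsto_divide_0[OF tendsto_const filterlim_at_top_imp_at_infinity[OF E_at_top]])
    from tendsto_diff[OF elim(2) this] have "(\<lambda>n. c n \<omega> / E_seq \<alpha> n - d / E_seq \<alpha> n) \<longlonglongrightarrow> 1" by simp
    then show ?case
    proof (rule Lim_transform_eventually)
      show "\<forall>\<^sub>F n in sequentially. c n \<omega> / E_seq \<alpha> n - d / E_seq \<alpha> n = c' n \<omega> / E_seq \<alpha> n"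
        using d by eventually_elim (auto simp: diff_divide_distrib[symmetric])
    qed
  qed
next
  assume "convergent (V_seq \<alpha>)"
  then have "AE \<omega> in M. convergent (\<lambda>n. c n \<omega> - E_seq \<alpha> n)" using limits by (simp add: record_limits_def)
  with diff show "AE \<omega> in M. convergent (\<lambda>n. c' n \<omega> - E_seq \<alpha> n)"
  proof eventually_elim
    case (elim \<omega>)
    then obtain d where d: "\<forall>\<^sub>F n in sequentially. c n \<omega> - c' n \<omega> = d" by blast
    obtain L where L: "(\<lambda>n. c n \<omega> - E_seq \<alpha> n) \<longlonglongrightarrow> L" using elim(2) by (auto simp: convergent_def)
    have "(\<lambda>n. c' n \<omega> - E_seq \<alpha> n) \<longlonglongrightarrow> L - d"
      by (rule Lim_transform_eventually[OF tendsto_diff[OF L tendsto_const[of d]]])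
        (use d in eventually_elim, simp)
    then show ?case by (auto simp: convergent_def)
  qed
next
  assume V: "filterlim (V_seq \<alpha>) at_top sequentially"
  let ?Z = "\<lambda>c n \<omega>. V_seq \<alpha> n powr (- 1 / 2) * (c n \<omega> - E_seq \<alpha> n)"
  have "weak_conv_m (\<lambda>n. distr M borel (?Z c n)) std_normal_distribution"
    using limits V by (simp add: record_limits_def)
  then show "weak_conv_m (\<lambda>n. distr M borel (?Z c' n)) std_normal_distribution"
  proof (rule weak_conv_m_null_shift[OF M, rotated 4])
    show "AE \<omega> in M. (\<lambda>n. ?Z c n \<omega> - ?Z c' n \<omega>) \<longlonglongrightarrow> 0"
      using diff
    proof eventually_elim
      case (elim \<omega>)
      then obtain d where d: "\<forall>\<^sub>F n in sequentially. c n \<omega> - c' n \<omega> = d" by blast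
      have "(\<lambda>n. V_seq \<alpha> n powr (- 1 / 2)) \<longlonglongrightarrow> 0"
        by (rule tendsto_neg_powr[OF _ V]) simp
      then have "(\<lambda>n. V_seq \<alpha> n powr (- 1 / 2) * d) \<longlonglongrightarrow> 0" by (rule tendsto_mult_left_zero)
      then show ?case
        by (rule Lim_transform_eventually) (use d in eventually_elim, auto simp: right_diff_distrib[symmetric])
    qed
    show "?Z c n \<in> borel_measurable M" for n using c[of n] by measurable
    show "?Z c' n \<in> borel_measurable M" for n using c'[of n] by measurable
  qed (rule real_dist_normal_dist)
qed

lemma sets_Collect_tendsto:
  fixes f :: "nat \<Rightarrow> 'a \<Rightarrow> real"
  assumes [measurable]: "\<And>n. f n \<in> borel_measurable M"
  shows "{x \<in> space M. (\<lambda>n. f n x) \<longlonglongrightarrow> L} \<in> sets M"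
proof -
  have "(\<lambda>n. f n x) \<longlonglongrightarrow> L \<longleftrightarrow> Cauchy (\<lambda>n. f n x) \<and> lim (\<lambda>n. f n x) = L" for x
    by (metis Cauchy_convergent_iff LIMSEQ_imp_Cauchy convergent_LIMSEQ_iff limI)
  then have "{x \<in> space M. (\<lambda>n. f n x) \<longlonglongrightarrow> L} =
      {x \<in> space M. Cauchy (\<lambda>n. f n x)} \<inter> {x \<in> space M. lim (\<lambda>n. f n x) = L}" by auto
  also have "\<dots> \<in> sets M" by (intro sets.Int sets_Collect_Cauchy) measurable
  finally show ?thesis .
qed

lemma record_limits_same_law:
  assumes X: "\<And>k. k \<ge> 1 \<Longrightarrow> X k \<in> borel_measurable M" and Z: "\<And>k. k \<ge> 1 \<Longrightarrow> Z k \<in> borel_measurable N"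
    and law: "distr M (PiM {1..} (\<lambda>_. borel)) (\<lambda>\<omega>. \<lambda>n\<in>{1..}. X n \<omega>) = distr N (PiM {1..} (\<lambda>_. borel)) (\<lambda>\<omega>. \<lambda>n\<in>{1..}. Z n \<omega>)"
    and limits: "record_limits \<alpha> M (num_records X)"
  shows "record_limits \<alpha> N (num_records Z)"
proof -
  let ?P = "PiM {1..} (\<lambda>_::nat. borel :: real measure)"
  let ?X = "\<lambda>\<omega>. \<lambda>n\<in>{1..}. X n \<omega>" and ?Z = "\<lambda>\<omega>. \<lambda>n\<in>{1..}. Z n \<omega>"
  let ?R = "\<lambda>n. num_records (\<lambda>k s. s k) n :: (nat \<Rightarrow> real) \<Rightarrow> real"
  have Xm: "?X \<in> measurable M ?P" and Zm: "?Z \<in> measurable N ?P"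
    by (auto intro!: measurable_restrict X Z)
  have R [measurable]: "?R n \<in> borel_measurable ?P" for n
    by (intro num_records_measurable measurable_component_singleton) auto
  note transfer = AE_transfer_law[OF Xm Zm law]
  note coord = num_records_coordinates[of X] num_records_coordinates[of Z]
  show ?thesis
    unfolding record_limits_def
  proof (intro conjI impI)
    have "AE \<omega> in M. (\<lambda>n. ?R n (?X \<omega>) / E_seq \<alpha> n) \<longlonglongrightarrow> 1"
      using limits unfolding record_limits_def coord by blast
    then show "AE \<omega> in N. (\<lambda>n. num_records Z n \<omega> / E_seq \<alpha> n) \<longlonglongrightarrow> 1"
      unfolding coord by (rule transfer[rotated]) (rule sets_Collect_tendsto, measurable)
  next
    assume "convergent (V_seq \<alpha>)"
    then have "AE \<omega> in M. convergent (\<lambda>n. ?R n (?X \<omega>) - E_seq \<alpha> n)"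
      using limits unfolding record_limits_def coord by blast
    then show "AE \<omega> in N. convergent (\<lambda>n. num_records Z n \<omega> - E_seq \<alpha> n)"
      unfolding coord Cauchy_convergent_iff[symmetric]
      by (rule transfer[rotated]) (rule sets_Collect_Cauchy, measurable)
  next
    assume V: "filterlim (V_seq \<alpha>) at_top sequentially"
    let ?f = "\<lambda>n s. V_seq \<alpha> n powr (- 1 / 2) * (?R n s - E_seq \<alpha> n)"
    have f: "?f n \<in> borel_measurable ?P" for n by measurable
    have "distr M borel (\<lambda>\<omega>. ?f n (?X \<omega>)) = distr (distr M ?P ?X) borel (?f n)" for n
      by (subst distr_distr[OF f Xm]) (simp add: comp_def)
    moreover have "distr N borel (\<lambda>\<omega>. ?f n (?Z \<omega>)) = distr (distr N ?P ?Z) borel (?f n)" for n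
      by (subst distr_distr[OF f Zm]) (simp add: comp_def)
    ultimately have "distr M borel (\<lambda>\<omega>. ?f n (?X \<omega>)) = distr N borel (\<lambda>\<omega>. ?f n (?Z \<omega>))" for n
      by (simp only: law)
    moreover have "weak_conv_m (\<lambda>n. distr M borel (\<lambda>\<omega>. ?f n (?X \<omega>))) std_normal_distribution"
      using limits V unfolding record_limits_def coord by blast
    ultimately show "weak_conv_m (\<lambda>n. distr N borel (\<lambda>\<omega>. V_seq \<alpha> n powr (- 1 / 2) * (num_records Z n \<omega> - E_seq \<alpha> n)))
        std_normal_distribution"
      unfolding coord by (simp only:)
  qed
qed

text \<open>The condition that the maxima eventually exceed the thresholds concerns the law of the sequence
only. It is written with \<open>Suc m \<le> n\<close> because the maximum of the empty set at time \<open>0\<close> is an arbitrary value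
that need not be measurable.\<close>
lemma AE_exceeds_same_law:
  assumes X: "\<And>k. k \<ge> 1 \<Longrightarrow> X k \<in> borel_measurable M" and Z: "\<And>k. k \<ge> 1 \<Longrightarrow> Z k \<in> borel_measurable N"
    and law: "distr M (PiM {1..} (\<lambda>_. borel)) (\<lambda>\<omega>. \<lambda>n\<in>{1..}. X n \<omega>) = distr N (PiM {1..} (\<lambda>_. borel)) (\<lambda>\<omega>. \<lambda>n\<in>{1..}. Z n \<omega>)"
    and ev: "AE \<omega> in M. \<forall>\<^sub>F n in sequentially. l n < partial_max X n \<omega>"
  shows "AE \<omega> in N. \<forall>\<^sub>F n in sequentially. l n < partial_max Z n \<omega>"
proof -
  let ?P = "PiM {1..} (\<lambda>_::nat. borel :: real measure)"
  let ?R = "\<lambda>n. partial_max (\<lambda>k s. s k) n :: (nat \<Rightarrow> real) \<Rightarrow> real"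
  have eq: "(\<forall>\<^sub>F n in sequentially. l n < W n) \<longleftrightarrow> (\<exists>m. \<forall>n. Suc m \<le> n \<longrightarrow> l n < W n)" for W :: "nat \<Rightarrow> real"
    by (auto simp: eventually_sequentially intro: Suc_leD)
  have Xm: "(\<lambda>\<omega>. \<lambda>n\<in>{1..}. X n \<omega>) \<in> measurable M ?P" and Zm: "(\<lambda>\<omega>. \<lambda>n\<in>{1..}. Z n \<omega>) \<in> measurable N ?P"
    by (auto intro!: measurable_restrict X Z)
  have "{s \<in> space ?P. \<exists>m. \<forall>n. Suc m \<le> n \<longrightarrow> l n < ?R n s} \<in> sets ?P"
  proof (intro sets.sets_Collect_countable_Ex sets.sets_Collect_countable_All)
    fix m n :: nat
    show "{s \<in> space ?P. Suc m \<le> n \<longrightarrow> l n < ?R n s} \<in> sets ?P"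
    proof (cases "Suc m \<le> n")
      case True
      have "?R n \<in> borel_measurable ?P"
        using True by (intro partial_max_measurable measurable_component_singleton) auto
      then show ?thesis using True by simp
    qed simp
  qed
  from AE_transfer_law[OF Xm Zm law this] show ?thesis
    using ev unfolding eq partial_max_coordinates[of X] partial_max_coordinates[of Z] .
qed

lemma exceeds_truncate_at_iff:
  assumes "mono_on {1..} l"
  shows "(\<forall>\<^sub>F n in sequentially. l n < partial_max (truncate_at l X) n \<omega>) \<longleftrightarrow>
    (\<forall>\<^sub>F n in sequentially. l n < partial_max X n \<omega>)"
  by (intro eventually_cong[OF eventually_ge_at_top[of 1]]) (auto simp: partial_max_truncate_at[OF assms] less_max_iff_disj)

text \<open>The chain of comparisons
\<open>Y\<close>, \<open>max Y l\<close>, \<open>y\<close>, \<open>x\<close>, \<open>max X l\<close>, \<open>X\<close>, where \<open>x\<close> and \<open>y\<close> are the coupled copies of the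
truncated sequences. It is used twice: to carry the statement that the maxima eventually exceed the
thresholds from \<open>Y\<close> to \<open>X\<close>, and then to carry the limits of the record counts.\<close>
theorem (in growing_weights) records_under_C2:
  assumes M: "prob_space M" and X: "\<And>n. n \<ge> 1 \<Longrightarrow> X n \<in> borel_measurable M"
    and C2: "condition_C2 M X F \<alpha> l N Y" and atom: "no_endpoint_atom M X F"
  shows "record_limits \<alpha> M (num_records X)"
proof -
  interpret M: prob_space M by (rule M)
  have F: "is_df F" and cont: "continuous_on UNIV F" and l: "mono_on {1..} l"
    and endpoint: "\<And>n. n \<ge> 1 \<Longrightarrow> quantile_left_lim_1 (cdf (distr M borel (X n))) \<le> quantile_left_lim_1 F"
    and cond: "\<And>n. n \<ge> 2 \<Longrightarrow> \<exists>G. is_cond_df M X n G \<and>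
        (\<forall>xs \<in> {1..<n} \<rightarrow>\<^sub>E UNIV. \<forall>x\<ge>l n. G xs x = cdf (distr M borel (X n)) x)"
    and summ: "summable (\<lambda>n. delta_seq M X F \<alpha> l (Suc n))"
    and scheme: "Falpha_scheme N Y F \<alpha>"
    and exceed: "AE \<omega> in N. \<forall>\<^sub>F n in sequentially. l n < partial_max Y n \<omega>"
    using C2 by (auto simp: condition_C2_def)
  interpret Y: falpha_scheme N \<alpha> Y F
    using scheme F cont growing_weights_axioms
    by (auto simp: Falpha_scheme_def falpha_scheme_def falpha_scheme_axioms_def)
  have mono_F: "x \<le> y \<Longrightarrow> F x \<le> F y" for x y using F by (auto simp: is_df_def mono_def)
  let ?X = "truncate_at l X" and ?Y = "truncate_at l Y"
  have Xt: "?X n \<in> borel_measurable M" if "n \<ge> 1" for n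
    unfolding truncate_at_def[abs_def] using X[OF that] by measurable
  have Yt: "?Y n \<in> borel_measurable N" if "n \<ge> 1" for n
    unfolding truncate_at_def[abs_def] using Y.rv_Y[OF that] by measurable
  have indep_X: "M.indep_vars (\<lambda>_. borel) ?X {1..}"
    using M.truncations_indep[OF X cond] by (simp add: truncate_at_def[abs_def])
  have indep_Y: "Y.indep_vars (\<lambda>_. borel) ?Y {1..}"
    unfolding truncate_at_def[abs_def] by (rule Y.indep_vars_compose2[OF Y.indep_Y]) auto

  have law_X: "real_distribution (distr M borel (X n))" if "n \<ge> 1" for n
    using X[OF that] by (rule M.real_distribution_distr)
  have law_Y: "real_distribution (distr N borel (Y n))" if "n \<ge> 1" for n
    using Y.rv_Y[OF that] by (rule Y.real_distribution_distr)
  have Y_interval: "interval_measure (\<lambda>x. F x powr \<alpha> n) = distr N borel (Y n)" if n: "n \<ge> 1" for n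
  proof -
    have "(\<lambda>x. F x powr \<alpha> n) = cdf (distr N borel (Y n))" using Y.law[OF n] by auto
    then show ?thesis using interval_measure_cdf[OF law_Y[OF n]] by simp
  qed
  have trunc_law: "distr M borel (?X n) = distr (distr M borel (X n)) borel (\<lambda>x. max x (l n))"
    "distr N borel (?Y n) = distr (distr N borel (Y n)) borel (\<lambda>x. max x (l n))" if "n \<ge> 1" for n
    using X[OF that] Y.rv_Y[OF that] by (auto simp: distr_distr comp_def truncate_at_def[abs_def])
  have close: "\<bar>measure (distr M borel (?X n)) A - measure (distr N borel (?Y n)) A\<bar> \<le> 2 * delta_seq M X F \<alpha> l n"
    if n: "n \<ge> 1" and A: "A \<in> sets borel" for n A
    using truncated_laws_close[OF law_X[OF n] law_Y[OF n] A, of "l n"]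
    by (simp add: trunc_law[OF n] delta_seq_def Y_interval[OF n])
  \<comment> \<open>Index \<open>0\<close> does not occur in the sequences; it repeats index \<open>1\<close>.\<close>
  define P where "P n = distr M borel (?X (max 1 n))" for n
  define Q where "Q n = distr N borel (?Y (max 1 n))" for n
  have P: "real_distribution (P n)" for n unfolding P_def by (intro M.real_distribution_distr Xt) simp
  have Q: "real_distribution (Q n)" for n unfolding Q_def by (intro Y.real_distribution_distr Yt) simp
  have PQ: "\<bar>measure (P n) A - measure (Q n) A\<bar> \<le> 2 * delta_seq M X F \<alpha> l (max 1 n)" if "A \<in> sets borel" for n A
    unfolding P_def Q_def by (rule close[OF _ that]) simp
  have "summable (\<lambda>n. 2 * delta_seq M X F \<alpha> l (max 1 (Suc n)))"
    using summable_mult[OF summ, of 2] by simp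
  note coupling = independent_coupling[of P Q, OF P Q PQ this]
  obtain \<Omega> :: "(nat \<Rightarrow> real \<times> real) measure" and x y where \<Omega>: "prob_space \<Omega>"
    and indep_x: "prob_space.indep_vars \<Omega> (\<lambda>_. borel) x {1..}" and indep_y: "prob_space.indep_vars \<Omega> (\<lambda>_. borel) y {1..}"
    and law_x: "\<forall>n\<ge>1. distr \<Omega> borel (x n) = P n" and law_y: "\<forall>n\<ge>1. distr \<Omega> borel (y n) = Q n"
    and agree: "AE \<omega> in \<Omega>. \<forall>\<^sub>F n in sequentially. x n \<omega> = y n \<omega>"
    by (rule coupling) blast
  interpret \<Omega>: prob_space \<Omega> by (rule \<Omega>)
  have x: "x n \<in> borel_measurable \<Omega>" and y: "y n \<in> borel_measurable \<Omega>" if "n \<ge> 1" for n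
    using indep_x indep_y that by (auto simp: \<Omega>.indep_vars_def)
  have x_law: "distr \<Omega> borel (x n) = distr M borel (?X n)" and y_law: "distr \<Omega> borel (y n) = distr N borel (?Y n)" if "n \<ge> 1" for n
    using law_x law_y that by (auto simp: P_def Q_def max_def)
  let ?S = "PiM {1..} (\<lambda>_::nat. borel :: real measure)"
  have same_x: "distr \<Omega> ?S (\<lambda>\<omega>. \<lambda>n\<in>{1..}. x n \<omega>) = distr M ?S (\<lambda>\<omega>. \<lambda>n\<in>{1..}. ?X n \<omega>)"
    by (rule indep_sequences_same_law[OF \<Omega> M indep_x indep_X]) (rule x_law)
  have same_y: "distr N ?S (\<lambda>\<omega>. \<lambda>n\<in>{1..}. ?Y n \<omega>) = distr \<Omega> ?S (\<lambda>\<omega>. \<lambda>n\<in>{1..}. y n \<omega>)"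
    by (rule indep_sequences_same_law[OF Y.prob_space_axioms \<Omega> indep_Y indep_y]) (rule y_law[symmetric])

  have F_meas [measurable]: "F \<in> borel_measurable borel" by (rule borel_measurable_continuous_onI[OF cont])
  have Y_below: "AE \<omega> in N. F (Y n \<omega>) < 1" if n: "n \<ge> 1" for n
  proof -
    have "AE z in distr N borel (Y n). F z < 1"
    proof (rule AE_below_right_endpoint[OF law_Y[OF n] F])
      have "F z powr \<alpha> n < 1 \<longleftrightarrow> F z < 1" for z
      proof
        assume "F z powr \<alpha> n < 1"
        then show "F z < 1"
          using is_df_le_1[OF F, of z] by (cases "F z = 1") auto
      next
        assume "F z < 1"
        then show "F z powr \<alpha> n < 1"
          using powr_less_mono2[of "\<alpha> n" "F z" 1] weight_pos[OF n] is_df_nonneg[OF F, of z] by simp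
      qed
      then show le: "quantile_left_lim_1 (cdf (distr N borel (Y n))) \<le> quantile_left_lim_1 F"
        using quantile_left_lim_1_eq[OF F] quantile_left_lim_1_eq[OF is_df_cdf[OF law_Y[OF n]]] by (simp add: Y.law[OF n])
      show "AE z in distr N borel (Y n). ereal z \<noteq> quantile_left_lim_1 F"
      proof (cases "quantile_left_lim_1 F")
        case (real e)
        have "AE \<omega> in N. Y n \<omega> \<noteq> e" by (rule Y.AE_Y_neq[OF n])
        then show ?thesis using Y.rv_Y[OF n] real by (subst AE_distr_iff) auto
      qed auto
    qed
    then show ?thesis using Y.rv_Y[OF n] by (subst (asm) AE_distr_iff) auto
  qed
  \<comment> \<open>A threshold that reached the right endpoint could never be exceeded by the scheme.\<close>
  have l_below: "F (l k) < 1" if k: "k \<ge> 1" for k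
  proof -
    have "AE \<omega> in N. \<forall>n\<in>{1..}. F (Y n \<omega>) < 1" by (subst AE_ball_countable) (auto intro: Y_below)
    with exceed have "AE \<omega> in N. F (l k) < 1"
    proof eventually_elim
      case (elim \<omega>)
      then obtain m where m: "\<And>n. n \<ge> m \<Longrightarrow> l n < partial_max Y n \<omega>" by (auto simp: eventually_sequentially)
      define n where "n = max m k"
      have n: "n \<ge> 1" "n \<ge> m" "k \<le> n" using k by (auto simp: n_def)
      have "\<not> (\<forall>j\<in>{1..n}. Y j \<omega> \<le> l n)" using m[OF n(2)] partial_max_le_iff[OF n(1), of Y \<omega> "l n"] by auto
      then obtain j where j: "j \<in> {1..n}" "l n < Y j \<omega>" by (auto simp: not_le)
      have "F (l k) \<le> F (l n)" using mono_onD[OF l, of k n] k n by (intro mono_F) auto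
      also have "\<dots> \<le> F (Y j \<omega>)" using j by (intro mono_F) auto
      also have "\<dots> < 1" using elim(2) j by auto
      finally show ?case .
    qed
    then show ?thesis by simp
  qed
  have F_max: "F (max a (l n)) < 1" if "F a < 1" "n \<ge> 1" for a n
    using that l_below[of n] by (simp add: max_def)
  have x_below: "AE \<omega> in \<Omega>. \<forall>n\<in>{1..}. F (x n \<omega>) < 1"
  proof (subst AE_ball_countable, simp, intro ballI)
    fix n :: nat assume "n \<in> {1..}"
    then have n: "n \<ge> 1" by simp
    have "AE z in distr M borel (X n). F z < 1"
    proof (rule AE_below_right_endpoint[OF law_X[OF n] F endpoint[OF n]])
      show "AE z in distr M borel (X n). ereal z \<noteq> quantile_left_lim_1 F"
        using atom n X[OF n] by (subst AE_distr_iff) (auto simp: no_endpoint_atom_def)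
    qed
    then have "AE \<omega> in M. F (X n \<omega>) < 1" using X[OF n] by (subst (asm) AE_distr_iff) auto
    then have "AE \<omega> in M. F (?X n \<omega>) < 1"
      by eventually_elim (unfold truncate_at_def, rule F_max[OF _ n])
    then have "AE z in distr M borel (?X n). F z < 1" using Xt[OF n] by (subst AE_distr_iff) auto
    then have "AE z in distr \<Omega> borel (x n). F z < 1" by (simp only: x_law[OF n])
    then show "AE \<omega> in \<Omega>. F (x n \<omega>) < 1" using x[OF n] by (subst (asm) AE_distr_iff) auto
  qed
  have y_below: "AE \<omega> in \<Omega>. \<forall>n\<in>{1..}. F (y n \<omega>) < 1"
  proof (subst AE_ball_countable, simp, intro ballI)
    fix n :: nat assume "n \<in> {1..}"
    then have n: "n \<ge> 1" by simp
    have "AE \<omega> in N. F (?Y n \<omega>) < 1"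
      using Y_below[OF n] by eventually_elim (unfold truncate_at_def, rule F_max[OF _ n])
    then have "AE z in distr N borel (?Y n). F z < 1" using Yt[OF n] by (subst AE_distr_iff) auto
    then have "AE z in distr \<Omega> borel (y n). F z < 1" by (simp only: y_law[OF n])
    then show "AE \<omega> in \<Omega>. F (y n \<omega>) < 1" using y[OF n] by (subst (asm) AE_distr_iff) auto
  qed
  \<comment> \<open>Raising \<open>Y\<close> to the threshold only lowers the probability of staying below a level.\<close>
  have y_exceeds: "AE \<omega> in \<Omega>. \<forall>z. F z < 1 \<longrightarrow> (\<forall>m. \<exists>n\<ge>m. z < y n \<omega>)"
  proof (rule AE_exceeds_infinitely_often[OF growing_weights_axioms \<Omega> F cont indep_y])
    fix n :: nat and z assume n: "n \<ge> 1"
    have "\<Omega>.prob {\<omega> \<in> space \<Omega>. y n \<omega> \<le> z} = measure (distr \<Omega> borel (y n)) {..z}"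
      using y[OF n] by (subst measure_distr) (auto intro!: arg_cong[where f=\<Omega>.prob])
    also have "\<dots> = Y.prob {\<omega> \<in> space N. ?Y n \<omega> \<le> z}"
      unfolding y_law[OF n] using Yt[OF n] by (subst measure_distr) (auto intro!: arg_cong[where f=Y.prob])
    also have "\<dots> \<le> Y.prob {\<omega> \<in> space N. Y n \<omega> \<le> z}"
      using Y.rv_Y[OF n] by (intro Y.finite_measure_mono borel_measurable_le) (auto simp: truncate_at_def)
    finally show "\<Omega>.prob {\<omega> \<in> space \<Omega>. y n \<omega> \<le> z} \<le> F z powr \<alpha> n" by (simp add: Y.prob_Y_le[OF n])
  qed
  have coupled_max: "AE \<omega> in \<Omega>. \<forall>\<^sub>F n in sequentially. partial_max x n \<omega> = partial_max y n \<omega>"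
    using agree x_below y_below y_exceeds
  proof eventually_elim
    case (elim \<omega>)
    then obtain m where m: "\<And>n. n \<ge> m \<Longrightarrow> x n \<omega> = y n \<omega>" by (auto simp: eventually_sequentially)
    show ?case
    proof (rule partial_max_eventually_eq[of m])
      show "x n \<omega> = y n \<omega>" if "n \<ge> m" for n using m that .
      show "\<exists>n\<ge>m. x k \<omega> < y n \<omega>" "\<exists>n\<ge>m. y k \<omega> < y n \<omega>" if "k \<ge> 1" for k
        using elim(2-4) that by simp_all
    qed
  qed
  have coupled_records: "AE \<omega> in \<Omega>. \<forall>\<^sub>F n in sequentially. record_indicator x n \<omega> = record_indicator y n \<omega>"
    using coupled_max agree by eventually_elim (rule record_indicator_eventually_eq)

  have "AE \<omega> in N. \<forall>\<^sub>F n in sequentially. l n < partial_max ?Y n \<omega>"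
    using exceed by (simp only: exceeds_truncate_at_iff[OF l])
  then have "AE \<omega> in \<Omega>. \<forall>\<^sub>F n in sequentially. l n < partial_max y n \<omega>"
    by (rule AE_exceeds_same_law[OF _ _ same_y, rotated 2]) (rule Yt y, assumption)+
  with coupled_max have "AE \<omega> in \<Omega>. \<forall>\<^sub>F n in sequentially. l n < partial_max x n \<omega>"
  proof eventually_elim
    case (elim \<omega>)
    then show ?case by eventually_elim simp
  qed
  then have "AE \<omega> in M. \<forall>\<^sub>F n in sequentially. l n < partial_max ?X n \<omega>"
    by (rule AE_exceeds_same_law[OF _ _ same_x, rotated 2]) (rule x Xt, assumption)+
  then have exceed_X: "AE \<omega> in M. \<forall>\<^sub>F n in sequentially. l n < partial_max X n \<omega>"
    by (simp only: exceeds_truncate_at_iff[OF l])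

  have "record_limits \<alpha> N (num_records Y)" by (rule Y.record_limits)
  then have "record_limits \<alpha> N (num_records ?Y)"
  proof (rule record_limits_shift[OF Y.prob_space_axioms, rotated 3])
    show "AE \<omega> in N. \<exists>d. \<forall>\<^sub>F n in sequentially. num_records Y n \<omega> - num_records ?Y n \<omega> = d"
      using exceed by eventually_elim (intro num_records_eventually_const_diff truncation_keeps_records l)
  qed (auto intro!: num_records_measurable Y.rv_Y Yt)
  then have "record_limits \<alpha> \<Omega> (num_records y)"
    by (rule record_limits_same_law[OF _ _ same_y, rotated 2]) (rule Yt y, assumption)+
  then have "record_limits \<alpha> \<Omega> (num_records x)"
  proof (rule record_limits_shift[OF \<Omega>, rotated 3])
    show "AE \<omega> in \<Omega>. \<exists>d. \<forall>\<^sub>F n in sequentially. num_records y n \<omega> - num_records x n \<omega> = d"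
      using coupled_records by eventually_elim (intro num_records_eventually_const_diff, auto elim: eventually_mono)
  qed (auto intro!: num_records_measurable x y)
  then have "record_limits \<alpha> M (num_records ?X)"
    by (rule record_limits_same_law[OF _ _ same_x, rotated 2]) (rule x Xt, assumption)+
  then show ?thesis
  proof (rule record_limits_shift[OF M, rotated 3])
    show "AE \<omega> in M. \<exists>d. \<forall>\<^sub>F n in sequentially. num_records ?X n \<omega> - num_records X n \<omega> = d"
      using exceed_X
    proof eventually_elim
      case (elim \<omega>)
      from truncation_keeps_records[OF l elim] show ?case
        by (intro num_records_eventually_const_diff) (auto elim: eventually_mono)
    qed
  qed (auto intro!: num_records_measurable X Xt)
qed

lemma (in growing_weights) E_over_ln_s_bounded: "\<forall>\<^sub>F n in sequentially. \<bar>E_seq \<alpha> n / ln (s_seq \<alpha> n)\<bar> \<le> 2"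
proof -
  have "\<forall>\<^sub>F n in sequentially. ln (s_seq \<alpha> n) \<ge> max 1 (1 - ln (\<alpha> 1))"
    using ln_s_at_top unfolding filterlim_at_top by blast
  then show ?thesis using eventually_ge_at_top[of 1]
  proof eventually_elim
    case (elim n)
    have "0 \<le> E_seq \<alpha> n" using monoD[OF E_mono, of 0 n] by simp
    moreover have "E_seq \<alpha> n \<le> 2 * ln (s_seq \<alpha> n)" using E_le_ln_s[OF elim(2)] elim(1) by simp
    moreover have "0 < ln (s_seq \<alpha> n)" using elim(1) by linarith
    ultimately show ?case by (simp add: abs_of_nonneg divide_le_eq)
  qed
qed

text \<open>With \<open>c / E \<rightarrow> 1\<close> the remaining statements only involve \<open>E\<close> and \<open>ln s\<close>: multiply the relative error
\<open>c / E - 1\<close> by \<open>E / ln s\<close>, which is bounded.\<close>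
lemma (in growing_weights) count_over_E_consequences:
  assumes c: "(\<lambda>n. c n / E_seq \<alpha> n) \<longlonglongrightarrow> 1"
  shows "filterlim c at_top sequentially"
    and "(\<lambda>n. (c n - E_seq \<alpha> n) / ln (s_seq \<alpha> n)) \<longlonglongrightarrow> 0"
    and "(\<lambda>n. E_seq \<alpha> n / ln (s_seq \<alpha> n)) \<longlonglongrightarrow> L \<Longrightarrow> (\<lambda>n. c n / ln (s_seq \<alpha> n)) \<longlonglongrightarrow> L"
proof -
  have E: "\<forall>\<^sub>F n in sequentially. E_seq \<alpha> n > 0"
    using E_at_top by (simp add: filterlim_at_top_dense)
  have "filterlim (\<lambda>n. c n / E_seq \<alpha> n * E_seq \<alpha> n) at_top sequentially"
    by (rule filterlim_tendsto_pos_mult_at_top[OF c _ E_at_top]) simp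
  moreover have "\<forall>\<^sub>F n in sequentially. c n / E_seq \<alpha> n * E_seq \<alpha> n = c n"
    using E by eventually_elim simp
  ultimately show "filterlim c at_top sequentially"
    by (rule filterlim_cong[THEN iffD1, OF refl refl, rotated])
  have "(\<lambda>n. c n / E_seq \<alpha> n - 1) \<longlonglongrightarrow> 0" using tendsto_diff[OF c tendsto_const[of 1]] by simp
  then have "(\<lambda>n. \<bar>c n / E_seq \<alpha> n - 1\<bar> * 2) \<longlonglongrightarrow> 0"
    by (intro tendsto_mult_left_zero tendsto_rabs_zero)
  then show "(\<lambda>n. (c n - E_seq \<alpha> n) / ln (s_seq \<alpha> n)) \<longlonglongrightarrow> 0"
  proof (rule Lim_null_comparison[rotated])
    show "\<forall>\<^sub>F n in sequentially. norm ((c n - E_seq \<alpha> n) / ln (s_seq \<alpha> n)) \<le> \<bar>c n / E_seq \<alpha> n - 1\<bar> * 2"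
      using E E_over_ln_s_bounded
    proof eventually_elim
      case (elim n)
      have "(c n - E_seq \<alpha> n) / ln (s_seq \<alpha> n) = (c n / E_seq \<alpha> n - 1) * (E_seq \<alpha> n / ln (s_seq \<alpha> n))"
        using elim(1) by (simp add: left_diff_distrib diff_divide_distrib)
      then show ?case using elim(2) by (simp only: real_norm_def abs_mult) (intro mult_left_mono, auto)
    qed
  qed
  assume "(\<lambda>n. E_seq \<alpha> n / ln (s_seq \<alpha> n)) \<longlonglongrightarrow> L"
  from tendsto_mult[OF c this] have "(\<lambda>n. c n / E_seq \<alpha> n * (E_seq \<alpha> n / ln (s_seq \<alpha> n))) \<longlonglongrightarrow> L" by simp
  then show "(\<lambda>n. c n / ln (s_seq \<alpha> n)) \<longlonglongrightarrow> L"
    by (rule Lim_transform_eventually) (use E in eventually_elim, simp)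
qed

theorem corollary1:
  fixes M :: "'a measure" and X :: "nat \<Rightarrow> 'a \<Rightarrow> real"
    and N :: "'b measure" and Y :: "nat \<Rightarrow> 'b \<Rightarrow> real"
    and F :: "real \<Rightarrow> real" and \<alpha> l :: "nat \<Rightarrow> real"
  assumes "prob_space M"
    and "\<And>n. n \<ge> 1 \<Longrightarrow> X n \<in> borel_measurable M"
    and "condition_C2 M X F \<alpha> l N Y"
    and "no_endpoint_atom M X F"
  shows
    "(AE \<omega> in M. filterlim (\<lambda>n. num_records X n \<omega>) at_top sequentially) \<and>
     (AE \<omega> in M. (\<lambda>n. num_records X n \<omega> / E_seq \<alpha> n) \<longlonglongrightarrow> 1) \<and>
     ((AE \<omega> in M. (\<lambda>n. (num_records X n \<omega> - E_seq \<alpha> n) / ln (s_seq \<alpha> n)) \<longlonglongrightarrow> 0) \<and>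
      (p_seq \<alpha> \<longlonglongrightarrow> 0 \<longrightarrow>
         (AE \<omega> in M. (\<lambda>n. num_records X n \<omega> / ln (s_seq \<alpha> n)) \<longlonglongrightarrow> 1)) \<and>
      (p_seq \<alpha> \<longlonglongrightarrow> 1 \<longrightarrow>
         (AE \<omega> in M. (\<lambda>n. num_records X n \<omega> / ln (s_seq \<alpha> n)) \<longlonglongrightarrow> 0))) \<and>
     ((convergent (V_seq \<alpha>) \<longrightarrow>
         (\<exists>Z \<in> borel_measurable M.
            AE \<omega> in M. (\<lambda>n. num_records X n \<omega> - E_seq \<alpha> n) \<longlonglongrightarrow> (Z \<omega> :: real))) \<and>
      (filterlim (V_seq \<alpha>) at_top sequentially \<longrightarrow>
         weak_conv_m
           (\<lambda>n. distr M borel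
              (\<lambda>\<omega>. V_seq \<alpha> n powr (- 1 / 2) * (num_records X n \<omega> - E_seq \<alpha> n)))
           std_normal_distribution))"
proof -
  interpret growing_weights \<alpha>
    using assms(3) by unfold_locales (auto simp: condition_C2_def)
  have limits: "record_limits \<alpha> M (num_records X)"
    by (rule records_under_C2[OF assms])
  then have lln: "AE \<omega> in M. (\<lambda>n. num_records X n \<omega> / E_seq \<alpha> n) \<longlonglongrightarrow> 1"
    by (simp add: record_limits_def)
  show ?thesis
  proof (intro conjI impI)
    show "AE \<omega> in M. filterlim (\<lambda>n. num_records X n \<omega>) at_top sequentially"
      using lln by eventually_elim (rule count_over_E_consequences)
    show "AE \<omega> in M. (\<lambda>n. num_records X n \<omega> / E_seq \<alpha> n) \<longlonglongrightarrow> 1" by (rule lln)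
    show "AE \<omega> in M. (\<lambda>n. (num_records X n \<omega> - E_seq \<alpha> n) / ln (s_seq \<alpha> n)) \<longlonglongrightarrow> 0"
      using lln by eventually_elim (rule count_over_E_consequences)
    show "AE \<omega> in M. (\<lambda>n. num_records X n \<omega> / ln (s_seq \<alpha> n)) \<longlonglongrightarrow> 1" if "p_seq \<alpha> \<longlonglongrightarrow> 0"
      using lln by eventually_elim (rule count_over_E_consequences(3)[OF _ E_over_ln_s_if_p_vanishes[OF that]])
    show "AE \<omega> in M. (\<lambda>n. num_records X n \<omega> / ln (s_seq \<alpha> n)) \<longlonglongrightarrow> 0" if "p_seq \<alpha> \<longlonglongrightarrow> 1"
      using lln by eventually_elim (rule count_over_E_consequences(3)[OF _ E_over_ln_s_if_p_to_1[OF that]])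
    show "\<exists>Z\<in>borel_measurable M. AE \<omega> in M. (\<lambda>n. num_records X n \<omega> - E_seq \<alpha> n) \<longlonglongrightarrow> (Z \<omega> :: real)"
      if "convergent (V_seq \<alpha>)"
    proof (rule bexI)
      have "AE \<omega> in M. convergent (\<lambda>n. num_records X n \<omega> - E_seq \<alpha> n)"
        using limits that by (simp add: record_limits_def)
      then show "AE \<omega> in M. (\<lambda>n. num_records X n \<omega> - E_seq \<alpha> n) \<longlonglongrightarrow> lim (\<lambda>n. num_records X n \<omega> - E_seq \<alpha> n)"
        by eventually_elim (simp add: convergent_LIMSEQ_iff)
      show "(\<lambda>\<omega>. lim (\<lambda>n. num_records X n \<omega> - E_seq \<alpha> n)) \<in> borel_measurable M"
      proof (rule borel_measurable_lim_metric)
        show "(\<lambda>\<omega>. num_records X n \<omega> - E_seq \<alpha> n) \<in> borel_measurable M" for n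
          by (intro borel_measurable_diff num_records_measurable assms(2)) auto
      qed
    qed
    show "weak_conv_m (\<lambda>n. distr M borel (\<lambda>\<omega>. V_seq \<alpha> n powr (- 1 / 2) * (num_records X n \<omega> - E_seq \<alpha> n)))
        std_normal_distribution" if "filterlim (V_seq \<alpha>) at_top sequentially"
      using limits that by (simp add: record_limits_def)
  qed
qed

end
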